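(* Let $K$ be a finitely generated field of characteristic $0$ and let $S$ be a Puiseux monoid. Then the monoid algebra $K[S]$ is a finite factorization domain (FFD) if and only if $S$ is a finite factorization monoid (FFM).
   Context: A finitely generated field of characteristic $0$ is a field that is finitely generated as a field over its prime field $\mathbb{Q}$. A Puiseux monoid is an additive submonoid of $\mathbb{Q}_+$, the additive monoid of non-negative rational numbers. For a field $K$ and a Puiseux monoid $S$, the monoid algebra (Puiseux algebra) $K[S]$ is the ring of all finite sums $\sum_i a_i X^{s_i}$ with $a_i\in K$, $s_i\in S$, with multiplication determined by $X^sX^t=X^{s+t}$; it is an integral domain. For a commutative cancellative monoid $M$ (written multiplicatively here) with group of units $U(M)$: $s$ divides $t$ in $M$ if $t=rs$ for some $r\in M$; $s$ and $t$ are associate if $t=us$ for some $u\in U(M)$; a nonunit is irreducible (an atom) if it is not a product of two nonunits; $M$ is atomic if each nonunit is a finite product of irreducibles. $M$ is a finite factorization monoid (FFM) if it is atomic and each nonunit has only finitely many non-associate irreducible divisors; equivalently, each nonunit of $M$ has only finitely many non-associate divisors in $M$. For an additive monoid such as $S$ these notions are read additively (so $s$ divides $t$ in $S$ if $t-s\in S$). An integral domain $D$ is a finite factorization domain (FFD) if its multiplicative monoid $D\setminus\{0\}$ is an FFM; equivalently, every nonzero nonunit of $D$ has only finitely many non-associate divisors. *)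

theory Defs
  imports Complex_Main "HOL-Algebra.Ring_Divisibility" "HOL-Library.Poly_Mapping"
begin

definition is_subfield :: "'k::field set \<Rightarrow> bool" where
  "is_subfield F \<longleftrightarrow> 0 \<in> F \<and> 1 \<in> F
     \<and> (\<forall>x\<in>F. \<forall>y\<in>F. x + y \<in> F \<and> x * y \<in> F)
     \<and> (\<forall>x\<in>F. - x \<in> F \<and> inverse x \<in> F)"

text \<open>The field is the type \<open>'k\<close> itself; \<open>\<rat>\<close> is its prime field.\<close>

definition finitely_generated_field :: "'k::field_char_0 itself \<Rightarrow> bool" where
  "finitely_generated_field _ \<longleftrightarrow>
     (\<exists>A::'k set. finite A \<and> is_subfield hull (\<rat> \<union> A) = UNIV)"

definition puiseux_monoid :: "rat set \<Rightarrow> bool" where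
  "puiseux_monoid S \<longleftrightarrow> 0 \<in> S \<and> (\<forall>s\<in>S. 0 \<le> s) \<and> (\<forall>s\<in>S. \<forall>t\<in>S. s + t \<in> S)"

definition additive_monoid :: "'a::comm_monoid_add set \<Rightarrow> 'a monoid" where
  "additive_monoid S = \<lparr>carrier = S, mult = (+), one = 0\<rparr>"

text \<open>A finitely supported function \<open>p\<close> stands for the sum of the
  \<open>lookup p s X\<^sup>s\<close>; multiplication on \<open>\<Rightarrow>\<^sub>0\<close> is convolution.\<close>

definition monoid_algebra ::
    "'a::comm_monoid_add set \<Rightarrow> ('a \<Rightarrow>\<^sub>0 'k::comm_ring_1) ring" where
  "monoid_algebra S =
     \<lparr>carrier = {p. Poly_Mapping.keys p \<subseteq> S}, mult = (*), one = 1, zero = 0, add = (+)\<rparr>"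

definition atomic_monoid :: "('a, 'b) monoid_scheme \<Rightarrow> bool" where
  "atomic_monoid G \<longleftrightarrow>
     (\<forall>a \<in> carrier G - Units G. \<exists>fs. set fs \<subseteq> carrier G \<and> factors G fs a)"

text \<open>Non-associate divisors are counted by their association classes.\<close>

definition ffm :: "('a, 'b) monoid_scheme \<Rightarrow> bool" where
  "ffm G \<longleftrightarrow> comm_monoid_cancel G \<and> atomic_monoid G \<and>
     (\<forall>a \<in> carrier G - Units G.
        finite (assocs G `
          {d \<in> carrier G. Divisibility.irreducible G d \<and> d divides\<^bsub>G\<^esub> a}))"

definition ffd :: "('a, 'b) ring_scheme \<Rightarrow> bool" where
  "ffd R \<longleftrightarrow> domain R \<and> ffm (mult_of R)"

text \<open>The library defines association by mutual divisibility and irreducibility by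
  proper factors. In a commutative cancellative monoid these are the usual notions.\<close>

lemma (in comm_monoid_cancel) associated_iff_unit_multiple:
  assumes "a \<in> carrier G" "b \<in> carrier G"
  shows "a \<sim> b \<longleftrightarrow> (\<exists>u\<in>Units G. a = u \<otimes> b)"
proof
  assume "a \<sim> b"
  then obtain u where "u \<in> Units G" "a = b \<otimes> u"
    using assms by (elim associatedE2)
  then show "\<exists>u\<in>Units G. a = u \<otimes> b"
    using assms m_comm Units_closed by blast
next
  assume "\<exists>u\<in>Units G. a = u \<otimes> b"
  then show "a \<sim> b"
    using assms m_comm Units_closed by (metis associatedI2)
qed

lemma (in comm_monoid_cancel) irreducible_iff_not_product:
  assumes a: "a \<in> carrier G"
  shows "Divisibility.irreducible G a \<longleftrightarrow> a \<notin> Units G \<and>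
    \<not> (\<exists>b \<in> carrier G - Units G. \<exists>c \<in> carrier G - Units G. a = b \<otimes> c)"
proof (intro iffI conjI notI)
  assume irr: "Divisibility.irreducible G a"
  show "a \<in> Units G \<Longrightarrow> False" using irr by (simp add: Divisibility.irreducible_def)
  assume "\<exists>b \<in> carrier G - Units G. \<exists>c \<in> carrier G - Units G. a = b \<otimes> c"
  then obtain b c where "b \<in> carrier G - Units G" "c \<in> carrier G - Units G" "a = b \<otimes> c"
    by blast
  then show False using irr irreducible_prodE by blast
next
  assume *: "a \<notin> Units G \<and>
    \<not> (\<exists>b \<in> carrier G - Units G. \<exists>c \<in> carrier G - Units G. a = b \<otimes> c)"
  show "Divisibility.irreducible G a"
    unfolding Divisibility.irreducible_def
  proof (intro conjI ballI impI)
    show "a \<notin> Units G" using * by blast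
    fix b assume b: "b \<in> carrier G" and pf: "properfactor G b a"
    then obtain c where c: "c \<in> carrier G" "a = b \<otimes> c"
      by (auto simp: properfactor_def factor_def)
    have "c \<notin> Units G"
      using b c pf associatedI2' unfolding properfactor_def associated_def by blast
    then show "b \<in> Units G" using * b c by blast
  qed
qed

lemma domain_monoid_algebra:
  assumes "puiseux_monoid S"
  shows "domain (monoid_algebra S :: (rat \<Rightarrow>\<^sub>0 'k::field_char_0) ring)"
proof -
  let ?R = "monoid_algebra S :: (rat \<Rightarrow>\<^sub>0 'k) ring"
  have 0: "0 \<in> S" and add: "\<And>s t. s \<in> S \<Longrightarrow> t \<in> S \<Longrightarrow> s + t \<in> S"
    using assms by (auto simp: puiseux_monoid_def)
  have closed_add: "Poly_Mapping.keys (p + q) \<subseteq> S"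
    if "Poly_Mapping.keys p \<subseteq> S" "Poly_Mapping.keys q \<subseteq> S" for p q :: "rat \<Rightarrow>\<^sub>0 'k"
    using that Poly_Mapping.keys_add[of p q] by blast
  have closed_mult: "Poly_Mapping.keys (p * q) \<subseteq> S"
    if "Poly_Mapping.keys p \<subseteq> S" "Poly_Mapping.keys q \<subseteq> S" for p q :: "rat \<Rightarrow>\<^sub>0 'k"
    using that Poly_Mapping.keys_mult[of p q] add by blast
  have "cring ?R"
  proof (rule cringI)
    show "abelian_group ?R"
    proof (rule abelian_groupI)
      fix p assume "p \<in> carrier ?R"
      then show "\<exists>q\<in>carrier ?R. q \<oplus>\<^bsub>?R\<^esub> p = \<zero>\<^bsub>?R\<^esub>"
        by (intro bexI[of _ "- p"]) (auto simp: monoid_algebra_def)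
    qed (use closed_add in \<open>auto simp: monoid_algebra_def algebra_simps\<close>)
    show "Group.comm_monoid ?R"
      by (rule comm_monoidI)
        (use closed_mult 0 in \<open>auto simp: monoid_algebra_def algebra_simps\<close>)
  qed (auto simp: monoid_algebra_def algebra_simps)
  then show ?thesis
    by (rule domain.intro) (auto simp: domain_axioms_def monoid_algebra_def)
qed

end

theory Submission
  imports Defs "Jordan_Normal_Form.Char_Poly" "Berlekamp_Zassenhaus.Factor_Bound"
    "HOL-Algebra.Algebraic_Closure_Type"
begin

hide_const (open) Polynomials.degree Polynomials.lead_coeff

text \<open>
If \<open>G\<close> divides \<open>f\<close> in \<open>K[S]\<close>, then the least and the greatest exponent of \<open>G\<close> divide those of \<open>f\<close> in \<open>S\<close>, so
  they take finitely many values when \<open>S\<close> is an FFM. To bound the other exponents, write \<open>f = \<psi>(Y^n)\<close>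
  with \<open>Y = X^(1/l)\<close> for a large denominator \<open>l\<close>, and split \<open>G = c Y^d G1 G2\<close> over the algebraic closure
  of \<open>K\<close>, where the roots of \<open>G1\<close> are roots of unity and those of \<open>G2\<close> are not.

  The support of \<open>G1\<close> is symmetric, as complex conjugation inverts roots of unity. On the other hand,
  \<open>G2\<close> is a polynomial in \<open>Y^q\<close>, where \<open>n/q\<close> depends only on \<open>\<psi>\<close>: in a finitely generated field \<open>L\<close>
  an element \<open>\<alpha>\<close> that is not a root of unity satisfies \<open>\<gamma>^n = \<alpha>^k\<close> with \<open>\<gamma> \<in> L\<close> only if \<open>n \<le> N k\<close>, so
  the number of conjugacy classes over \<open>L\<close> of \<open>n\<close>-th roots of \<open>\<alpha>\<close> is bounded. Once this number is
  maximal, \<open>n\<close>-th roots of \<open>\<alpha>\<close> with the same \<open>q\<close>-th power are conjugate. Hence every exponent \<open>s\<close> of \<open>G\<close> has a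
  partner \<open>s'\<close> among the exponents of \<open>G\<close> such that \<open>s + s'\<close> has a bounded denominator. So \<open>s\<close> divides
  in \<open>S\<close> one of finitely many elements, and all divisors of \<open>f\<close> lie in one ring \<open>K[X^(1/l)]\<close>, which is
  factorial.
\<close>

section \<open>Subfields, finite extensions and algebraic elements\<close>

text \<open>A divisor \<open>G\<close> brings its own denominator \<open>m\<close>, which nothing
  bounds in advance. So every constant has to be uniform in \<open>n\<close> and may depend on
  \<open>f\<close> only.

  Torsion roots are the obstacle. The support of a cyclotomic polynomial of prime index has no gaps,
  so no bound on the denominators in \<open>G1\<close> can be expected. Only the reflection of its
  support is available, and it controls sums of two exponents. Such a sum lies in \<open>S\<close>,
  has a bounded denominator and is at most twice the greatest exponent of \<open>f\<close>, which
  leaves finitely many values.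

  The hypothesis on \<open>K\<close> enters through the bound on \<open>n\<close>: in an
  algebraically closed field every \<open>\<alpha>\<close> has \<open>n\<close>-th roots for all
  \<open>n\<close>. The field \<open>L\<close> consists of \<open>K\<close> and the roots of
  \<open>\<psi>\<close>; it is still finitely generated, and it is reached from the rationals by
  adjoining one element at a time.

  For the converse, every factor of a monomial is a monomial, so \<open>K[S]\<close> contains the
  factorizations of \<open>S\<close> unchanged up to units.\<close>

lemma is_subfieldD:
  assumes "is_subfield F"
  shows subfield_0: "0 \<in> F" and subfield_1: "1 \<in> F"
    and subfield_add: "x \<in> F \<Longrightarrow> y \<in> F \<Longrightarrow> x + y \<in> F"
    and subfield_mult: "x \<in> F \<Longrightarrow> y \<in> F \<Longrightarrow> x * y \<in> F"
    and subfield_uminus: "x \<in> F \<Longrightarrow> - x \<in> F"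
    and subfield_inverse: "x \<in> F \<Longrightarrow> inverse x \<in> F"
  using assms by (auto simp: is_subfield_def)

lemma subfield_diff: "is_subfield F \<Longrightarrow> x \<in> F \<Longrightarrow> y \<in> F \<Longrightarrow> x - y \<in> F"
  using subfield_add[of F x "- y"] subfield_uminus[of F y] by simp

lemma subfield_divide: "is_subfield F \<Longrightarrow> x \<in> F \<Longrightarrow> y \<in> F \<Longrightarrow> x / y \<in> F"
  using subfield_mult[of F x "inverse y"] subfield_inverse[of F y] by (simp add: divide_inverse)

lemma subfield_power: "is_subfield F \<Longrightarrow> x \<in> F \<Longrightarrow> x ^ n \<in> F"
  by (induction n) (auto simp: is_subfieldD)

lemma subfield_sum: "is_subfield F \<Longrightarrow> (\<And>i. i \<in> I \<Longrightarrow> f i \<in> F) \<Longrightarrow> sum f I \<in> F"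
  by (induction I rule: infinite_finite_induct) (auto simp: is_subfieldD)

lemma subfield_of_nat: "is_subfield F \<Longrightarrow> of_nat n \<in> F"
  by (induction n) (auto simp: is_subfieldD)

lemmas subfield_closed = subfield_0 subfield_1 subfield_add subfield_mult subfield_uminus
  subfield_inverse subfield_diff subfield_divide subfield_power subfield_sum subfield_of_nat

lemma subfield_Rats:
  assumes "is_subfield (F :: 'a::field_char_0 set)"
  shows "\<rat> \<subseteq> F"
proof
  fix x :: 'a assume "x \<in> \<rat>"
  then obtain a b :: int where x: "x = of_int a / of_int b"
    by (metis Rats_cases' )
  have int: "of_int i \<in> F" for i
    by (cases i rule: int_cases2) (auto intro!: subfield_closed assms)
  show "x \<in> F" unfolding x by (intro subfield_divide assms int)
qed

lemma is_subfield_Rats: "is_subfield (\<rat> :: 'a::field_char_0 set)"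
  by (auto simp: is_subfield_def)

lemma is_subfield_Inter: "(\<And>F. F \<in> T \<Longrightarrow> is_subfield F) \<Longrightarrow> is_subfield (\<Inter>T)"
  by (auto simp: is_subfield_def)

lemma is_subfield_hull: "is_subfield (is_subfield hull A)"
  by (rule hull_in) (simp add: is_subfield_Inter)

section \<open>Polynomials with coefficients in a subfield\<close>

definition polys_over :: "'a::field set \<Rightarrow> 'a poly set" where
  "polys_over F = {p. \<forall>i. coeff p i \<in> F}"

lemma polys_overI: "(\<And>i. coeff p i \<in> F) \<Longrightarrow> p \<in> polys_over F"
  and polys_overD: "p \<in> polys_over F \<Longrightarrow> coeff p i \<in> F"
  by (auto simp: polys_over_def)

lemma polys_over_mono: "F \<subseteq> G \<Longrightarrow> polys_over F \<subseteq> polys_over G"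
  by (auto simp: polys_over_def)

context
  fixes F :: "'a::field set"
  assumes F: "is_subfield F"
begin

lemma polys_over_0 [simp]: "0 \<in> polys_over F"
  and polys_over_1 [simp]: "1 \<in> polys_over F"
  using F by (auto simp: polys_over_def subfield_closed)

lemma polys_over_pCons: "pCons c p \<in> polys_over F \<longleftrightarrow> c \<in> F \<and> p \<in> polys_over F"
  by (force simp: polys_over_def coeff_pCons split: nat.splits)

lemma polys_over_add: "p \<in> polys_over F \<Longrightarrow> q \<in> polys_over F \<Longrightarrow> p + q \<in> polys_over F"
  and polys_over_diff: "p \<in> polys_over F \<Longrightarrow> q \<in> polys_over F \<Longrightarrow> p - q \<in> polys_over F"
  and polys_over_smult: "c \<in> F \<Longrightarrow> p \<in> polys_over F \<Longrightarrow> smult c p \<in> polys_over F"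
  and polys_over_mult: "p \<in> polys_over F \<Longrightarrow> q \<in> polys_over F \<Longrightarrow> p * q \<in> polys_over F"
  and polys_over_monom: "c \<in> F \<Longrightarrow> monom c n \<in> polys_over F"
  and polys_over_pderiv: "p \<in> polys_over F \<Longrightarrow> pderiv p \<in> polys_over F"
  using F by (auto simp: polys_over_def coeff_mult coeff_pderiv intro!: subfield_closed)

lemma polys_over_sum: "(\<And>i. i \<in> I \<Longrightarrow> f i \<in> polys_over F) \<Longrightarrow> sum f I \<in> polys_over F"
  by (induction I rule: infinite_finite_induct) (auto intro: polys_over_add)

lemma polys_over_pcompose:
  "p \<in> polys_over F \<Longrightarrow> q \<in> polys_over F \<Longrightarrow> pcompose p q \<in> polys_over F"
proof (induction p)
  case (pCons c p)
  then show ?case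
    by (auto simp: pcompose_pCons polys_over_pCons intro!: polys_over_add polys_over_mult)
qed auto

lemma polys_over_power: "p \<in> polys_over F \<Longrightarrow> p ^ n \<in> polys_over F"
  by (induction n) (auto intro: polys_over_mult)

lemma poly_in_subfield: "p \<in> polys_over F \<Longrightarrow> x \<in> F \<Longrightarrow> poly p x \<in> F"
  by (induction p) (use F in \<open>auto simp: polys_over_pCons subfield_closed\<close>)

lemma polys_over_division:
  assumes p: "p \<in> polys_over F" "p \<noteq> 0" and g: "g \<in> polys_over F"
  shows "\<exists>s \<in> polys_over F. \<exists>r \<in> polys_over F. g = p * s + r \<and> (r = 0 \<or> degree r < degree p)"
  using g
proof (induction "degree g" arbitrary: g rule: less_induct)
  case less
  show ?case
  proof (cases "g = 0 \<or> degree g < degree p")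
    case True
    then show ?thesis by (intro bexI[of _ 0] bexI[of _ g]) (use less.prems in auto)
  next
    case False
    define t where "t = monom (lead_coeff g / lead_coeff p) (degree g - degree p)"
    have t: "t \<in> polys_over F" unfolding t_def
      by (intro polys_over_monom subfield_divide F polys_overD p less.prems)
    define g' where "g' = g - p * t"
    have g': "g' \<in> polys_over F" unfolding g'_def
      by (intro polys_over_diff polys_over_mult t p less.prems)
    have "t \<noteq> 0" "degree t = degree g - degree p" "lead_coeff t = lead_coeff g / lead_coeff p"
      using False p by (auto simp: t_def degree_monom_eq)
    then have dpt: "degree (p * t) = degree g" "lead_coeff (p * t) = lead_coeff g"
      using False p lead_coeff_mult[of p t] by (auto simp: degree_mult_eq)
    have "g' = 0 \<or> degree g' < degree g"
    proof (cases "degree g = 0")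
      case True
      then have "degree g' = 0" using dpt degree_diff_le[of g 0 "p * t"] by (simp add: g'_def)
      moreover have "coeff g' 0 = 0" using dpt True by (simp add: g'_def)
      ultimately show ?thesis by (metis leading_coeff_0_iff)
    next
      case False
      have "degree g' \<le> degree g" using dpt by (simp add: g'_def degree_diff_le)
      moreover have "coeff g' (degree g) = 0" using dpt by (simp add: g'_def)
      ultimately show ?thesis
        using False by (metis eq_zero_or_degree_less)
    qed
    then show ?thesis
    proof
      assume "g' = 0"
      then show ?thesis by (intro bexI[of _ t] bexI[of _ 0]) (use t in \<open>auto simp: g'_def\<close>)
    next
      assume "degree g' < degree g"
      then obtain s r where sr: "s \<in> polys_over F" "r \<in> polys_over F" "g' = p * s + r"
        "r = 0 \<or> degree r < degree p"
        using less.hyps[OF _ g'] by blast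
      then show ?thesis
        by (intro bexI[of _ "s + t"] bexI[of _ r])
          (use t in \<open>auto simp: g'_def algebra_simps intro: polys_over_add\<close>)
    qed
  qed
qed

end

section \<open>Spans, linear dependence and dimension\<close>

definition lspan :: "'a::field set \<Rightarrow> 'a set \<Rightarrow> 'a set" where
  "lspan F V = {\<Sum>v\<in>V. c v * v | c. \<forall>v\<in>V. c v \<in> F}"

definition finite_over :: "'a::field set \<Rightarrow> 'a set \<Rightarrow> bool" where
  "finite_over F E \<longleftrightarrow> (\<exists>V. finite V \<and> E \<subseteq> lspan F V)"

text \<open>Families are used rather than sets, so a repetition among elements such as the powers
  \<open>x ^ i\<close> already counts as a dependence.\<close>

definition dependent_on :: "'a::field set \<Rightarrow> 'i set \<Rightarrow> ('i \<Rightarrow> 'a) \<Rightarrow> bool" where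
  "dependent_on F J x \<longleftrightarrow>
     (\<exists>c. (\<forall>j\<in>J. c j \<in> F) \<and> (\<exists>j\<in>J. c j \<noteq> 0) \<and> (\<Sum>j\<in>J. c j * x j) = 0)"

text \<open>The dimension bound \<open>[E : F] \<le> D\<close> without a basis. In this form it can
  be established for a subfield for which no spanning set is known yet.\<close>

definition degree_at_most :: "'a::field set \<Rightarrow> 'a set \<Rightarrow> nat \<Rightarrow> bool" where
  "degree_at_most F E D \<longleftrightarrow> (\<forall>x. (\<forall>i\<le>D. x i \<in> E) \<longrightarrow> dependent_on F {..D} x)"

lemma lspan_image:
  assumes F: "is_subfield F" and I: "finite I" and c: "\<And>i. i \<in> I \<Longrightarrow> c i \<in> F"
  shows "(\<Sum>i\<in>I. c i * f i) \<in> lspan F (f ` I)"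
proof -
  have "(\<Sum>i\<in>I. c i * f i) = (\<Sum>v\<in>f ` I. \<Sum>i\<in>{i\<in>I. f i = v}. c i * f i)"
    by (rule sum.image_gen[OF I])
  also have "\<dots> = (\<Sum>v\<in>f ` I. (\<Sum>i\<in>{i\<in>I. f i = v}. c i) * v)"
    by (intro sum.cong) (auto simp: sum_distrib_right)
  finally show ?thesis
    unfolding lspan_def by (auto intro!: exI subfield_sum F c)
qed

lemma dependent_on_lspan:
  assumes F: "is_subfield F" and V: "finite V"
  shows "finite J \<Longrightarrow> card J > card V \<Longrightarrow> (\<And>j. j \<in> J \<Longrightarrow> x j \<in> lspan F V)
    \<Longrightarrow> dependent_on F J x"
  using V
proof (induction V arbitrary: J x rule: finite_induct)
  case empty
  then have "J \<noteq> {}" "\<And>j. j \<in> J \<Longrightarrow> x j = 0" by (auto simp: lspan_def)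
  then show ?case
    using F unfolding dependent_on_def by (intro exI[of _ "\<lambda>_. 1"]) (auto simp: subfield_1)
next
  case (insert w V)
  have "\<exists>c. x j = (\<Sum>v\<in>insert w V. c v * v) \<and> (\<forall>v\<in>insert w V. c v \<in> F)" if "j \<in> J" for j
    using insert.prems(3)[OF that] by (auto simp: lspan_def)
  then obtain A where A: "\<And>j. j \<in> J \<Longrightarrow> x j = (\<Sum>v\<in>insert w V. A j v * v)"
    "\<And>j v. j \<in> J \<Longrightarrow> v \<in> insert w V \<Longrightarrow> A j v \<in> F"
    by metis
  have x: "x j = A j w * w + (\<Sum>v\<in>V. A j v * v)" if "j \<in> J" for j
    using A(1)[OF that] insert.hyps by simp
  show ?case
  proof (cases "\<forall>j\<in>J. A j w = 0")
    case True
    show ?thesis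
    proof (rule insert.IH)
      show "card V < card J" using insert by simp
      fix j assume "j \<in> J"
      then show "x j \<in> lspan F V"
        using x True A(2) by (auto simp: lspan_def intro!: exI[of _ "A j"])
    qed (use insert in auto)
  next
    case False
    then obtain i where i: "i \<in> J" "A i w \<noteq> 0" by blast
    define e where "e j = A j w / A i w" for j
    have e: "e j \<in> F" if "j \<in> J" for j
      unfolding e_def using that i A(2) by (intro subfield_divide F) auto
    have "dependent_on F (J - {i}) (\<lambda>j. x j - e j * x i)"
    proof (rule insert.IH)
      show "card V < card (J - {i})" using insert i by simp
      fix j assume j: "j \<in> J - {i}"
      have "x j - e j * x i = (\<Sum>v\<in>V. (A j v - e j * A i v) * v)"
        using j i x by (auto simp: e_def sum_subtractf sum_distrib_left algebra_simps)
      then show "x j - e j * x i \<in> lspan F V"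
        using j i A(2) e unfolding lspan_def
        by (auto intro!: exI[of _ "\<lambda>v. A j v - e j * A i v"] subfield_closed F)
    qed (use insert in auto)
    then obtain c where c: "\<forall>j\<in>J - {i}. c j \<in> F" "\<exists>j\<in>J - {i}. c j \<noteq> 0"
      "(\<Sum>j\<in>J - {i}. c j * (x j - e j * x i)) = 0"
      unfolding dependent_on_def by blast
    \<comment> \<open>The coefficient at the pivot \<open>i\<close> collects the multiples of
      \<open>x i\<close> that were subtracted.\<close>
    define d where "d = c(i := - (\<Sum>j\<in>J - {i}. c j * e j))"
    have "(\<Sum>j\<in>J. d j * x j) = d i * x i + (\<Sum>j\<in>J - {i}. d j * x j)"
      using i insert.prems by (simp add: sum.remove)
    also have "(\<Sum>j\<in>J - {i}. d j * x j) = (\<Sum>j\<in>J - {i}. c j * x j)"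
      by (intro sum.cong) (auto simp: d_def)
    also have "d i * x i + \<dots> = (\<Sum>j\<in>J - {i}. c j * (x j - e j * x i))"
      by (simp add: d_def sum_subtractf sum_distrib_left algebra_simps)
    finally have "(\<Sum>j\<in>J. d j * x j) = 0" using c by simp
    moreover have "d j \<in> F" if "j \<in> J" for j
      using that c e by (auto simp: d_def intro!: subfield_closed F)
    moreover have "\<exists>j\<in>J. d j \<noteq> 0" using c by (auto simp: d_def)
    ultimately show ?thesis unfolding dependent_on_def by blast
  qed
qed

lemma finite_over_imp_degree_at_most:
  assumes "is_subfield F" "finite_over F E"
  shows "\<exists>D. degree_at_most F E D"
proof -
  obtain V where V: "finite V" "E \<subseteq> lspan F V" using assms by (auto simp: finite_over_def)
  have "degree_at_most F E (card V)"
    unfolding degree_at_most_def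
  proof (intro allI impI)
    fix x :: "nat \<Rightarrow> 'a" assume "\<forall>i\<le>card V. x i \<in> E"
    then show "dependent_on F {..card V} x"
      using V by (intro dependent_on_lspan[OF assms(1) V(1)]) auto
  qed
  then show ?thesis ..
qed

text \<open>An independent family of maximal length spans: appending \<open>y\<close> yields a
  relation whose coefficient at \<open>y\<close> cannot vanish.\<close>

lemma degree_at_most_imp_finite_over:
  assumes F: "is_subfield F" and D: "degree_at_most F E D"
  shows "finite_over F E"
proof -
  define P where "P n \<longleftrightarrow> (\<exists>x. (\<forall>i<n. x i \<in> E) \<and> \<not> dependent_on F {..<n} x)" for n :: nat
  have "P 0" by (auto simp: P_def dependent_on_def)
  moreover have "\<not> P (Suc D)"
    using D unfolding P_def degree_at_most_def
    by (metis lessThan_Suc_atMost less_Suc_eq_le)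
  ultimately obtain n where n: "P n" "\<not> P (Suc n)"
    by (metis nat_induct)
  then obtain x where x: "\<forall>i<n. x i \<in> E" "\<not> dependent_on F {..<n} x"
    unfolding P_def by blast
  have "y \<in> lspan F (x ` {..<n})" if y: "y \<in> E" for y
  proof -
    define z where "z = x(n := y)"
    have "\<forall>i<Suc n. z i \<in> E" using x(1) y by (auto simp: z_def less_Suc_eq)
    then have "dependent_on F {..<Suc n} z"
      using n(2) unfolding P_def by blast
    then obtain c where c: "\<forall>i\<in>{..<Suc n}. c i \<in> F" "\<exists>i\<in>{..<Suc n}. c i \<noteq> 0"
      "(\<Sum>i<Suc n. c i * z i) = 0"
      unfolding dependent_on_def by blast
    have s: "(\<Sum>i<Suc n. c i * z i) = (\<Sum>i<n. c i * x i) + c n * y"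
      by (simp add: z_def)
    have "c n \<noteq> 0"
    proof
      assume "c n = 0"
      then have "dependent_on F {..<n} x"
        using c s unfolding dependent_on_def
        by (intro exI[of _ c]) (auto simp: less_Suc_eq)
      then show False using x by blast
    qed
    have "c n * y = - (\<Sum>i<n. c i * x i)" using s c(3) by (simp add: eq_neg_iff_add_eq_0 add.commute)
    then have "y = - (\<Sum>i<n. c i * x i) / c n" using \<open>c n \<noteq> 0\<close> by (simp add: field_simps)
    also have "\<dots> = (\<Sum>i<n. (- c i / c n) * x i)"
      by (simp add: sum_divide_distrib flip: sum_negf)
    also have "\<dots> \<in> lspan F (x ` {..<n})"
      using c(1) by (intro lspan_image F) (auto intro!: subfield_closed F)
    finally show ?thesis .
  qed
  then show ?thesis unfolding finite_over_def by (intro exI[of _ "x ` {..<n}"]) auto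
qed

lemma finite_over_trans:
  assumes F: "is_subfield F" and "finite_over F G" "finite_over G E"
  shows "finite_over F E"
proof -
  obtain W V where V: "finite V" "G \<subseteq> lspan F V" and W: "finite W" "E \<subseteq> lspan G W"
    using assms by (auto simp: finite_over_def)
  have "x \<in> lspan F ((\<lambda>(v, w). v * w) ` (V \<times> W))" if x: "x \<in> E" for x
  proof -
    obtain c where c: "\<forall>w\<in>W. c w \<in> G" "x = (\<Sum>w\<in>W. c w * w)"
      using subsetD[OF W(2) x] unfolding lspan_def by blast
    have "\<exists>d. (\<forall>v\<in>V. d v \<in> F) \<and> c w = (\<Sum>v\<in>V. d v * v)" if "w \<in> W" for w
    proof -
      have "c w \<in> lspan F V" using that c V by blast
      then show ?thesis unfolding lspan_def by blast
    qed
    then obtain d where d: "\<And>w v. w \<in> W \<Longrightarrow> v \<in> V \<Longrightarrow> d w v \<in> F"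
      "\<And>w. w \<in> W \<Longrightarrow> c w = (\<Sum>v\<in>V. d w v * v)"
      by metis
    have "x = (\<Sum>w\<in>W. \<Sum>v\<in>V. d w v * v * w)"
      using c d by (simp add: sum_distrib_right)
    also have "\<dots> = (\<Sum>(v, w)\<in>V \<times> W. d w v * v * w)"
      by (subst sum.swap) (simp add: sum.cartesian_product)
    also have "\<dots> = (\<Sum>p\<in>V \<times> W. d (snd p) (fst p) * (case p of (v, w) \<Rightarrow> v * w))"
      by (intro sum.cong) (auto simp: mult.assoc)
    also have "\<dots> \<in> lspan F ((\<lambda>(v, w). v * w) ` (V \<times> W))"
      using d V W by (intro lspan_image F) auto
    finally show ?thesis .
  qed
  then show ?thesis
    using V W unfolding finite_over_def
    by (intro exI[of _ "(\<lambda>(v, w). v * w) ` (V \<times> W)"]) auto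
qed

lemma lspan_mono: "F \<subseteq> G \<Longrightarrow> lspan F V \<subseteq> lspan G V"
  by (fastforce simp: lspan_def)

lemma finite_over_mono: "finite_over F E \<Longrightarrow> F \<subseteq> G \<Longrightarrow> finite_over G E"
  using lspan_mono unfolding finite_over_def by blast

lemma finite_over_refl:
  assumes "is_subfield F" shows "finite_over F F"
  unfolding finite_over_def lspan_def
  by (intro exI[of _ "{1}"]) (auto intro!: exI[of _ "\<lambda>_. x" for x])

section \<open>Algebraic elements and simple extensions\<close>

definition algebraic_over :: "'a::field set \<Rightarrow> 'a \<Rightarrow> bool" where
  "algebraic_over F x \<longleftrightarrow> (\<exists>p\<in>polys_over F. p \<noteq> 0 \<and> poly p x = 0)"

lemma algebraic_over_mono: "F \<subseteq> G \<Longrightarrow> algebraic_over F x \<Longrightarrow> algebraic_over G x"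
  using polys_over_mono unfolding algebraic_over_def by blast

lemma poly_of_combination:
  assumes F: "is_subfield F" and "dependent_on F {..D} (\<lambda>i. x ^ i)"
  shows "\<exists>p\<in>polys_over F. p \<noteq> 0 \<and> degree p \<le> D \<and> poly p x = 0"
proof -
  obtain c where c: "\<forall>i\<le>D. c i \<in> F" "\<exists>i\<le>D. c i \<noteq> 0" "(\<Sum>i\<le>D. c i * x ^ i) = 0"
    using assms(2) by (auto simp: dependent_on_def)
  define p where "p = (\<Sum>i\<le>D. monom (c i) i)"
  have co: "coeff p i = (if i \<le> D then c i else 0)" for i
    by (simp add: p_def coeff_sum)
  have "p \<in> polys_over F" using c F by (auto simp: polys_over_def co subfield_0)
  moreover have "p \<noteq> 0" using c co by (metis coeff_0)
  moreover have "degree p \<le> D" by (rule degree_le) (simp add: co)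
  moreover have "poly p x = 0" using c by (simp add: p_def poly_sum poly_monom)
  ultimately show ?thesis by blast
qed

lemma finite_over_imp_algebraic:
  assumes F: "is_subfield F" and E: "is_subfield E" "finite_over F E" and x: "x \<in> E"
  shows "algebraic_over F x"
proof -
  obtain D where "degree_at_most F E D" using finite_over_imp_degree_at_most F E by blast
  then have "dependent_on F {..D} (\<lambda>i. x ^ i)"
    using x E unfolding degree_at_most_def by (simp add: subfield_power)
  from poly_of_combination[OF F this] show ?thesis unfolding algebraic_over_def by blast
qed

text \<open>The simple extension \<open>F(a)\<close>. Fractions make the same description serve
  algebraic and transcendental \<open>a\<close>.\<close>

definition adjoin :: "'a::field set \<Rightarrow> 'a \<Rightarrow> 'a set" where
  "adjoin F a = {poly p a / poly q a | p q. p \<in> polys_over F \<and> q \<in> polys_over F \<and> poly q a \<noteq> 0}"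

lemma adjoinI: "p \<in> polys_over F \<Longrightarrow> q \<in> polys_over F \<Longrightarrow> poly q a \<noteq> 0
    \<Longrightarrow> x = poly p a / poly q a \<Longrightarrow> x \<in> adjoin F a"
  by (auto simp: adjoin_def)

lemma adjoinE:
  assumes "x \<in> adjoin F a"
  obtains p q where "p \<in> polys_over F" "q \<in> polys_over F" "poly q a \<noteq> 0" "x = poly p a / poly q a"
  using assms by (auto simp: adjoin_def)

lemma poly_in_adjoin: "is_subfield F \<Longrightarrow> p \<in> polys_over F \<Longrightarrow> poly p a \<in> adjoin F a"
  by (rule adjoinI[of p _ 1]) auto

lemma subset_adjoin: "is_subfield F \<Longrightarrow> F \<subseteq> adjoin F a"
  using poly_in_adjoin[of F "[:c:]" a for c] by (auto simp: polys_over_pCons)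

lemma self_in_adjoin: "is_subfield F \<Longrightarrow> a \<in> adjoin F a"
  using poly_in_adjoin[of F "[:0, 1:]" a] by (auto simp: polys_over_pCons subfield_closed)

lemma is_subfield_adjoin:
  assumes F: "is_subfield F"
  shows "is_subfield (adjoin F a)"
  unfolding is_subfield_def
proof (intro conjI ballI)
  show "0 \<in> adjoin F a" "1 \<in> adjoin F a" 
    using subset_adjoin[OF F, of a] subfield_0[OF F] subfield_1[OF F] by blast+
  fix x assume x: "x \<in> adjoin F a"
  then obtain p q where pq: "p \<in> polys_over F" "q \<in> polys_over F" "poly q a \<noteq> 0"
    "x = poly p a / poly q a" by (rule adjoinE)
  show "- x \<in> adjoin F a"
    by (rule adjoinI[of "0 - p" _ q]) (use pq polys_over_diff[OF F polys_over_0[OF F]] in auto)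
  show "inverse x \<in> adjoin F a"
  proof (cases "poly p a = 0")
    case True
    then show ?thesis using pq x by simp
  next
    case False
    then show ?thesis by (intro adjoinI[of q _ p]) (use pq in auto)
  qed
  fix y assume "y \<in> adjoin F a"
  then obtain r s where rs: "r \<in> polys_over F" "s \<in> polys_over F" "poly s a \<noteq> 0"
    "y = poly r a / poly s a" by (rule adjoinE)
  show "x + y \<in> adjoin F a"
    by (rule adjoinI[of "p * s + q * r" _ "q * s"])
      (use pq(1-3) rs(1-3) in \<open>auto intro!: polys_over_add polys_over_mult F
          simp: pq(4) rs(4) add_divide_distrib\<close>)
  show "x * y \<in> adjoin F a"
    by (rule adjoinI[of "p * r" _ "q * s"])
      (use pq rs in \<open>auto intro!: polys_over_mult F\<close>)
qed

lemma adjoin_least: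
  assumes "is_subfield E" "F \<subseteq> E" "a \<in> E"
  shows "adjoin F a \<subseteq> E"
proof
  fix x assume "x \<in> adjoin F a"
  then obtain p q where "p \<in> polys_over F" "q \<in> polys_over F" "x = poly p a / poly q a"
    by (rule adjoinE)
  then show "x \<in> E"
    using assms polys_over_mono[of F E] by (auto intro!: subfield_divide poly_in_subfield)
qed

lemma hull_insert_eq_adjoin: "is_subfield hull (insert a A) = adjoin (is_subfield hull A) a"
proof (rule hull_unique)
  let ?H = "is_subfield hull A"
  show "insert a A \<subseteq> adjoin ?H a"
    using self_in_adjoin[OF is_subfield_hull] subset_adjoin[OF is_subfield_hull] hull_subset[of A is_subfield]
    by blast
  show "is_subfield (adjoin ?H a)" by (intro is_subfield_adjoin is_subfield_hull)
  fix E assume "insert a A \<subseteq> E" "is_subfield E"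
  then show "adjoin ?H a \<subseteq> E" by (intro adjoin_least hull_minimal) auto
qed

text \<open>A zero constant term allows division by the indeterminate; a nonzero one allows the
  equation to be solved for the inverse.\<close>

lemma inverse_algebraic_poly:
  assumes F: "is_subfield F" and x: "x \<noteq> 0"
  shows "p \<in> polys_over F \<Longrightarrow> p \<noteq> 0 \<Longrightarrow> poly p x = 0 \<Longrightarrow> \<exists>h\<in>polys_over F. inverse x = poly h x"
proof (induction p)
  case (pCons c p)
  then have p: "p \<in> polys_over F" "c \<in> F" by (auto simp: polys_over_pCons F)
  show ?case
  proof (cases "c = 0")
    case True
    then show ?thesis using pCons p x by auto
  next
    case False
    have "x * poly p x = - c" using pCons.prems by (simp add: eq_neg_iff_add_eq_0 add.commute)
    then have "inverse x = poly (smult (- inverse c) p) x"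
      using False x by (simp add: field_simps)
    moreover have "smult (- inverse c) p \<in> polys_over F"
      using p by (intro polys_over_smult subfield_closed F) auto
    ultimately show ?thesis by blast
  qed
qed auto

text \<open>The polynomial \<open>P\<close> need not be irreducible, so a denominator is not
  inverted modulo \<open>P\<close>. Instead, the powers of \<open>poly q a\<close> lie in a finite
  span, hence it is algebraic and its inverse is a polynomial in it.\<close>

lemma finite_over_adjoin:
  assumes F: "is_subfield F" and a: "algebraic_over F a"
  shows "finite_over F (adjoin F a)"
proof -
  obtain P where P: "P \<in> polys_over F" "P \<noteq> 0" "poly P a = 0"
    using a by (auto simp: algebraic_over_def)
  define V where "V = (\<lambda>i. a ^ i) ` {..<degree P}"
  have ring: "poly g a \<in> lspan F V" if g: "g \<in> polys_over F" for g
  proof -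
    obtain s r where sr: "r \<in> polys_over F" "g = P * s + r" "r = 0 \<or> degree r < degree P"
      using polys_over_division[OF F P(1,2) g] by blast
    have "poly g a = poly r a" using sr P by simp
    also have "\<dots> = (\<Sum>i<degree P. coeff r i * a ^ i)"
    proof (cases "r = 0")
      case False
      then show ?thesis using sr unfolding poly_altdef
        by (intro sum.mono_neutral_left) (auto simp: coeff_eq_0)
    qed auto
    also have "\<dots> \<in> lspan F V" unfolding V_def
      using sr by (intro lspan_image F) (auto simp: polys_overD)
    finally show ?thesis .
  qed
  have "x \<in> lspan F V" if x: "x \<in> adjoin F a" for x
  proof -
    obtain p q where pq: "p \<in> polys_over F" "q \<in> polys_over F" "poly q a \<noteq> 0"
      "x = poly p a / poly q a" using x by (rule adjoinE)
    have "dependent_on F {..card V} (\<lambda>i. poly q a ^ i)"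
    proof (rule dependent_on_lspan[OF F])
      show "finite V" by (simp add: V_def)
      fix j
      show "poly q a ^ j \<in> lspan F V"
        using ring[OF polys_over_power[OF F pq(2), of j]] by simp
    qed auto
    then obtain R where R: "R \<in> polys_over F" "R \<noteq> 0" "poly R (poly q a) = 0"
      using poly_of_combination[OF F] by blast
    obtain h where h: "h \<in> polys_over F" "inverse (poly q a) = poly h (poly q a)"
      using inverse_algebraic_poly[OF F pq(3) R] by blast
    have "x = poly (p * pcompose h q) a"
      using pq h by (simp add: divide_inverse poly_pcompose)
    also have "\<dots> \<in> lspan F V"
      by (intro ring polys_over_mult polys_over_pcompose F pq h)
    finally show ?thesis .
  qed
  then show ?thesis unfolding finite_over_def
    by (intro exI[of _ V]) (auto simp: V_def)
qed

lemma algebraic_finite_extension: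
  assumes F: "is_subfield F" and "finite C" "\<And>x. x \<in> C \<Longrightarrow> algebraic_over F x"
  shows "\<exists>E. is_subfield E \<and> F \<subseteq> E \<and> C \<subseteq> E \<and> finite_over F E"
  using assms(2,3)
proof (induction C rule: finite_induct)
  case empty
  then show ?case using F finite_over_refl by blast
next
  case (insert x C)
  then obtain E where E: "is_subfield E" "F \<subseteq> E" "C \<subseteq> E" "finite_over F E" by auto
  have "algebraic_over E x" using insert E algebraic_over_mono by blast
  then have "finite_over F (adjoin E x)"
    using finite_over_trans[OF F E(4)] finite_over_adjoin E by blast
  then show ?case
    using E by (intro exI[of _ "adjoin E x"])
      (use is_subfield_adjoin subset_adjoin self_in_adjoin in blast)
qed

lemma is_subfield_algebraic_over:
  assumes F: "is_subfield F"
  shows "is_subfield {x. algebraic_over F x}"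
proof -
  have alg2: "algebraic_over F (x + y) \<and> algebraic_over F (x * y) \<and> algebraic_over F (- x)
    \<and> algebraic_over F (inverse x)" if xy: "algebraic_over F x" "algebraic_over F y" for x y
  proof -
    obtain E where E: "is_subfield E" "{x, y} \<subseteq> E" "finite_over F E"
      using algebraic_finite_extension[OF F, of "{x, y}"] xy by blast
    then show ?thesis
      by (auto intro!: finite_over_imp_algebraic[OF F E(1,3)] subfield_closed)
  qed
  have "algebraic_over F x" if "x \<in> F" for x
    using that finite_over_imp_algebraic[OF F F finite_over_refl[OF F]] by blast
  then show ?thesis unfolding is_subfield_def mem_Collect_eq
    using alg2 subfield_0[OF F] subfield_1[OF F] by blast
qed

lemma algebraic_over_self: "is_subfield F \<Longrightarrow> x \<in> F \<Longrightarrow> algebraic_over F x"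
  using finite_over_imp_algebraic finite_over_refl by blast

lemma algebraic_over_trans:
  assumes F: "is_subfield F" and p: "p \<noteq> 0" "poly p a = 0" "\<And>i. algebraic_over F (coeff p i)"
  shows "algebraic_over F a"
proof -
  obtain E where E: "is_subfield E" "F \<subseteq> E" "coeff p ` {..degree p} \<subseteq> E" "finite_over F E"
    using algebraic_finite_extension[OF F, of "coeff p ` {..degree p}"] p(3) by auto
  have "p \<in> polys_over E"
  proof (rule polys_overI)
    fix i
    show "coeff p i \<in> E"
      using E by (cases "i \<le> degree p") (auto simp: coeff_eq_0 subfield_0)
  qed
  then have "algebraic_over E a" using p by (auto simp: algebraic_over_def)
  then have "finite_over F (adjoin E a)"
    using finite_over_trans[OF F E(4)] finite_over_adjoin E by blast
  then show ?thesis
    using finite_over_imp_algebraic[OF F] is_subfield_adjoin self_in_adjoin E by blast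
qed

section \<open>Bounded exponents of roots: ascending a field extension\<close>

text \<open>Here \<open>N\<close> may depend on \<open>\<alpha>\<close> only. The exponent
  \<open>k\<close> is needed because the product of \<open>k\<close> conjugates of an
  \<open>n\<close>-th root of \<open>\<alpha>\<close> has \<open>n\<close>-th power
  \<open>\<alpha> ^ k\<close>.\<close>

definition bounded_roots :: "'a::field set \<Rightarrow> bool" where
  "bounded_roots E \<longleftrightarrow> (\<forall>\<alpha>\<in>E. \<alpha> \<noteq> 0 \<longrightarrow> (\<forall>m>0. \<alpha> ^ m \<noteq> 1) \<longrightarrow>
     (\<exists>N. \<forall>\<gamma>\<in>E. \<forall>n>0. \<forall>k>0. \<gamma> ^ n = \<alpha> ^ k \<longrightarrow> n \<le> N * k))"

text \<open>Finite extensions are included so that the property survives adjoining one element: an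
  algebraic generator only enlarges the extension, and a transcendental one requires the hypothesis
  for the algebraic elements of \<open>E\<close>, which may exceed \<open>F\<close>.\<close>

definition bounded_roots_above :: "'a::field set \<Rightarrow> bool" where
  "bounded_roots_above F \<longleftrightarrow>
     (\<forall>E. is_subfield E \<longrightarrow> F \<subseteq> E \<longrightarrow> finite_over F E \<longrightarrow> bounded_roots E)"

text \<open>The relation is multiplied by the product of all denominators. The coefficients are
  given as polynomials, not as values at \<open>a\<close>, so that they can be compared term by term
  when \<open>a\<close> is transcendental.\<close>

lemma clear_denominators:
  assumes F: "is_subfield F" and dep: "dependent_on (adjoin F a) {..D::nat} x"
  shows "\<exists>p. (\<forall>i\<le>D. p i \<in> polys_over F) \<and> (\<exists>i\<le>D. poly (p i) a \<noteq> 0)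
    \<and> (\<Sum>i\<le>D. poly (p i) a * x i) = 0"
proof -
  obtain c where c: "\<forall>i\<le>D. c i \<in> adjoin F a" "\<exists>i\<le>D. c i \<noteq> 0" "(\<Sum>i\<le>D. c i * x i) = 0"
    using dep by (auto simp: dependent_on_def)
  have "\<exists>r s. r \<in> polys_over F \<and> s \<in> polys_over F \<and> poly s a \<noteq> 0 \<and> c i = poly r a / poly s a"
    if "i \<le> D" for i
    using c(1)[rule_format, OF that] unfolding adjoin_def by blast
  then obtain r s where rs: "\<And>i. i \<le> D \<Longrightarrow> r i \<in> polys_over F" "\<And>i. i \<le> D \<Longrightarrow> s i \<in> polys_over F"
    "\<And>i. i \<le> D \<Longrightarrow> poly (s i) a \<noteq> 0" "\<And>i. i \<le> D \<Longrightarrow> c i = poly (r i) a / poly (s i) a"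
    by metis
  define S where "S = (\<Prod>j\<le>D. poly (s j) a)"
  define p where "p i = r i * (\<Prod>j\<in>{..D} - {i}. s j)" for i
  have S: "S \<noteq> 0" using rs by (simp add: S_def)
  have prod_over: "prod s J \<in> polys_over F" if "J \<subseteq> {..D}" for J
    using that
    by (induction J rule: infinite_finite_induct) (use rs in \<open>auto intro!: polys_over_mult F simp: F\<close>)
  have p: "p i \<in> polys_over F" if "i \<le> D" for i
    unfolding p_def using rs that by (intro polys_over_mult F prod_over) auto
  have pa: "poly (p i) a = S * c i" if "i \<le> D" for i
  proof -
    have "S = poly (s i) a * (\<Prod>j\<in>{..D} - {i}. poly (s j) a)"
      unfolding S_def using that by (intro prod.remove) auto
    then show ?thesis using rs[OF that] by (simp add: p_def poly_prod)
  qed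
  have "(\<Sum>i\<le>D. poly (p i) a * x i) = S * (\<Sum>i\<le>D. c i * x i)"
    by (simp add: pa sum_distrib_left mult.assoc)
  moreover have "\<exists>i\<le>D. poly (p i) a \<noteq> 0" using c(2) pa S by auto
  ultimately show ?thesis using p c(3) by (intro exI[of _ p]) auto
qed

lemma algebraic_over_root:
  assumes F: "is_subfield F" and "algebraic_over F (x ^ n)" "n > 0"
  shows "algebraic_over F x"
proof (rule algebraic_over_trans[OF F])
  let ?p = "monom 1 n - [:x ^ n:]"
  have "coeff ?p n = 1" using \<open>n > 0\<close> by (simp add: coeff_pCons split: nat.split)
  then show "?p \<noteq> 0" by (metis coeff_0 zero_neq_one)
  show "poly ?p x = 0" by (simp add: poly_monom)
  fix i
  note A = is_subfield_algebraic_over[OF F]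
  have "?p \<in> polys_over {x. algebraic_over F x}"
    using assms A by (intro polys_over_diff polys_over_monom) (auto simp: polys_over_pCons subfield_1 algebraic_over_self[OF F])
  then show "algebraic_over F (coeff ?p i)" using polys_overD by fastforce
qed

text \<open>
  If \<open>\<alpha>\<close> is transcendental over \<open>F\<close> and \<open>\<tau>^n = \<alpha>\<close>, then \<open>\<gamma>^n = \<alpha>^k\<close> means \<open>\<gamma> = \<zeta> \<tau>^k\<close> with \<open>\<zeta>^n = 1\<close>. As
  long as \<open>k i < n\<close>, the exponents of \<open>\<tau>\<close> in the products \<open>\<alpha>^j \<gamma>^i\<close> are distinct, so the powers \<open>\<gamma>^i\<close> are
  independent over \<open>F(\<alpha>)\<close>. If \<open>\<alpha>\<close> is algebraic over \<open>F\<close>, so is \<open>\<gamma>\<close>, and the algebraic elements of \<open>E\<close>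
  form a finite extension of \<open>F\<close>.
\<close>

lemma bounded_roots_above_adjoin_transcendental:
  fixes F :: "'a::alg_closed_field set"
  assumes F: "is_subfield F" and hyp: "bounded_roots_above F" and a: "\<not> algebraic_over F a"
  shows "bounded_roots_above (adjoin F a)"
  unfolding bounded_roots_above_def
proof (intro allI impI)
  fix E assume E: "is_subfield E" "adjoin F a \<subseteq> E" "finite_over (adjoin F a) E"
  let ?A = "{x. algebraic_over F x}"
  have A: "is_subfield ?A" by (rule is_subfield_algebraic_over[OF F])
  have FE: "F \<subseteq> E" and aE: "a \<in> E" using E subset_adjoin[OF F] self_in_adjoin[OF F] by auto
  obtain D where D: "degree_at_most (adjoin F a) E D"
    using finite_over_imp_degree_at_most[OF is_subfield_adjoin[OF F] E(3)] by blast
  \<comment> \<open>What is transcendental over \<open>F\<close> remains so over the field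
    \<open>?A\<close> of algebraic elements.\<close>
  have zero_over_A: "h = 0" if "h \<in> polys_over ?A" "poly h t = 0" "\<not> algebraic_over F t" for h t
    using that algebraic_over_trans[OF F, of h t] polys_overD[of h ?A] by auto
  show "bounded_roots E" unfolding bounded_roots_def
  proof (intro ballI impI)
    fix \<alpha> assume \<alpha>: "\<alpha> \<in> E" "\<alpha> \<noteq> 0" "\<forall>m>0. \<alpha> ^ m \<noteq> 1"
    show "\<exists>N. \<forall>\<gamma>\<in>E. \<forall>n>0. \<forall>k>0. \<gamma> ^ n = \<alpha> ^ k \<longrightarrow> n \<le> N * k"
    proof (cases "algebraic_over F \<alpha>")
      case True
      define E0 where "E0 = E \<inter> ?A"
      have E0: "is_subfield E0" unfolding E0_def
        using E(1) A is_subfield_Inter[of "{E, ?A}"] by auto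
      have "degree_at_most F E0 D"
        unfolding degree_at_most_def
      proof (intro allI impI)
        fix x :: "nat \<Rightarrow> 'a" assume x: "\<forall>i\<le>D. x i \<in> E0"
        then have "dependent_on (adjoin F a) {..D} x"
          using D unfolding degree_at_most_def E0_def by blast
        from clear_denominators[OF F this] obtain p where
          p: "\<forall>i\<le>D. p i \<in> polys_over F" "\<exists>i\<le>D. poly (p i) a \<noteq> 0" "(\<Sum>i\<le>D. poly (p i) a * x i) = 0"
          by blast
        \<comment> \<open>As a polynomial with algebraic coefficients that vanishes at the
          transcendental \<open>a\<close>, \<open>h\<close> is zero. Reading off one position
          \<open>j\<close> with some \<open>coeff (p i) j\<close> nonzero gives a relation among the
          \<open>x i\<close> over \<open>F\<close>.\<close>
        define h where "h = (\<Sum>i\<le>D. smult (x i) (p i))"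
        have "h \<in> polys_over ?A" unfolding h_def
          using x p F A by (intro polys_over_sum polys_over_smult)
            (auto simp: E0_def polys_over_def algebraic_over_self)
        moreover have "poly h a = 0" using p(3) by (simp add: h_def poly_sum mult.commute)
        ultimately have "h = 0" using zero_over_A a by blast
        then have co: "(\<Sum>i\<le>D. coeff (p i) j * x i) = 0" for j
          by (metis (no_types, lifting) h_def coeff_0 coeff_smult coeff_sum mult.commute sum.cong)
        obtain i j where "i \<le> D" "coeff (p i) j \<noteq> 0"
          using p(2) by (metis leading_coeff_0_iff poly_0)
        then show "dependent_on F {..D} x"
          unfolding dependent_on_def using co p(1)
          by (intro exI[of _ "\<lambda>i. coeff (p i) j"]) (auto simp: polys_overD)
      qed
      then have "finite_over F E0" using degree_at_most_imp_finite_over F by blast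
      moreover have "F \<subseteq> E0" using FE by (auto simp: E0_def algebraic_over_self F)
      ultimately have "bounded_roots E0" using hyp E0 by (auto simp: bounded_roots_above_def)
      moreover have "\<alpha> \<in> E0" using \<alpha> True by (auto simp: E0_def)
      ultimately obtain N where N: "\<forall>\<gamma>\<in>E0. \<forall>n>0. \<forall>k>0. \<gamma> ^ n = \<alpha> ^ k \<longrightarrow> n \<le> N * k"
        using \<alpha> unfolding bounded_roots_def by blast
      have "\<gamma> \<in> E0" if "\<gamma> \<in> E" "n > 0" "\<gamma> ^ n = \<alpha> ^ k" for \<gamma> n k
        using algebraic_over_root[OF F, of \<gamma> n] that subfield_power[OF A, of \<alpha> k] True
        by (auto simp: E0_def)
      then show ?thesis using N by blast
    next
      case False
      \<comment> \<open>Exchange of generators: \<open>\<alpha>\<close> is algebraic over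
        \<open>F(a)\<close> but transcendental over \<open>F\<close>, so \<open>a\<close> is
        algebraic over \<open>F(\<alpha>)\<close>, and \<open>E\<close> is finite over
        \<open>F(\<alpha>)\<close>.\<close>
      define F' where "F' = adjoin F \<alpha>"
      have F': "is_subfield F'" by (simp add: F'_def is_subfield_adjoin F)
      have "dependent_on (adjoin F a) {..D} (\<lambda>i. \<alpha> ^ i)"
        using D \<alpha>(1) E(1) unfolding degree_at_most_def by (simp add: subfield_power)
      from clear_denominators[OF F this] obtain p where
        p: "\<forall>i\<le>D. p i \<in> polys_over F" "\<exists>i\<le>D. poly (p i) a \<noteq> 0" "(\<Sum>i\<le>D. poly (p i) a * \<alpha> ^ i) = 0"
        by blast
      have "algebraic_over F' a"
        unfolding algebraic_over_def
      proof (intro bexI conjI)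
        define h where "h = (\<Sum>i\<le>D. smult (\<alpha> ^ i) (p i))"
        show "poly h a = 0" using p(3) by (simp add: h_def poly_sum mult.commute)
        have "F \<subseteq> F'" "\<alpha> \<in> F'" using subset_adjoin[OF F] self_in_adjoin[OF F] by (auto simp: F'_def)
        then show "h \<in> polys_over F'" unfolding h_def
          using p(1) polys_over_mono[of F F']
          by (intro polys_over_sum polys_over_smult F' subfield_power) auto
        obtain i j where ij: "i \<le> D" "coeff (p i) j \<noteq> 0"
          using p(2) by (metis leading_coeff_0_iff poly_0)
        define e where "e = (\<Sum>i\<le>D. monom (coeff (p i) j) i)"
        have "coeff e i = coeff (p i) j" using ij by (simp add: e_def coeff_sum)
        then have "e \<noteq> 0" using ij by auto
        moreover have "e \<in> polys_over F"
          unfolding e_def using p(1) by (intro polys_over_sum polys_over_monom F) (auto simp: polys_overD)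
        ultimately have "poly e \<alpha> \<noteq> 0" using False by (auto simp: algebraic_over_def)
        also have "poly e \<alpha> = coeff h j"
          by (simp add: e_def h_def poly_sum poly_monom coeff_sum mult.commute)
        finally show "h \<noteq> 0" by auto
      qed
      then have "finite_over F' (adjoin F' a)" by (rule finite_over_adjoin[OF F'])
      moreover have "adjoin F a \<subseteq> adjoin F' a"
        using subset_adjoin[OF F'] subset_adjoin[OF F] self_in_adjoin[OF F'] is_subfield_adjoin[OF F']
        by (intro adjoin_least) (auto simp: F'_def)
      then have "finite_over (adjoin F' a) E" using E(3) finite_over_mono by blast
      ultimately have "finite_over F' E" using finite_over_trans[OF F'] by blast
      then obtain D' where D': "degree_at_most F' E D'"
        using finite_over_imp_degree_at_most[OF F'] by blast
      have "n \<le> D' * k" if \<gamma>: "\<gamma> \<in> E" "n > 0" "k > 0" "\<gamma> ^ n = \<alpha> ^ k" for \<gamma> n k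
      proof (rule ccontr)
        assume "\<not> n \<le> D' * k"
        then have n: "D' * k < n" by simp
        obtain \<tau> where \<tau>: "\<tau> ^ n = \<alpha>" using nth_root_exists \<gamma>(2) by blast
        have "\<tau> \<noteq> 0" using \<tau> \<alpha>(2) \<gamma>(2) by (auto simp: power_0_left)
        define \<zeta> where "\<zeta> = \<gamma> / \<tau> ^ k"
        have "(\<tau> ^ k) ^ n = \<alpha> ^ k" unfolding \<tau>[symmetric] by (metis power_mult mult.commute)
        then have "\<zeta> ^ n = 1"
          using \<gamma>(4) \<alpha>(2) by (simp add: \<zeta>_def power_divide)
        then have \<zeta>: "algebraic_over F \<zeta>" "\<zeta> \<noteq> 0"
          using algebraic_over_root[OF F, of \<zeta> n] \<gamma>(2) algebraic_over_self[OF F subfield_1[OF F]]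
          by (auto simp: power_0_left)
        have \<tau>_trans: "\<not> algebraic_over F \<tau>"
          using False \<tau> subfield_power[OF A, of \<tau> n] by auto
        have "dependent_on F' {..D'} (\<lambda>i. \<gamma> ^ i)"
          using D' \<gamma>(1) E(1) unfolding degree_at_most_def by (simp add: subfield_power)
        then obtain p where
          p: "\<forall>i\<le>D'. p i \<in> polys_over F" "\<exists>i\<le>D'. poly (p i) \<alpha> \<noteq> 0" "(\<Sum>i\<le>D'. poly (p i) \<alpha> * \<gamma> ^ i) = 0"
          using clear_denominators[OF F] unfolding F'_def by blast
        \<comment> \<open>The relation among the powers of \<open>\<gamma>\<close> as a polynomial
          in \<open>\<tau>\<close> with coefficients algebraic over \<open>F\<close>. The
          \<open>i\<close>-th summand has only exponents congruent to \<open>k * i\<close> modulo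
          \<open>n\<close>.\<close>
        define H where "H = (\<Sum>i\<le>D'. smult (\<zeta> ^ i) (monom 1 (k * i) * pcompose (p i) (monom 1 n)))"
        have pA: "p i \<in> polys_over ?A" if "i \<le> D'" for i
          using p(1) that polys_over_mono[of F ?A] algebraic_over_self[OF F] by blast
        have "H \<in> polys_over ?A" unfolding H_def
          using \<zeta>(1) pA
          by (intro polys_over_sum polys_over_smult polys_over_mult polys_over_monom
              polys_over_pcompose A subfield_power subfield_1) auto
        moreover have "poly H \<tau> = (\<Sum>i\<le>D'. poly (p i) \<alpha> * \<gamma> ^ i)"
        proof -
          have "\<gamma> ^ i = \<zeta> ^ i * \<tau> ^ (k * i)" for i
            using \<open>\<tau> \<noteq> 0\<close> by (simp add: \<zeta>_def power_mult power_divide)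
          then show ?thesis
            by (simp add: H_def poly_sum poly_monom poly_pcompose \<tau> mult_ac)
        qed
        ultimately have "H = 0" using zero_over_A[OF _ _ \<tau>_trans] p(3) by simp
        obtain i j where ij: "i \<le> D'" "coeff (p i) j \<noteq> 0"
          using p(2) by (metis leading_coeff_0_iff poly_0)
        have "coeff (monom 1 (k * l) * pcompose (p l) (monom 1 n)) (n * j + k * i)
          = (if l = i then coeff (p i) j else 0)" if l: "l \<le> D'" for l
        proof (cases "k * l \<le> n * j + k * i")
          case True
          have small: "k * l < n" "k * i < n"
            using l ij(1) n by (metis le_less_trans mult.commute mult_le_mono2)+
          define t where "t = n * j + k * i - k * l"
          have t: "t + k * l = n * j + k * i" using True by (simp add: t_def)
          have ct: "coeff (pcompose (p l) (monom 1 n)) t =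
            (if t mod n = 0 then coeff (p l) (t div n) else 0)"
            using coeff_pcompose_monom[of "t mod n" n "p l" "t div n"] \<gamma>(2) by simp
          show ?thesis
          proof (cases "l = i")
            case True
            then show ?thesis using ct \<gamma>(2) by (simp add: coeff_monom_mult t_def)
          next
            case False
            have "t mod n \<noteq> 0"
            proof
              assume "t mod n = 0"
              then obtain s where "t = n * s" by auto
              then have "(t + k * l) mod n = k * l" "(n * j + k * i) mod n = k * i"
                using small by simp_all
              then have "k * l = k * i" using t by simp
              then show False using \<gamma>(3) False by simp
            qed
            then show ?thesis using ct False by (simp add: coeff_monom_mult t_def)
          qed
        next
          case False
          then show ?thesis by (auto simp: coeff_monom_mult)
        qed
        then have "coeff H (n * j + k * i) = (\<Sum>l\<le>D'. \<zeta> ^ l * (if l = i then coeff (p i) j else 0))"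
          unfolding H_def coeff_sum coeff_smult by (intro sum.cong) auto
        also have "\<dots> = \<zeta> ^ i * coeff (p i) j"
          using ij(1) by (simp add: if_distrib[of "\<lambda>x. _ * x"] cong: if_cong)
        finally show False using \<open>H = 0\<close> ij \<zeta>(2) by simp
      qed
      then show ?thesis by blast
    qed
  qed
qed

lemma bounded_roots_above_adjoin:
  fixes F :: "'a::alg_closed_field set"
  assumes F: "is_subfield F" and hyp: "bounded_roots_above F"
  shows "bounded_roots_above (adjoin F a)"
proof (cases "algebraic_over F a")
  case True
  show ?thesis unfolding bounded_roots_above_def
  proof (intro allI impI)
    fix E assume E: "is_subfield E" "adjoin F a \<subseteq> E" "finite_over (adjoin F a) E"
    have "finite_over F E" using finite_over_trans[OF F finite_over_adjoin[OF F True] E(3)] .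
    then show "bounded_roots E"
      using hyp E subset_adjoin[OF F, of a] unfolding bounded_roots_above_def by blast
  qed
next
  case False
  then show ?thesis using bounded_roots_above_adjoin_transcendental F hyp by blast
qed

lemma bounded_roots_above_finitely_generated:
  fixes A :: "'a::{alg_closed_field, field_char_0} set"
  assumes "bounded_roots_above (\<rat> :: 'a set)" and "finite A"
  shows "bounded_roots (is_subfield hull (\<rat> \<union> A))"
proof -
  have "bounded_roots_above (is_subfield hull (\<rat> \<union> A))"
    using assms(2)
  proof (induction A rule: finite_induct)
    case empty
    then show ?case using assms(1) by (simp add: hull_same is_subfield_Rats)
  next
    case (insert a A)
    then show ?case
      using bounded_roots_above_adjoin[OF is_subfield_hull, of "\<rat> \<union> A" a] by (simp add: hull_insert_eq_adjoin)
  qed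
  then show ?thesis
    unfolding bounded_roots_above_def using is_subfield_hull finite_over_refl by blast
qed

section \<open>Bounded exponents of roots: number fields\<close>

lemma rational_poly_clear_denominators:
  assumes "p \<in> polys_over (\<rat> :: 'a::field_char_0 set)"
  shows "\<exists>d P. d \<noteq> (0::int) \<and> smult (of_int d) p = (of_int_poly P :: 'a poly)"
  using assms
proof (induction p)
  case 0
  show ?case by (intro exI[of _ 1] exI[of _ 0]) auto
next
  case (pCons c p)
  then obtain d P where dP: "d \<noteq> 0" "smult (of_int d) p = (of_int_poly P :: 'a poly)"
    by (auto simp: polys_over_pCons is_subfield_Rats)
  have "c \<in> \<rat>" using pCons.prems by (simp add: polys_over_pCons is_subfield_Rats)
  then obtain i j where ij: "j > 0" "c = of_int i / of_int j" by (rule Rats_cases')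
  have "smult (of_int (d * j)) (pCons c p) = of_int_poly (pCons (d * i) (smult j P))"
    using ij dP(2)[symmetric] by (simp add: map_poly_pCons hom_distribs mult_ac)
  then show ?case using dP(1) ij(1) by (intro exI[of _ "d * j"] exI) auto
qed

text \<open>The matrix is the companion matrix of an integer polynomial, scaled by its leading
  coefficient \<open>a\<close>; the eigenvector consists of the powers of \<open>\<alpha>\<close>.
  An integer matrix can be read over \<open>'a\<close> and over the complex numbers alike, so no
  embedding between the two is needed.\<close>

lemma integral_eigenvector:
  fixes \<alpha> :: "'a::field_char_0"
  assumes "algebraic_over \<rat> \<alpha>"
  shows "\<exists>a r M v. a \<noteq> (0::int) \<and> M \<in> carrier_mat r r \<and> eigenvector (map_mat of_int M) v (of_int a * \<alpha>)"
proof -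
  obtain p where p: "p \<in> polys_over \<rat>" "p \<noteq> 0" "poly p \<alpha> = 0"
    using assms by (auto simp: algebraic_over_def)
  obtain d P where dP: "d \<noteq> 0" "smult (of_int d) p = (of_int_poly P :: 'a poly)"
    using rational_poly_clear_denominators[OF p(1)] by blast
  have P0: "P \<noteq> 0" using dP p(2) by auto
  have "poly (of_int_poly P) \<alpha> = 0" using p(3) by (simp flip: dP(2))
  define r where "r = degree P"
  define a where "a = lead_coeff P"
  have eq: "of_int a * \<alpha> ^ r = (\<Sum>j<r. - of_int (coeff P j) * \<alpha> ^ j)"
  proof -
    have "0 = (\<Sum>j\<le>r. of_int (coeff P j) * \<alpha> ^ j)"
      using \<open>poly (of_int_poly P) \<alpha> = 0\<close> by (simp add: poly_altdef r_def)
    also have "\<dots> = of_int a * \<alpha> ^ r + (\<Sum>j<r. of_int (coeff P j) * \<alpha> ^ j)"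
      by (simp add: lessThan_Suc_atMost[symmetric] a_def r_def)
    finally show ?thesis by (simp add: sum_negf add_eq_0_iff)
  qed
  have "r > 0"
  proof (rule ccontr)
    assume "\<not> r > 0"
    then have "a = 0" using eq by simp
    then show False using P0 by (simp add: a_def)
  qed
  define M where "M = mat r r (\<lambda>(i, j). if Suc i < r then (if j = Suc i then a else 0) else - coeff P j)"
  define v where "v = vec r (\<lambda>i. \<alpha> ^ i)"
  have "v \<noteq> 0\<^sub>v r"
  proof
    assume "v = 0\<^sub>v r"
    then have "v $ 0 = 0" using \<open>r > 0\<close> by simp
    then show False using \<open>r > 0\<close> by (simp add: v_def)
  qed
  moreover have "map_mat of_int M *\<^sub>v v = (of_int a * \<alpha>) \<cdot>\<^sub>v v"
  proof (rule eq_vecI)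
    fix i assume "i < dim_vec ((of_int a * \<alpha>) \<cdot>\<^sub>v v)"
    then have i: "i < r" by (simp add: v_def)
    have "(map_mat of_int M *\<^sub>v v) $ i = (\<Sum>j<r. of_int (M $$ (i, j)) * \<alpha> ^ j)"
      using i by (simp add: M_def v_def scalar_prod_def lessThan_atLeast0)
    also have "\<dots> = of_int a * \<alpha> ^ Suc i"
    proof (cases "Suc i < r")
      case True
      then have "(\<Sum>j<r. of_int (M $$ (i, j)) * \<alpha> ^ j) = (\<Sum>j<r. if j = Suc i then of_int a * \<alpha> ^ Suc i else 0)"
        using i by (intro sum.cong) (auto simp: M_def)
      then show ?thesis using True by simp
    next
      case False
      then have "Suc i = r" using i by simp
      then show ?thesis using eq i by (simp add: M_def)
    qed
    finally show "(map_mat of_int M *\<^sub>v v) $ i = ((of_int a * \<alpha>) \<cdot>\<^sub>v v) $ i"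
      using i by (simp add: v_def)
  qed (simp add: M_def v_def)
  ultimately show ?thesis
    using P0 by (intro exI[of _ a] exI[of _ r] exI[of _ M] exI[of _ v])
      (auto simp: eigenvector_def a_def M_def v_def)
qed

text \<open>A bound for the operator norm that belongs to the maximum norm; it is submultiplicative
  and dominates the eigenvalues.\<close>

definition row_sums_bounded :: "int mat \<Rightarrow> nat \<Rightarrow> int \<Rightarrow> bool" where
  "row_sums_bounded A r R \<longleftrightarrow> (\<forall>i<r. (\<Sum>j<r. \<bar>A $$ (i, j)\<bar>) \<le> R)"

lemma row_sums_bounded_mult:
  assumes A: "A \<in> carrier_mat r r" "row_sums_bounded A r R"
    and B: "B \<in> carrier_mat r r" "row_sums_bounded B r Q" and "Q \<ge> 0"
  shows "row_sums_bounded (A * B) r (R * Q)"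
  unfolding row_sums_bounded_def
proof (intro allI impI)
  fix i assume i: "i < r"
  have "(\<Sum>j<r. \<bar>(A * B) $$ (i, j)\<bar>) \<le> (\<Sum>j<r. \<Sum>l<r. \<bar>A $$ (i, l)\<bar> * \<bar>B $$ (l, j)\<bar>)"
  proof (rule sum_mono)
    fix j assume "j \<in> {..<r}"
    then have "(A * B) $$ (i, j) = (\<Sum>l<r. A $$ (i, l) * B $$ (l, j))"
      using i A(1) B(1) by (simp add: scalar_prod_def lessThan_atLeast0)
    then show "\<bar>(A * B) $$ (i, j)\<bar> \<le> (\<Sum>l<r. \<bar>A $$ (i, l)\<bar> * \<bar>B $$ (l, j)\<bar>)"
      using sum_abs[of "\<lambda>l. A $$ (i, l) * B $$ (l, j)" "{..<r}"] by (simp add: abs_mult)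
  qed
  also have "\<dots> = (\<Sum>l<r. \<bar>A $$ (i, l)\<bar> * (\<Sum>j<r. \<bar>B $$ (l, j)\<bar>))"
    by (subst sum.swap) (simp add: sum_distrib_left)
  also have "\<dots> \<le> (\<Sum>l<r. \<bar>A $$ (i, l)\<bar> * Q)"
    using B(2) by (intro sum_mono mult_left_mono) (auto simp: row_sums_bounded_def)
  also have "\<dots> \<le> R * Q"
    using A(2) i \<open>Q \<ge> 0\<close> by (auto simp: row_sums_bounded_def sum_distrib_right[symmetric] intro: mult_right_mono)
  finally show "(\<Sum>j<r. \<bar>(A * B) $$ (i, j)\<bar>) \<le> R * Q" .
qed

lemma row_sums_bounded_pow:
  assumes A: "A \<in> carrier_mat r r" "row_sums_bounded A r R" and "R \<ge> 0"
  shows "row_sums_bounded (A ^\<^sub>m k) r (R ^ k)"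
proof (induction k)
  case 0
  have "(\<Sum>j<r. \<bar>(1\<^sub>m r :: int mat) $$ (i, j)\<bar>) = 1" if "i < r" for i
  proof -
    have "(\<Sum>j<r. \<bar>(1\<^sub>m r :: int mat) $$ (i, j)\<bar>) = (\<Sum>j<r. if j = i then 1 else 0)"
      using that by (intro sum.cong) auto
    then show ?thesis using that by simp
  qed
  then show ?case using A by (simp add: row_sums_bounded_def)
next
  case (Suc k)
  then show ?case
    using row_sums_bounded_mult[OF _ Suc A \<open>R \<ge> 0\<close>] A by (simp add: mult.commute)
qed

text \<open>The eigenvalue equation is compared at a coordinate where the eigenvector has largest
  modulus.\<close>

lemma eigenvalue_le_row_sums:
  assumes A: "A \<in> carrier_mat r r" "row_sums_bounded A r R"
    and ev: "eigenvalue (map_mat of_int A :: complex mat) z"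
  shows "norm z \<le> of_int R"
proof -
  obtain u where u: "u \<in> carrier_vec r" "u \<noteq> 0\<^sub>v r" "map_mat of_int A *\<^sub>v u = z \<cdot>\<^sub>v u"
    using ev A unfolding eigenvalue_def eigenvector_def by auto
  obtain i0 where i0: "i0 < r" "u $ i0 \<noteq> 0"
    using u(1,2) by (metis carrier_vecD eq_vecI index_zero_vec)
  have "finite ((\<lambda>i. norm (u $ i)) ` {..<r})" "(\<lambda>i. norm (u $ i)) ` {..<r} \<noteq> {}"
    using i0 by auto
  from Max_in[OF this] obtain i where i: "i < r" "norm (u $ i) = Max ((\<lambda>i. norm (u $ i)) ` {..<r})"
    by auto
  have le: "norm (u $ j) \<le> norm (u $ i)" if "j < r" for j
    using that unfolding i(2) by (intro Max_ge) auto
  have pos: "norm (u $ i) > 0" using le[OF i0(1)] i0(2) by (metis norm_eq_zero norm_ge_zero order_antisym_conv not_le)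
  have "z * u $ i = (z \<cdot>\<^sub>v u) $ i" using i u(1) by simp
  also have "\<dots> = (\<Sum>j<r. of_int (A $$ (i, j)) * u $ j)"
    using i u(1) A(1) by (simp add: scalar_prod_def lessThan_atLeast0 flip: u(3))
  finally have "norm z * norm (u $ i) = norm (\<Sum>j<r. of_int (A $$ (i, j)) * u $ j)"
    by (metis norm_mult)
  also have "\<dots> \<le> (\<Sum>j<r. of_int \<bar>A $$ (i, j)\<bar> * norm (u $ j))"
    by (rule order.trans[OF norm_sum]) (simp add: norm_mult)
  also have "\<dots> \<le> (\<Sum>j<r. of_int \<bar>A $$ (i, j)\<bar> * norm (u $ i))"
    using le by (intro sum_mono mult_left_mono) auto
  also have "\<dots> = of_int (\<Sum>j<r. \<bar>A $$ (i, j)\<bar>) * norm (u $ i)"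
    by (simp add: sum_distrib_right)
  also have "\<dots> \<le> of_int R * norm (u $ i)"
    using A(2) i(1) unfolding row_sums_bounded_def by (intro mult_right_mono) (auto simp only: of_int_le_iff norm_ge_zero)
  finally show ?thesis using pos by simp
qed

text \<open>
  The polynomial is \<open>\<chi>(Y^n)\<close>, where \<open>\<chi>\<close> is the characteristic polynomial of \<open>a^(n-k) M^k\<close> for an integer
  matrix \<open>M\<close> with eigenvalue \<open>a \<alpha>\<close>.
\<close>

lemma root_poly_with_bounded_roots:
  fixes \<alpha> :: "'a::field_char_0"
  assumes "algebraic_over \<rat> \<alpha>"
  shows "\<exists>a C. a \<noteq> (0::int) \<and> C \<ge> (0::real) \<and> (\<forall>\<gamma> n k. k > 0 \<longrightarrow> k \<le> n \<longrightarrow> \<gamma> ^ n = \<alpha> ^ k \<longrightarrow>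
    (\<exists>w :: int poly. lead_coeff w = 1 \<and> poly (of_int_poly w) (of_int a * \<gamma>) = 0 \<and>
      (\<forall>z::complex. poly (of_int_poly w) z = 0 \<longrightarrow> norm z \<le> C)))"
proof -
  obtain a r M v where M: "a \<noteq> (0::int)" "M \<in> carrier_mat r r"
    "eigenvector (map_mat of_int M) v (of_int a * \<alpha>)"
    using integral_eigenvector[OF assms] by blast
  \<comment> \<open>The summand 1 ensures \<open>R \<ge> 1\<close>, so that \<open>R ^ k\<close> can
    be replaced by \<open>R ^ n\<close>.\<close>
  define R where "R = 1 + (\<Sum>i<r. \<Sum>j<r. \<bar>M $$ (i, j)\<bar>)"
  have "(\<Sum>j<r. \<bar>M $$ (i, j)\<bar>) \<le> (\<Sum>i<r. \<Sum>j<r. \<bar>M $$ (i, j)\<bar>)" if "i < r" for i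
    using that by (intro member_le_sum[of i _ "\<lambda>i. \<Sum>j<r. \<bar>M $$ (i, j)\<bar>"]) (auto intro: sum_nonneg)
  then have R: "row_sums_bounded M r R" unfolding row_sums_bounded_def R_def by force
  have "R \<ge> 1" by (simp add: R_def sum_nonneg)
  define C where "C = \<bar>a\<bar> * R"
  have "\<exists>w :: int poly. lead_coeff w = 1 \<and> poly (of_int_poly w) (of_int a * \<gamma>) = 0 \<and>
      (\<forall>z::complex. poly (of_int_poly w) z = 0 \<longrightarrow> norm z \<le> of_int C)"
    if kn: "k > 0" "k \<le> n" and \<gamma>: "\<gamma> ^ n = \<alpha> ^ k" for \<gamma> n k
  proof -
    \<comment> \<open>The exponent \<open>n - k\<close> is chosen so that the eigenvalue
      \<open>a ^ (n - k) * (a * \<alpha>) ^ k\<close> equals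
      \<open>(a * \<gamma>) ^ n\<close>.\<close>
    define W where "W = a ^ (n - k) \<cdot>\<^sub>m (M ^\<^sub>m k)"
    have W: "W \<in> carrier_mat r r" using M by (simp add: W_def)
    define w where "w = pcompose (char_poly W) (monom 1 n)"
    have n: "n > 0" using kn by simp
    have lc: "lead_coeff (char_poly W) = 1" using degree_monic_char_poly[OF W] by simp
    have "lead_coeff w = lead_coeff (char_poly W) * lead_coeff (monom 1 n :: int poly) ^ degree (char_poly W)"
      unfolding w_def using n by (intro lead_coeff_comp) (simp add: degree_monom_eq)
    then have "lead_coeff w = 1" using lc by (simp add: degree_monom_eq)
    moreover have "poly (of_int_poly w) (of_int a * \<gamma>) = 0"
    proof -
      have carr: "(map_mat of_int M :: 'a mat) \<in> carrier_mat r r" using M by simp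
      have v: "v \<in> carrier_vec r" "v \<noteq> 0\<^sub>v r" using M unfolding eigenvector_def by auto
      have pw: "(map_mat of_int (M ^\<^sub>m k) :: 'a mat) = map_mat of_int M ^\<^sub>m k"
        by (rule of_int_hom.mat_hom_pow[OF M(2)])
      have "map_mat of_int W *\<^sub>v v = (of_int a * \<gamma>) ^ n \<cdot>\<^sub>v v"
      proof -
        have "(map_mat of_int W :: 'a mat) = (of_int a ^ (n - k)) \<cdot>\<^sub>m (map_mat of_int M ^\<^sub>m k)"
          unfolding W_def pw[symmetric] using M by (intro eq_matI) auto
        then have "map_mat of_int W *\<^sub>v v = (of_int a ^ (n - k)) \<cdot>\<^sub>m (map_mat of_int M ^\<^sub>m k) *\<^sub>v v"
          by simp
        also have "\<dots> = (of_int a ^ (n - k)) \<cdot>\<^sub>v ((map_mat of_int M ^\<^sub>m k) *\<^sub>v v)"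
          using carr v by (intro eq_vecI) auto
        also have "\<dots> = (of_int a ^ (n - k)) \<cdot>\<^sub>v ((of_int a * \<alpha>) ^ k \<cdot>\<^sub>v v)"
          using eigenvector_pow[OF carr M(3)] by simp
        also have "\<dots> = (of_int a ^ (n - k) * (of_int a * \<alpha>) ^ k) \<cdot>\<^sub>v v"
          by (simp add: smult_smult_assoc)
        also have "of_int a ^ (n - k) * (of_int a * \<alpha>) ^ k = (of_int a * \<gamma>) ^ n"
          using kn \<gamma> by (simp add: power_mult_distrib mult.assoc[symmetric] power_add[symmetric])
        finally show ?thesis .
      qed
      then have "eigenvalue (map_mat of_int W) ((of_int a * \<gamma>) ^ n)"
        using v W unfolding eigenvalue_def eigenvector_def by auto
      then have "poly (char_poly (map_mat of_int W)) ((of_int a * \<gamma>) ^ n) = 0"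
        using eigenvalue_root_char_poly[of "map_mat of_int W :: 'a mat" r] W by simp
      then show ?thesis
        unfolding of_int_hom.char_poly_hom[OF W] w_def
        by (simp add: of_int_poly_hom.base.map_poly_pcompose poly_pcompose poly_monom)
    qed
    moreover have "norm z \<le> of_int C" if z: "poly (of_int_poly w) z = 0" for z :: complex
    proof -
      have "poly (char_poly (map_mat of_int W)) (z ^ n) = 0"
        using z unfolding of_int_hom.char_poly_hom[OF W] w_def
        by (simp add: of_int_poly_hom.base.map_poly_pcompose poly_pcompose poly_monom)
      then have "eigenvalue (map_mat of_int W) (z ^ n)"
        using eigenvalue_root_char_poly[of "map_mat of_int W :: complex mat" r] W by simp
      moreover have "row_sums_bounded W r (\<bar>a\<bar> ^ (n - k) * R ^ k)"
        using row_sums_bounded_pow[OF M(2) R, of k] \<open>R \<ge> 1\<close> M(2)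
        by (auto simp: row_sums_bounded_def W_def abs_mult power_abs simp flip: sum_distrib_left
            intro!: mult_left_mono)
      ultimately have "norm (z ^ n) \<le> of_int (\<bar>a\<bar> ^ (n - k) * R ^ k)"
        by (rule eigenvalue_le_row_sums[OF W, rotated])
      also have "\<bar>a\<bar> ^ (n - k) * R ^ k \<le> \<bar>a\<bar> ^ n * R ^ n"
        using M(1) \<open>R \<ge> 1\<close> kn by (intro mult_mono power_increasing) auto
      finally have "norm z ^ n \<le> of_int C ^ n"
        by (simp add: norm_power C_def power_mult_distrib)
      then show ?thesis
        using n \<open>R \<ge> 1\<close> by (intro power_le_imp_le_base[of "norm z" "n - 1"]) (auto simp: C_def)
    qed
    ultimately show ?thesis by blast
  qed
  moreover have "C \<ge> 0" using \<open>R \<ge> 1\<close> by (simp add: C_def)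
  ultimately show ?thesis
    using M(1) by (intro exI[of _ a] exI[of _ "of_int C"]) auto
qed

text \<open>An annihilating integer polynomial of least degree divides a nonzero integer multiple of
  \<open>w\<close> by pseudo-division; by Gauss's lemma its primitive part divides \<open>w\<close>
  itself.\<close>

lemma primitive_min_poly_dvd:
  fixes \<beta> :: "'a::field_char_0"
  assumes "r \<noteq> 0" "poly (of_int_poly r) \<beta> = 0"
  shows "\<exists>p::int poly. p \<noteq> 0 \<and> poly (of_int_poly p) \<beta> = 0 \<and> degree p \<le> degree r \<and>
    (\<forall>w. poly (of_int_poly w) \<beta> = 0 \<longrightarrow> p dvd w)"
proof -
  define K where "K = {p::int poly. p \<noteq> 0 \<and> poly (of_int_poly p) \<beta> = 0}"
  have "r \<in> K" using assms by (simp add: K_def)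
  then obtain p where p: "p \<in> K" "\<And>q. q \<in> K \<Longrightarrow> degree p \<le> degree q"
    using arg_min_nat_lemma[of "\<lambda>p. p \<in> K" r degree] by (metis (no_types))
  have p': "p \<noteq> 0" "poly (of_int_poly p) \<beta> = 0" using p by (auto simp: K_def)
  have "of_int_poly p = smult (of_int (content p)) (of_int_poly (primitive_part p) :: 'a poly)"
    by (metis content_times_primitive_part of_int_hom.map_poly_hom_smult)
  then have pp: "poly (of_int_poly (primitive_part p)) \<beta> = 0" using p' by simp
  have "primitive_part p dvd w" if w: "poly (of_int_poly w) \<beta> = 0" for w
  proof -
    obtain c q where q: "c \<noteq> 0" "smult c w = p * q + pseudo_mod w p"
      using pseudo_mod(1)[OF p'(1)] by blast
    have "of_int_poly (smult c w) = of_int_poly p * of_int_poly q + (of_int_poly (pseudo_mod w p) :: 'a poly)"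
      unfolding q(2) by (simp add: hom_distribs)
    from arg_cong[OF this, of "\<lambda>f. poly f \<beta>"] have "poly (of_int_poly (pseudo_mod w p)) \<beta> = 0"
      using w p' by (simp add: hom_distribs)
    then have "pseudo_mod w p = 0"
      using pseudo_mod(2)[OF p'(1), of w] p(2)[of "pseudo_mod w p"] by (force simp: K_def)
    then have "p dvd smult c w" using q by simp
    then show ?thesis using dvd_smult_int q(1) by blast
  qed
  then show ?thesis
    using p' pp p(2)[OF \<open>r \<in> K\<close>] by (intro exI[of _ "primitive_part p"]) auto
qed

text \<open>With leading coefficient 1 or -1 the Mahler measure is the product of
  \<open>max 1 (cmod a)\<close> over the roots, hence at most \<open>max 1 C ^ D\<close>. Mignotte's
  bound then limits every coefficient.\<close>

lemma finite_int_polys_bounded_roots: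
  "finite {p::int poly. \<bar>lead_coeff p\<bar> = 1 \<and> degree p \<le> D \<and>
     (\<forall>z::complex. poly (of_int_poly p) z = 0 \<longrightarrow> norm z \<le> C)}" (is "finite ?P")
proof -
  define B where "B = 2 ^ D * max 1 C ^ D"
  have bound: "\<bar>coeff p i\<bar> \<le> \<lfloor>B\<rfloor>" if p: "p \<in> ?P" for p i
  proof -
    let ?q = "of_int_poly p :: complex poly"
    have rt: "norm a \<le> C" if "a \<in> set (complex_roots_complex ?q)" for a
    proof -
      have "poly ?q a = poly (smult (lead_coeff ?q) (\<Prod>a\<leftarrow>complex_roots_complex ?q. [:- a, 1:])) a"
        using complex_roots(1)[of ?q] by simp
      also have "\<dots> = 0"
        using that by (auto simp: poly_prod_list prod_list_zero_iff)
      finally show ?thesis using p by simp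
    qed
    have prod_le: "(\<Prod>a\<leftarrow>as. max 1 (cmod a)) \<le> max 1 C ^ length as" if "\<forall>a\<in>set as. norm a \<le> C" for as
      using that
    proof (induction as)
      case (Cons a as)
      then show ?case by (auto intro!: mult_mono prod_list_nonneg)
    qed auto
    have "mahler_measure p \<le> max 1 C ^ degree p"
      using p rt complex_roots(2)[of ?q] prod_le[of "complex_roots_complex ?q"] unfolding mahler_measure_def mahler_measure_poly_def
      by (simp flip: of_int_abs)
    also have "\<dots> \<le> max 1 C ^ D" using p by (intro power_increasing) auto
    finally have mm: "mahler_measure p \<le> max 1 C ^ D" .
    have "degree p choose i \<le> 2 ^ degree p" by (rule binomial_le_pow2)
    also have "\<dots> \<le> 2 ^ D" using p by (intro power_increasing) auto
    finally have "real (degree p choose i) \<le> real (2 ^ D)" by (rule of_nat_mono)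
    then have ch: "real (degree p choose i) \<le> 2 ^ D" by simp
    have "of_int \<bar>coeff p i\<bar> \<le> (degree p choose i) * mahler_measure p" by (rule Mignotte_bound)
    also have "\<dots> \<le> B" unfolding B_def
      using mm ch mahler_measure_ge_0[of p] by (intro mult_mono) auto
    finally show ?thesis by (simp add: le_floor_iff)
  qed
  have "?P \<subseteq> Poly ` {xs. set xs \<subseteq> {-\<lfloor>B\<rfloor>..\<lfloor>B\<rfloor>} \<and> length xs \<le> Suc D}"
  proof
    fix p assume p: "p \<in> ?P"
    have "set (coeffs p) \<subseteq> {-\<lfloor>B\<rfloor>..\<lfloor>B\<rfloor>}"
    proof
      fix x assume "x \<in> set (coeffs p)"
      then obtain i where "x = coeff p i" using range_coeff[of p] by blast
      then show "x \<in> {-\<lfloor>B\<rfloor>..\<lfloor>B\<rfloor>}" using bound[OF p, of i] by (simp add: abs_le_iff)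
    qed
    moreover have "length (coeffs p) \<le> Suc D" using p by (cases "p = 0") (auto simp: length_coeffs_degree)
    ultimately show "p \<in> Poly ` {xs. set xs \<subseteq> {-\<lfloor>B\<rfloor>..\<lfloor>B\<rfloor>} \<and> length xs \<le> Suc D}"
      by (intro image_eqI[of _ _ "coeffs p"]) auto
  qed
  then show ?thesis
    by (rule finite_subset) (intro finite_imageI finite_lists_length_le finite_atLeastAtMost_int)
qed

text \<open>The powers of \<open>\<alpha>\<close> are distinct, so computing
  \<open>\<gamma> ^ (n0 * n)\<close> in two ways gives \<open>k0 * n = n0 * k\<close>: the ratio
  \<open>n / k\<close> is determined by \<open>\<gamma>\<close>.\<close>

lemma bounded_exponent_ratio:
  fixes \<gamma> \<alpha> :: "'a::field"
  assumes "\<alpha> \<noteq> 0" "\<forall>m>0. \<alpha> ^ m \<noteq> 1"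
  shows "\<exists>N. \<forall>n>0. \<forall>k>0. \<gamma> ^ n = \<alpha> ^ k \<longrightarrow> n \<le> N * k"
proof (cases "\<exists>n>0. \<exists>k>0. \<gamma> ^ n = \<alpha> ^ k")
  case True
  then obtain n0 k0 where 0: "n0 > 0" "k0 > (0::nat)" "\<gamma> ^ n0 = \<alpha> ^ k0" by blast
  have inj: "i = j" if "\<alpha> ^ i = \<alpha> ^ j" for i j
  proof -
    have *: "False" if "i < j" "\<alpha> ^ i = \<alpha> ^ j" for i j
    proof -
      have "\<alpha> ^ j = \<alpha> ^ i * \<alpha> ^ (j - i)" using that(1) by (metis le_add_diff_inverse less_imp_le power_add)
      then have "\<alpha> ^ (j - i) = 1" using that assms(1) by simp
      then show False using that assms(2) by simp
    qed
    show ?thesis using * that by (metis linorder_neqE_nat)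
  qed
  have "n \<le> n0 * k" if "\<gamma> ^ n = \<alpha> ^ k" for n k
  proof -
    have "\<alpha> ^ (k0 * n) = (\<gamma> ^ n0) ^ n" by (simp add: 0 power_mult)
    also have "\<dots> = (\<gamma> ^ n) ^ n0" by (metis power_mult mult.commute)
    also have "\<dots> = \<alpha> ^ (k * n0)" by (simp add: that power_mult)
    finally have "k0 * n = n0 * k" using inj by (simp add: mult.commute)
    then show ?thesis using 0(2) by (metis le_add1 mult_Suc gr0_implies_Suc)
  qed
  then show ?thesis by blast
next
  case False
  then show ?thesis by blast
qed

text \<open>
  Northcott's argument: \<open>a \<gamma>\<close> is an algebraic integer of bounded degree with bounded conjugates, so there
  are only finitely many candidates for \<open>\<gamma>\<close>, and each of them determines the ratio \<open>n/k\<close>.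
\<close>

lemma bounded_roots_above_Rats: "bounded_roots_above (\<rat> :: 'a::field_char_0 set)"
  unfolding bounded_roots_above_def bounded_roots_def
proof (intro allI impI ballI)
  fix E :: "'a set" and \<alpha>
  assume E: "is_subfield E" "\<rat> \<subseteq> E" "finite_over \<rat> E" and \<alpha>: "\<alpha> \<in> E" "\<alpha> \<noteq> 0" "\<forall>m>0. \<alpha> ^ m \<noteq> 1"
  obtain D where D: "degree_at_most \<rat> E D"
    using finite_over_imp_degree_at_most[OF is_subfield_Rats E(3)] by blast
  have "algebraic_over \<rat> \<alpha>"
    using finite_over_imp_algebraic[OF is_subfield_Rats E(1,3) \<alpha>(1)] .
  from root_poly_with_bounded_roots[OF this] obtain a C where a: "a \<noteq> (0::int)" and
    w: "\<And>\<gamma> n k. k > 0 \<Longrightarrow> k \<le> n \<Longrightarrow> \<gamma> ^ n = \<alpha> ^ k \<Longrightarrow>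
    (\<exists>w :: int poly. lead_coeff w = 1 \<and> poly (of_int_poly w) (of_int a * \<gamma>) = 0 \<and>
      (\<forall>z::complex. poly (of_int_poly w) z = 0 \<longrightarrow> norm z \<le> C))"
    by blast
  define P where "P = {p::int poly. \<bar>lead_coeff p\<bar> = 1 \<and> degree p \<le> D \<and>
     (\<forall>z::complex. poly (of_int_poly p) z = 0 \<longrightarrow> norm z \<le> C)}"
  define \<Gamma> where "\<Gamma> = (\<Union>p\<in>P. (\<lambda>b. b / of_int a) ` {b::'a. poly (of_int_poly p) b = 0})"
  have "finite \<Gamma>"
    unfolding \<Gamma>_def
  proof (intro finite_UN_I finite_imageI poly_roots_finite)
    show "finite P" unfolding P_def by (rule finite_int_polys_bounded_roots)
    fix p assume "p \<in> P"
    then show "(of_int_poly p :: 'a poly) \<noteq> 0" by (auto simp: P_def)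
  qed
  have mem: "\<gamma> \<in> \<Gamma>" if \<gamma>: "\<gamma> \<in> E" "k > 0" "k \<le> n" "\<gamma> ^ n = \<alpha> ^ k" for \<gamma> n k
  proof -
    let ?b = "of_int a * \<gamma>"
    have "of_int a \<in> E" using E(2) by auto
    then have "?b \<in> E" using \<gamma> E(1) by (simp add: subfield_mult)
    then have "dependent_on \<rat> {..D} (\<lambda>i. ?b ^ i)"
      using D E(1) unfolding degree_at_most_def by (simp add: subfield_power)
    from poly_of_combination[OF is_subfield_Rats this] obtain r where
      r: "r \<in> polys_over \<rat>" "r \<noteq> 0" "degree r \<le> D" "poly r ?b = 0" by blast
    obtain d R where dR: "d \<noteq> 0" "smult (of_int d) r = (of_int_poly R :: 'a poly)"
      using rational_poly_clear_denominators[OF r(1)] by blast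
    have "R \<noteq> 0" using dR r(2) by auto
    moreover have "poly (of_int_poly R) ?b = 0" by (simp add: r(4) flip: dR(2))
    \<comment> \<open>The degree bound for \<open>p\<close> comes from the rational relation
      \<open>r\<close>; the leading coefficient and the root bound come from the monic multiple
      \<open>w\<close>.\<close>
    ultimately obtain p where p: "p \<noteq> 0" "poly (of_int_poly p) ?b = 0" "degree p \<le> degree R"
      "\<And>w. poly (of_int_poly w) ?b = 0 \<Longrightarrow> p dvd w"
      using primitive_min_poly_dvd by blast
    obtain w where w: "lead_coeff w = 1" "poly (of_int_poly w) ?b = 0"
      "\<forall>z::complex. poly (of_int_poly w) z = 0 \<longrightarrow> norm z \<le> C"
      using w[OF \<gamma>(2-4)] by blast
    obtain s where s: "w = p * s" using p(4)[OF w(2)] by auto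
    have "lead_coeff p dvd 1" using w(1) by (metis s lead_coeff_mult dvd_triv_left)
    then have "\<bar>lead_coeff p\<bar> = 1" by simp
    moreover have "degree R = degree r"
    proof -
      have "degree R = degree (of_int_poly R :: 'a poly)" by simp
      also have "\<dots> = degree r" using dR by (simp flip: dR(2))
      finally show ?thesis .
    qed
    moreover have "poly (of_int_poly w) z = 0" if "poly (of_int_poly p) z = 0" for z :: complex
      using that by (simp add: s hom_distribs)
    ultimately have "p \<in> P" using w(3) p(3) r(3) by (auto simp: P_def)
    then show ?thesis unfolding \<Gamma>_def using p(2) a
      by (intro UN_I[of p] image_eqI[of _ _ ?b]) auto
  qed
  obtain f where f: "\<And>\<gamma> n k. n > 0 \<Longrightarrow> k > 0 \<Longrightarrow> \<gamma> ^ n = \<alpha> ^ k \<Longrightarrow> n \<le> f \<gamma> * k"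
    using bounded_exponent_ratio[OF \<alpha>(2,3)] by metis
  \<comment> \<open>The summand 1 covers the case \<open>n < k\<close>.\<close>
  define N where "N = 1 + (\<Sum>\<gamma>\<in>\<Gamma>. f \<gamma>)"
  have "n \<le> N * k" if \<gamma>: "\<gamma> \<in> E" "n > 0" "k > 0" "\<gamma> ^ n = \<alpha> ^ k" for \<gamma> n k
  proof (cases "k \<le> n")
    case True
    have "f \<gamma> \<le> (\<Sum>\<gamma>\<in>\<Gamma>. f \<gamma>)"
      using mem[OF \<gamma>(1,3) True \<gamma>(4)] \<open>finite \<Gamma>\<close> by (intro member_le_sum) auto
    then have "f \<gamma> * k \<le> N * k" by (intro mult_le_mono1) (simp add: N_def)
    then show ?thesis using f[OF \<gamma>(2-4)] by linarith
  qed (simp add: N_def)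
  then show "\<exists>N. \<forall>\<gamma>\<in>E. \<forall>n>0. \<forall>k>0. \<gamma> ^ n = \<alpha> ^ k \<longrightarrow> n \<le> N * k" by blast
qed

section \<open>Conjugacy of the roots of an element\<close>

lemma proots_prod_linear: "proots (\<Prod>x\<in>#A. [:- x, 1:]) = (A :: 'a::idom multiset)"
proof (induction A)
  case (add x A)
  have "(\<Prod>x\<in>#A. [:- x, 1:]) \<noteq> 0" by (auto simp: prod_mset_zero_iff)
  moreover have "[:- x, 1:] \<noteq> 0" by simp
  ultimately have "proots ([:- x, 1:] * (\<Prod>x\<in>#A. [:- x, 1:])) = proots [:- x, 1:] + A"
    using add by (metis proots_mult)
  also have "proots [:- x, 1:] = {#x#}" by (metis minus_minus proots_linear_factor)
  finally show ?case by simp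
qed auto

lemma alg_closed_proots:
  fixes p :: "'a::alg_closed_field poly"
  assumes "p \<noteq> 0"
  shows "p = smult (lead_coeff p) (\<Prod>x\<in>#proots p. [:- x, 1:])" and "size (proots p) = degree p"
proof -
  obtain A where A: "size A = degree p" "p = smult (lead_coeff p) (\<Prod>x\<in>#A. [:- x, 1:])"
    using alg_closed_imp_factorization[OF assms] by blast
  have "proots (smult (lead_coeff p) (\<Prod>x\<in>#A. [:- x, 1:])) = A"
    using assms proots_prod_linear[of A] by (subst proots_smult) auto
  then have *: "A = proots p" unfolding A(2)[symmetric] by (rule sym)
  show "p = smult (lead_coeff p) (\<Prod>x\<in>#proots p. [:- x, 1:])" "size (proots p) = degree p"
    by (fact A[unfolded *])+
qed

text \<open>The ideal of \<open>b\<close> stands for its conjugacy class: algebraic elements are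
  conjugate over \<open>F\<close> exactly if these ideals agree. This avoids automorphisms.\<close>

definition vanishing :: "'a::field set \<Rightarrow> 'a \<Rightarrow> 'a poly set" where
  "vanishing F b = {p \<in> polys_over F. poly p b = 0}"

definition is_min_poly :: "'a::field set \<Rightarrow> 'a \<Rightarrow> 'a poly \<Rightarrow> bool" where
  "is_min_poly F b p \<longleftrightarrow> p \<in> polys_over F \<and> lead_coeff p = 1 \<and> poly p b = 0 \<and>
     (\<forall>g\<in>polys_over F. poly g b = 0 \<longrightarrow> (\<exists>s\<in>polys_over F. g = p * s))"

lemma min_poly_exists:
  assumes F: "is_subfield F" and b: "algebraic_over F b"
  shows "\<exists>p. is_min_poly F b p"
proof -
  define K where "K = {p \<in> polys_over F. p \<noteq> 0 \<and> poly p b = 0}"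
  obtain p0 where "p0 \<in> K" using b by (auto simp: K_def algebraic_over_def)
  then obtain p where p: "p \<in> K" "\<And>q. q \<in> K \<Longrightarrow> degree p \<le> degree q"
    using arg_min_nat_lemma[of "\<lambda>p. p \<in> K" p0 degree] by (metis (no_types))
  define m where "m = smult (inverse (lead_coeff p)) p"
  have p': "p \<in> polys_over F" "p \<noteq> 0" "poly p b = 0" using p by (auto simp: K_def)
  have m: "m \<in> polys_over F" "lead_coeff m = 1" "poly m b = 0" "m \<noteq> 0" "degree m = degree p"
    using p' by (auto simp: m_def intro!: polys_over_smult subfield_inverse F polys_overD)
  have "\<exists>s\<in>polys_over F. g = m * s" if g: "g \<in> polys_over F" "poly g b = 0" for g
  proof -
    obtain s r where sr: "s \<in> polys_over F" "r \<in> polys_over F" "g = m * s + r"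
      "r = 0 \<or> degree r < degree m"
      using polys_over_division[OF F m(1,4) g(1)] by blast
    have "poly r b = 0" using sr(3) g(2) m(3) by simp
    then have "r = 0" using sr(2,4) p(2)[of r] m(5) by (force simp: K_def)
    then show ?thesis using sr by auto
  qed
  then show ?thesis using m unfolding is_min_poly_def by blast
qed

context
  fixes F :: "'a::{alg_closed_field, field_char_0} set" and b :: 'a and p
  assumes F: "is_subfield F" and p: "is_min_poly F b p"
begin

lemma min_poly_nonzero: "p \<noteq> 0"
  and min_poly_degree: "degree p > 0"
proof -
  have lc: "lead_coeff p = 1" and r: "poly p b = 0" using p by (auto simp: is_min_poly_def)
  show "p \<noteq> 0" using lc by auto
  show "degree p > 0"
  proof (rule ccontr)
    assume "\<not> degree p > 0"
    then have "degree p = 0" by simp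
    then have "p = [:1:]" using lc by (metis degree_0_id pCons_0_0 lead_coeff_pCons(2) degree_eq_zeroE)
    then show False using r by simp
  qed
qed

text \<open>The minimal polynomial \<open>q\<close> of \<open>c\<close> divides \<open>p\<close>. If
  it did not vanish at \<open>b\<close>, the cofactor would, and would be a multiple of
  \<open>p\<close>; then \<open>q\<close> would be a unit in spite of its root
  \<open>c\<close>.\<close>

lemma vanishing_eq_if_root_min_poly:
  assumes c: "poly p c = 0"
  shows "vanishing F c = vanishing F b"
proof -
  have pF: "p \<in> polys_over F" and pb: "poly p b = 0"
    and dv: "\<And>g. g \<in> polys_over F \<Longrightarrow> poly g b = 0 \<Longrightarrow> \<exists>s\<in>polys_over F. g = p * s"
    using p by (auto simp: is_min_poly_def)
  have 1: "vanishing F b \<subseteq> vanishing F c"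
    using dv c unfolding vanishing_def by fastforce
  have "algebraic_over F c" using pF c min_poly_nonzero by (auto simp: algebraic_over_def)
  then obtain q where q: "is_min_poly F c q" using min_poly_exists[OF F] by blast
  then have qF: "q \<in> polys_over F" and qc: "poly q c = 0"
    and dq: "\<And>g. g \<in> polys_over F \<Longrightarrow> poly g c = 0 \<Longrightarrow> \<exists>s\<in>polys_over F. g = q * s"
    by (auto simp: is_min_poly_def)
  obtain s where s: "s \<in> polys_over F" "p = q * s" using dq[OF pF c] by blast
  have "poly q b = 0"
  proof (rule ccontr)
    assume "poly q b \<noteq> 0"
    then have "poly s b = 0" using pb s(2) by simp
    then obtain t where t: "s = p * t" using dv[OF s(1)] by blast
    then have "p * (q * t) = p * 1" using s(2) by (simp add: mult_ac)
    then have "q * t = 1" using min_poly_nonzero by (metis mult_cancel_left)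
    then have "q dvd 1" by (metis dvd_triv_left)
    then show False using qc by (metis dvdE mult_zero_left poly_1 poly_mult zero_neq_one)
  qed
  then obtain t where t: "q = p * t" using dv[OF qF] by blast
  have "vanishing F c \<subseteq> vanishing F b"
  proof
    fix g assume "g \<in> vanishing F c"
    then obtain u where "g \<in> polys_over F" "g = q * u" using dq by (auto simp: vanishing_def)
    then show "g \<in> vanishing F b" using t pb by (simp add: vanishing_def)
  qed
  with 1 show ?thesis by blast
qed

text \<open>A multiple root would be conjugate to \<open>b\<close>, so the derivative would vanish
  at \<open>b\<close> too and be divisible by \<open>p\<close>, which is impossible in
  characteristic 0.\<close>

lemma min_poly_eq_prod:
  "p = (\<Prod>x\<in>{x. poly p x = 0}. [:- x, 1:])" and card_roots_min_poly: "card {x. poly p x = 0} = degree p"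
proof -
  have lc: "lead_coeff p = 1" and pF: "p \<in> polys_over F" using p by (auto simp: is_min_poly_def)
  have "rsquarefree p"
    unfolding rsquarefree_roots
  proof (intro allI notI)
    fix a assume a: "poly p a = 0 \<and> poly (pderiv p) a = 0"
    then have "pderiv p \<in> vanishing F b"
      using vanishing_eq_if_root_min_poly[of a] polys_over_pderiv[OF F pF] by (auto simp: vanishing_def)
    then obtain s where "pderiv p = p * s" using p by (auto simp: is_min_poly_def vanishing_def)
    then have "p dvd pderiv p" by simp
    then show False using min_poly_degree not_dvd_pderiv[of p] by blast
  qed
  then have "count (proots p) x \<le> 1" for x
    by (auto simp: rsquarefree_def count_proots[OF min_poly_nonzero]) (metis le0 le_refl)
  then have "proots p = mset_set (set_mset (proots p))"
    by (intro multiset_eqI) (metis count_eq_zero_iff count_mset_set' finite_set_mset le_antisym less_one not_le)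
  moreover have "set_mset (proots p) = {x. poly p x = 0}" using min_poly_nonzero by simp
  ultimately have *: "proots p = mset_set {x. poly p x = 0}" by simp
  show "p = (\<Prod>x\<in>{x. poly p x = 0}. [:- x, 1:])"
    using alg_closed_proots(1)[OF min_poly_nonzero] unfolding lc * prod_unfold_prod_mset smult_1_left .
  show "card {x. poly p x = 0} = degree p"
    using alg_closed_proots(2)[OF min_poly_nonzero] * by simp
qed

end

lemma finite_nth_roots:
  fixes \<alpha> :: "'a::idom" assumes "n > 0" shows "finite {b. b ^ n = \<alpha>}" "card {b. b ^ n = \<alpha>} \<le> n"
proof -
  let ?p = "monom 1 n - [:\<alpha>:]"
  have "coeff ?p n = 1" using assms by (simp add: coeff_pCons split: nat.split)
  then have p: "?p \<noteq> 0" by (metis coeff_0 zero_neq_one)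
  have eq: "{b. b ^ n = \<alpha>} = {b. poly ?p b = 0}" by (auto simp: poly_monom)
  show "finite {b. b ^ n = \<alpha>}" unfolding eq using p by (rule poly_roots_finite)
  have "degree ?p \<le> n" by (intro degree_diff_le) (auto simp: degree_monom_le)
  then show "card {b. b ^ n = \<alpha>} \<le> n" unfolding eq using card_poly_roots_bound[OF p] by linarith
qed

text \<open>The product \<open>\<gamma>\<close> of the \<open>k\<close> conjugates of \<open>b\<close> lies in \<open>F\<close> and satisfies \<open>\<gamma>^n = \<alpha>^k\<close>.\<close>

lemma conjugates_many:
  fixes F :: "'a::{alg_closed_field, field_char_0} set"
  assumes F: "is_subfield F" and \<alpha>: "\<alpha> \<in> F"
    and N: "\<And>\<gamma> n k. \<gamma> \<in> F \<Longrightarrow> n > 0 \<Longrightarrow> k > 0 \<Longrightarrow> \<gamma> ^ n = \<alpha> ^ k \<Longrightarrow> n \<le> N * k"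
    and n: "n > 0" and b: "b ^ n = \<alpha>"
  shows "n \<le> N * card {c. c ^ n = \<alpha> \<and> vanishing F c = vanishing F b}"
proof -
  let ?m = "monom 1 n - [:\<alpha>:]"
  have mF: "?m \<in> polys_over F"
    using F \<alpha> by (intro polys_over_diff polys_over_monom) (auto simp: polys_over_pCons subfield_1)
  have "coeff ?m n = 1" using n by (simp add: coeff_pCons split: nat.split)
  then have "?m \<noteq> 0" by (metis coeff_0 zero_neq_one)
  moreover have mb: "poly ?m b = 0" using b by (simp add: poly_monom)
  ultimately have "algebraic_over F b" using mF unfolding algebraic_over_def by blast
  then obtain p where p: "is_min_poly F b p" using min_poly_exists[OF F] by blast
  define R where "R = {x. poly p x = 0}"
  define k where "k = degree p"
  have k: "k > 0" using min_poly_degree[OF F p] by (simp add: k_def)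
  have R: "card R = k" "p = (\<Prod>x\<in>R. [:- x, 1:])"
    unfolding R_def k_def by (fact card_roots_min_poly[OF F p], fact min_poly_eq_prod[OF F p])
  have pw: "x ^ n = \<alpha> \<and> vanishing F x = vanishing F b" if "x \<in> R" for x
  proof -
    have v: "vanishing F x = vanishing F b"
      using vanishing_eq_if_root_min_poly[OF F p] that by (simp add: R_def)
    then have "?m \<in> vanishing F x" using mF mb by (simp add: vanishing_def)
    then show ?thesis using v by (simp add: vanishing_def poly_monom)
  qed
  have "(\<Prod>x\<in>R. - x) = poly p 0" by (subst R(2)) (simp add: poly_prod)
  also have "\<dots> \<in> F" using p by (simp add: is_min_poly_def polys_overD poly_0_coeff_0)
  finally have "(\<Prod>x\<in>R. - x) \<in> F" .
  then have "(- 1) ^ k * (\<Prod>x\<in>R. - x) \<in> F"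
    by (intro subfield_mult subfield_power subfield_uminus subfield_1 F)
  also have "(- 1) ^ k * (\<Prod>x\<in>R. - x) = (\<Prod>x\<in>R. x)"
    by (simp add: R(1) prod_uminus flip: mult.assoc power_mult_distrib)
  finally have "(\<Prod>x\<in>R. x) \<in> F" .
  moreover have "(\<Prod>x\<in>R. x) ^ n = \<alpha> ^ k" using pw R(1) by (simp add: prod_power_distrib)
  ultimately have "n \<le> N * k" using N n k by blast
  also have "k \<le> card {c. c ^ n = \<alpha> \<and> vanishing F c = vanishing F b}"
    unfolding R(1)[symmetric]
    by (rule card_mono) (use pw finite_nth_roots(1)[OF n, of \<alpha>] in \<open>auto intro: rev_finite_subset\<close>)
  finally show ?thesis by simp
qed

text \<open>There are at most \<open>n\<close> roots, and each conjugacy class contains at least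
  \<open>n / N\<close> of them.\<close>

lemma card_vanishing_le:
  fixes F :: "'a::{alg_closed_field, field_char_0} set"
  assumes F: "is_subfield F" and \<alpha>: "\<alpha> \<in> F"
    and N: "\<And>\<gamma> n k. \<gamma> \<in> F \<Longrightarrow> n > 0 \<Longrightarrow> k > 0 \<Longrightarrow> \<gamma> ^ n = \<alpha> ^ k \<Longrightarrow> n \<le> N * k"
    and n: "n > 0"
  shows "card (vanishing F ` {b. b ^ n = \<alpha>}) \<le> N"
proof -
  define B where "B = {b. b ^ n = \<alpha>}"
  have B: "finite B" "card B \<le> n" using finite_nth_roots[OF n] by (auto simp: B_def)
  have "n * card (vanishing F ` B) = (\<Sum>Z\<in>vanishing F ` B. n)" by simp
  also have "\<dots> \<le> (\<Sum>Z\<in>vanishing F ` B. N * card {b \<in> B. vanishing F b = Z})"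
    using conjugates_many[OF F \<alpha> N n] by (intro sum_mono) (auto simp: B_def)
  also have "\<dots> = N * (\<Sum>Z\<in>vanishing F ` B. \<Sum>b\<in>{b \<in> B. vanishing F b = Z}. 1)"
    by (simp add: sum_distrib_left)
  also have "\<dots> = N * card B"
    using sum.image_gen[OF B(1), of "\<lambda>_. 1::nat" "vanishing F"] by simp
  also have "\<dots> \<le> N * n" using B(2) by simp
  finally show ?thesis using n by (simp add: B_def mult.commute)
qed

text \<open>Roots \<open>b\<close> and \<open>\<omega> * b\<close> are those with the same
  \<open>(n div N)\<close>-th power. The point is that one \<open>N\<close> serves all its multiples
  \<open>n\<close>.\<close>

definition stable_level :: "'a::field set \<Rightarrow> 'a \<Rightarrow> nat \<Rightarrow> bool" where
  "stable_level F \<alpha> N \<longleftrightarrow> N > 0 \<and> (\<forall>n>0. N dvd n \<longrightarrow> (\<forall>b \<omega>. b ^ n = \<alpha> \<longrightarrow> \<omega> ^ (n div N) = 1 \<longrightarrow>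
     vanishing F (\<omega> * b) = vanishing F b))"

lemma stable_level_mult:
  fixes F :: "'a::field set"
  assumes "stable_level F \<alpha> N" "N dvd M" "M > 0"
  shows "stable_level F \<alpha> M"
  unfolding stable_level_def
proof (intro conjI allI impI assms(3))
  fix n and b \<omega> :: 'a assume n: "n > 0" "M dvd n" and b: "b ^ n = \<alpha>" and \<omega>: "\<omega> ^ (n div M) = 1"
  obtain u where u: "M = N * u" using assms(2) by (rule dvdE)
  obtain v where v: "n = M * v" using n(2) by (rule dvdE)
  have "N > 0" using assms(1) by (simp add: stable_level_def)
  then have "n div N = v * u" unfolding v u by (simp add: mult_ac)
  moreover have "n div M = v" unfolding v using assms(3) by simp
  ultimately have "n div N = (n div M) * u" by simp
  then have "\<omega> ^ (n div N) = 1" using \<omega> by (simp add: power_mult)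
  moreover have "N dvd n" using assms(2) n(2) by (rule dvd_trans)
  ultimately show "vanishing F (\<omega> * b) = vanishing F b"
    using assms(1) n b unfolding stable_level_def by blast
qed

text \<open>
  The number of conjugacy classes of \<open>n\<close>-th roots of \<open>\<alpha>\<close> grows along divisibility of \<open>n\<close>, because \<open>b \<mapsto> b^q\<close>
  induces a surjection on the classes. Beyond a level where it is maximal the surjection is injective.
\<close>

lemma stable_level_exists:
  fixes F :: "'a::{alg_closed_field, field_char_0} set"
  assumes F: "is_subfield F" "bounded_roots F" and \<alpha>: "\<alpha> \<in> F" "\<alpha> \<noteq> 0" "\<forall>m>0. \<alpha> ^ m \<noteq> 1"
  shows "\<exists>N. stable_level F \<alpha> N"
proof -
  obtain N where N: "\<And>\<gamma> n k. \<gamma> \<in> F \<Longrightarrow> n > 0 \<Longrightarrow> k > 0 \<Longrightarrow> \<gamma> ^ n = \<alpha> ^ k \<Longrightarrow> n \<le> N * k"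
    using F(2) \<alpha> unfolding bounded_roots_def by metis
  define V where "V n = vanishing F ` {b. b ^ n = \<alpha>}" for n :: nat
  have "\<exists>M. M > 0 \<and> (\<forall>n. n > 0 \<longrightarrow> card (V n) \<le> card (V M))"
    unfolding V_def
    by (rule ex_has_greatest_nat[where b = "Suc N" and k = 1])
      (use card_vanishing_le[OF F(1) \<alpha>(1) N] in \<open>auto simp: less_Suc_eq_le intro: le_SucI\<close>)
  then obtain M where M: "M > 0" "\<And>n. n > 0 \<Longrightarrow> card (V n) \<le> card (V M)" by blast
  have "vanishing F (\<omega> * b) = vanishing F b"
    if n: "n > 0" "M dvd n" and b: "b ^ n = \<alpha>" and \<omega>: "\<omega> ^ (n div M) = 1" for n and b \<omega> :: 'a
  proof -
    define q where "q = n div M"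
    have q: "n = q * M" "q > 0" using n M by (auto simp: q_def)
    \<comment> \<open>The effect of \<open>c \<mapsto> c ^ q\<close> on ideals: a polynomial
      \<open>p\<close> vanishes at \<open>c ^ q\<close> exactly if \<open>p(Y^q)\<close> vanishes at
      \<open>c\<close>.\<close>
    define f where "f Z = {p \<in> polys_over F. pcompose p (monom 1 q) \<in> Z}" for Z
    have f: "f (vanishing F c) = vanishing F (c ^ q)" for c
      using F(1) by (auto simp: f_def vanishing_def poly_pcompose poly_monom
          intro!: polys_over_pcompose polys_over_monom subfield_1)
    have "V M \<subseteq> f ` V n"
    proof
      fix Z assume "Z \<in> V M"
      then obtain c where c: "c ^ M = \<alpha>" "Z = vanishing F c" by (auto simp: V_def)
      obtain d where d: "d ^ q = c" using nth_root_exists q(2) by blast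
      then have "d ^ n = \<alpha>" using c by (simp add: q(1) power_mult)
      then show "Z \<in> f ` V n" using f[of d] c d unfolding V_def by blast
    qed
    moreover have "finite (V n)" using finite_nth_roots(1)[OF n(1), of \<alpha>] by (simp add: V_def)
    ultimately have "card (V M) \<le> card (f ` V n)" by (intro card_mono) auto
    then have "card (V n) \<le> card (f ` V n)" using M(2)[OF n(1)] by simp
    then have "card (f ` V n) = card (V n)"
      using card_image_le[OF \<open>finite (V n)\<close>, of f] by linarith
    then have inj: "inj_on f (V n)" using \<open>finite (V n)\<close> by (simp add: eq_card_imp_inj_on)
    have eq: "f (vanishing F (\<omega> * b)) = f (vanishing F b)"
      using \<omega> by (simp add: f q_def power_mult_distrib)
    have "\<omega> ^ q = 1" using \<omega> by (simp add: q_def)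
    then have "\<omega> ^ n = 1" by (simp add: q(1) power_mult)
    then have "(\<omega> * b) ^ n = \<alpha>" using b by (simp add: power_mult_distrib)
    then have "vanishing F (\<omega> * b) \<in> V n" "vanishing F b \<in> V n" using b by (auto simp: V_def)
    then show ?thesis using inj eq by (meson inj_onD)
  qed
  then show ?thesis using M(1) unfolding stable_level_def by blast
qed

lemma stable_level_uniform:
  fixes F :: "'a::{alg_closed_field, field_char_0} set"
  assumes F: "is_subfield F" "bounded_roots F" and "finite A" "A \<subseteq> F" "0 \<notin> A" "\<And>\<alpha> m. \<alpha> \<in> A \<Longrightarrow> m > 0 \<Longrightarrow> \<alpha> ^ m \<noteq> 1"
  shows "\<exists>N>0. \<forall>\<alpha>\<in>A. stable_level F \<alpha> N"
proof -
  have "\<exists>N. stable_level F \<alpha> N" if "\<alpha> \<in> A" for \<alpha>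
    using that assms stable_level_exists[OF F, of \<alpha>] by fastforce
  then obtain f where f: "\<And>\<alpha>. \<alpha> \<in> A \<Longrightarrow> stable_level F \<alpha> (f \<alpha>)" by metis
  then have pos: "\<And>\<alpha>. \<alpha> \<in> A \<Longrightarrow> f \<alpha> > 0" by (simp add: stable_level_def)
  have "stable_level F \<alpha> (prod f A)" if "\<alpha> \<in> A" for \<alpha>
    using f[OF that] dvd_prodI[OF \<open>finite A\<close> that] prod_pos[of A f] pos by (auto intro: stable_level_mult)
  then show ?thesis using pos by (intro exI[of _ "prod f A"]) (auto intro: prod_pos)
qed

text \<open>In characteristic 0 the multiplicity of a root is one more than in the derivative, which
  again has coefficients in \<open>F\<close>.\<close>

lemma order_eq_if_vanishing_eq:
  fixes F :: "'a::field_char_0 set"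
  assumes F: "is_subfield F" and v: "vanishing F b = vanishing F c"
  shows "g \<in> polys_over F \<Longrightarrow> g \<noteq> 0 \<Longrightarrow> order b g = order c g"
proof (induction "degree g" arbitrary: g rule: less_induct)
  case less
  have iff: "poly g b = 0 \<longleftrightarrow> poly g c = 0" using v less.prems by (auto simp: vanishing_def)
  show ?case
  proof (cases "poly g b = 0")
    case False
    then show ?thesis using iff by (simp add: order_0I)
  next
    case True
    then have o: "order b g \<noteq> 0" "order c g \<noteq> 0" using iff less.prems by (auto simp: order_root)
    have "degree g \<noteq> 0"
    proof
      assume "degree g = 0"
      then obtain a where "g = [:a:]" by (auto elim: degree_eq_zeroE)
      then show False using True less.prems by simp
    qed
    then have d: "pderiv g \<noteq> 0" "degree (pderiv g) < degree g"
      by (auto simp: pderiv_eq_0_iff degree_pderiv)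
    have "order b (pderiv g) = order c (pderiv g)"
      using less.hyps[OF d(2) polys_over_pderiv[OF F less.prems(1)] d(1)] .
    then show ?thesis using order_pderiv[OF less.prems(2) True] order_pderiv[OF less.prems(2)] iff True by simp
  qed
qed

section \<open>Exponents of divisors of f(Y^n)\<close>

lemma coeff_linear_mult:
  "coeff ([:a, b:] * P) j = a * coeff P j + (case j of 0 \<Rightarrow> 0 | Suc i \<Rightarrow> b * coeff P i)"
  for P :: "'a::comm_ring_1 poly"
  by (cases j) (simp_all add: mult_pCons_left)

text \<open>There is no complex conjugation on \<open>'a\<close>. An element satisfying the same
  integer polynomials as a complex root of unity allows the zero pattern of coefficients to be
  studied over the complex numbers. It is any root of the primitive minimal polynomial of the
  latter.\<close>

lemma root_of_unity_transfer:
  assumes "M > 0"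
  shows "\<exists>\<zeta> :: 'a::{alg_closed_field, field_char_0}. \<forall>P :: int poly.
    poly (of_int_poly P) \<zeta> = 0 \<longleftrightarrow> poly (of_int_poly P) (cis (2 * pi / real M)) = 0"
proof -
  let ?z = "cis (2 * pi / real M)"
  have "?z ^ M = 1" using assms by (simp add: DeMoivre)
  then have r: "poly (of_int_poly (monom 1 M - 1)) ?z = 0"
    by (simp add: hom_distribs poly_monom)
  have "coeff (monom 1 M - 1 :: int poly) M = 1" using assms by simp
  then have "monom 1 M - 1 \<noteq> (0 :: int poly)" by (metis coeff_0 zero_neq_one)
  from primitive_min_poly_dvd[OF this r] obtain p :: "int poly" where
    p: "p \<noteq> 0" "poly (of_int_poly p) ?z = 0" "\<And>w. poly (of_int_poly w) ?z = 0 \<Longrightarrow> p dvd w"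
    by blast
  have "degree p \<noteq> 0"
  proof
    assume "degree p = 0"
    then obtain c where "p = [:c:]" by (auto elim: degree_eq_zeroE)
    then show False using p by simp
  qed
  then have "degree (of_int_poly p :: 'a poly) > 0" by simp
  then obtain \<zeta> :: 'a where \<zeta>: "poly (of_int_poly p) \<zeta> = 0"
    using alg_closed_imp_poly_has_root by blast
  obtain p' :: "int poly" where
    p': "p' \<noteq> 0" "poly (of_int_poly p') \<zeta> = 0" "\<And>w. poly (of_int_poly w) \<zeta> = 0 \<Longrightarrow> p' dvd w"
    using primitive_min_poly_dvd[OF p(1) \<zeta>] by blast
  obtain s where s: "p = p' * s" using p'(3)[OF \<zeta>] by (rule dvdE)
  have p'z: "poly (of_int_poly p') ?z = 0"
  proof (rule ccontr)
    assume "poly (of_int_poly p') ?z \<noteq> 0"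
    then have "poly (of_int_poly s) ?z = 0" using p(2) by (simp add: s hom_distribs)
    then obtain t where t: "s = p * t" using p(3) by (metis dvdE)
    have "p * (p' * t) = p * 1" by (subst (2) s, subst t) (simp add: mult_ac)
    then have "p' * t = 1" using p(1) mult_left_cancel by blast
    then have "poly (of_int_poly (p' * t)) \<zeta> = 1" by simp
    then show False using p'(2) by (simp add: hom_distribs)
  qed
  have "poly (of_int_poly P) \<zeta> = 0 \<longleftrightarrow> poly (of_int_poly P) ?z = 0" for P
  proof
    assume "poly (of_int_poly P) \<zeta> = 0"
    then obtain t where "P = p' * t" using p'(3) by (metis dvdE)
    then show "poly (of_int_poly P) ?z = 0" using p'z by (simp add: hom_distribs)
  next
    assume "poly (of_int_poly P) ?z = 0"
    then obtain t where "P = p * t" using p(3) by (metis dvdE)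
    then show "poly (of_int_poly P) \<zeta> = 0" using \<zeta> by (simp add: hom_distribs)
  qed
  then show ?thesis by blast
qed

text \<open>The equation \<open>\<zeta> ^ i = \<zeta> ^ j\<close> is an integer polynomial relation,
  so it holds exactly if it holds for the complex root of unity.\<close>

lemma primitive_root_of_unity:
  assumes M: "M > 0" and \<zeta>: "\<And>P :: int poly. poly (of_int_poly P) \<zeta> = 0 \<longleftrightarrow>
    poly (of_int_poly P) (cis (2 * pi / real M)) = 0"
  shows "\<zeta> ^ M = 1" and "\<zeta> ^ i = 1 \<Longrightarrow> M dvd i"
    and "x ^ M = 1 \<Longrightarrow> \<exists>i. x = (\<zeta> :: 'a::{alg_closed_field, field_char_0}) ^ i"
proof -
  let ?z = "cis (2 * pi / real M)"
  have zp: "?z ^ i = cis (2 * pi * real i / real M)" for i by (simp add: DeMoivre mult_ac)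
  have eq: "\<zeta> ^ i = \<zeta> ^ j \<longleftrightarrow> ?z ^ i = ?z ^ j" for i j
    using \<zeta>[of "monom 1 i - monom 1 j"] by (simp add: hom_distribs poly_monom)
  have "?z ^ M = 1" using M by (simp add: zp)
  then show *: "\<zeta> ^ M = 1" using eq[of M 0] by simp
  have inj: "inj_on (\<lambda>i. \<zeta> ^ i) {..<M}"
  proof (rule inj_onI)
    fix i j assume "i \<in> {..<M}" "j \<in> {..<M}" "\<zeta> ^ i = \<zeta> ^ j"
    then show "i = j"
      using bij_betw_roots_unity[OF M] eq[of i j] unfolding bij_betw_def zp inj_on_def by blast
  qed
  have red: "\<zeta> ^ i = \<zeta> ^ (i mod M)" for i
  proof -
    have "\<zeta> ^ i = \<zeta> ^ (M * (i div M) + i mod M)" by simp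
    also have "\<dots> = \<zeta> ^ (i mod M)" unfolding power_add power_mult * by simp
    finally show ?thesis .
  qed
  show "M dvd i" if "\<zeta> ^ i = 1" for i
  proof -
    have "\<zeta> ^ (i mod M) = \<zeta> ^ 0" using red[of i] that by simp
    then have "i mod M = 0" using inj_onD[OF inj, of "i mod M" 0] M by simp
    then show ?thesis by auto
  qed
  have "(\<lambda>i. \<zeta> ^ i) ` {..<M} = {x. x ^ M = 1}"
  proof (rule card_subset_eq)
    show "finite {x :: 'a. x ^ M = 1}" by (rule finite_nth_roots(1)[OF M])
    show "(\<lambda>i. \<zeta> ^ i) ` {..<M} \<subseteq> {x. x ^ M = 1}"
    proof safe
      fix i
      have "(\<zeta> ^ i) ^ M = (\<zeta> ^ M) ^ i" by (metis power_mult mult.commute)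
      then show "(\<zeta> ^ i) ^ M = 1" using * by simp
    qed
    from card_mono[OF finite_nth_roots(1)[OF M] this]
    show "card ((\<lambda>i. \<zeta> ^ i) ` {..<M}) = card {x :: 'a. x ^ M = 1}"
      using finite_nth_roots(2)[OF M, of "1 :: 'a"] by (simp add: card_image[OF inj])
  qed
  then show "\<exists>i. x = \<zeta> ^ i" if "x ^ M = 1" for x using that by blast
qed

text \<open>On the unit circle the inverse of \<open>w\<close> is \<open>cnj w\<close>, so the
  reversed factor \<open>1 - w Y\<close> is \<open>- w\<close> times the conjugate factor
  \<open>Y - cnj w\<close>; the constants multiply to \<open>u\<close>.\<close>

lemma reflect_unit_circle:
  assumes "\<And>w. w \<in># B \<Longrightarrow> cmod w = 1"
  shows "\<exists>u. u \<noteq> 0 \<and> (\<forall>j. coeff (reflect_poly (\<Prod>w\<in>#B. [:- w, 1:])) j = u * cnj (coeff (\<Prod>w\<in>#B. [:- w, 1:]) j))"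
  using assms
proof (induction B)
  case empty
  show ?case by (intro exI[of _ 1]) simp
next
  case (add w B)
  let ?P = "\<Prod>w\<in>#B. [:- w, 1:]"
  obtain u where u: "u \<noteq> 0" "\<And>j. coeff (reflect_poly ?P) j = u * cnj (coeff ?P j)"
    using add by auto
  have w: "w * cnj w = 1" "w \<noteq> 0" using add.prems[of w] complex_norm_square[of w] by auto
  have refl: "reflect_poly [:- w, 1:] = [:1, - w:]"
    using w by (intro poly_eqI) (auto simp: coeff_reflect_poly coeff_pCons split: nat.splits)
  have key: "u * c - w * u * d = - w * u * (- cnj w * c + d)" for c d
  proof -
    have "u * c - w * u * d = (w * cnj w) * (u * c) - w * u * d" by (simp only: w(1) mult_1_left)
    then show ?thesis by (simp add: algebra_simps)
  qed
  have "coeff (reflect_poly ([:- w, 1:] * ?P)) j = (- w * u) * cnj (coeff ([:- w, 1:] * ?P) j)" for j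
    unfolding reflect_poly_mult refl coeff_linear_mult u(2)
    using key[of "cnj (coeff ?P 0)" 0] key[of "cnj (coeff ?P j)" "cnj (coeff ?P (j - 1))"]
    by (cases j) (simp_all add: mult.assoc)
  moreover have "(\<Prod>w\<in>#add_mset w B. [:- w, 1:]) = [:- w, 1:] * ?P" by simp
  ultimately show ?case using u(1) w(2) by (intro exI[of _ "- w * u"]) (simp only: mult_eq_0_iff, simp)
qed

text \<open>The same integer polynomials \<open>c j\<close> serve both rings, which is what carries
  the vanishing of a coefficient from one to the other.\<close>

lemma coeffs_of_int_poly_products:
  fixes x :: "'a::comm_ring_1" and y :: "'b::comm_ring_1"
  shows "\<exists>c :: nat \<Rightarrow> int poly. \<forall>j.
    coeff (\<Prod>e\<in>#E. [:- (x ^ e), 1:]) j = poly (of_int_poly (c j)) x \<and>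
    coeff (\<Prod>e\<in>#E. [:- (y ^ e), 1:]) j = poly (of_int_poly (c j)) y"
proof (induction E)
  case empty
  show ?case by (intro exI[of _ "\<lambda>j. if j = 0 then 1 else 0"]) simp
next
  case (add e E)
  then obtain c :: "nat \<Rightarrow> int poly" where
    c: "\<And>j. coeff (\<Prod>e\<in>#E. [:- (x ^ e), 1:]) j = poly (of_int_poly (c j)) x"
    "\<And>j. coeff (\<Prod>e\<in>#E. [:- (y ^ e), 1:]) j = poly (of_int_poly (c j)) y" by blast
  show ?case
    by (intro exI[of _ "\<lambda>j. - monom 1 e * c j + (case j of 0 \<Rightarrow> 0 | Suc i \<Rightarrow> c i)"])
      (auto simp only: image_mset_add_mset prod_mset.add_mset coeff_linear_mult c,
        auto simp: hom_distribs poly_monom split: nat.splits)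
qed

text \<open>All elements of \<open>B\<close> are powers of one \<open>\<zeta>\<close>, with
  \<open>M\<close> a common order. Hence the product has the zero pattern of its complex counterpart
  \<open>Q\<close>, whose reversal is a multiple of its conjugate.\<close>

lemma symmetric_roots_of_unity:
  fixes B :: "'a::{alg_closed_field, field_char_0} multiset"
  assumes B: "\<And>x. x \<in># B \<Longrightarrow> \<exists>m>0. x ^ m = 1" and j: "j \<le> size B"
    and nz: "coeff (\<Prod>x\<in>#B. [:- x, 1:]) j \<noteq> 0"
  shows "coeff (\<Prod>x\<in>#B. [:- x, 1:]) (size B - j) \<noteq> 0"
proof -
  obtain f where f: "\<And>x. x \<in># B \<Longrightarrow> f x > 0 \<and> x ^ f x = 1" using B by metis
  define M where "M = (\<Prod>x\<in>set_mset B. f x)"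
  have M: "M > 0" using f by (simp add: M_def prod_pos)
  have BM: "x ^ M = 1" if "x \<in># B" for x
  proof -
    have "f x dvd M" unfolding M_def using that by (intro dvd_prodI) auto
    then obtain d where "M = f x * d" by (rule dvdE)
    then show ?thesis using f[OF that] by (simp add: power_mult)
  qed
  obtain \<zeta> :: 'a where \<zeta>: "\<And>P :: int poly. poly (of_int_poly P) \<zeta> = 0 \<longleftrightarrow>
    poly (of_int_poly P) (cis (2 * pi / real M)) = 0"
    using root_of_unity_transfer[OF M] by blast
  define z where "z = cis (2 * pi / real M)"
  have "\<exists>e. x = \<zeta> ^ e" if "x \<in># B" for x
    using primitive_root_of_unity(3)[OF M \<zeta>] BM[OF that] by blast
  then obtain e where e: "\<And>x. x \<in># B \<Longrightarrow> x = \<zeta> ^ e x" by metis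
  define E where "E = image_mset e B"
  have BE: "(\<Prod>x\<in>#B. [:- x, 1:]) = (\<Prod>k\<in>#E. [:- (\<zeta> ^ k), 1:])"
    unfolding E_def image_mset.compositionality
    by (intro arg_cong[of _ _ prod_mset] image_mset_cong) (simp add: e[symmetric])
  obtain c :: "nat \<Rightarrow> int poly" where
    c: "\<And>j. coeff (\<Prod>k\<in>#E. [:- (\<zeta> ^ k), 1:]) j = poly (of_int_poly (c j)) \<zeta>"
    "\<And>j. coeff (\<Prod>k\<in>#E. [:- (z ^ k), 1:]) j = poly (of_int_poly (c j)) z"
    using coeffs_of_int_poly_products by blast
  define Q where "Q = (\<Prod>w\<in>#image_mset (\<lambda>k. z ^ k) E. [:- w, 1:])"
  have Q: "Q = (\<Prod>k\<in>#E. [:- (z ^ k), 1:])"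
    by (simp add: Q_def image_mset.compositionality o_def)
  have iff: "coeff (\<Prod>x\<in>#B. [:- x, 1:]) i = 0 \<longleftrightarrow> coeff Q i = 0" for i
    unfolding BE Q c using \<zeta>[folded z_def] by blast
  have "Q \<noteq> 0" by (auto simp: Q_def prod_mset_zero_iff)
  have "proots Q = image_mset (\<lambda>k. z ^ k) E" unfolding Q_def by (rule proots_prod_linear)
  then have dQ: "degree Q = size B"
    using alg_closed_proots(2)[OF \<open>Q \<noteq> 0\<close>] by (simp add: E_def)
  have "cmod w = 1" if "w \<in># image_mset (\<lambda>k. z ^ k) E" for w
    using that by (auto simp: z_def norm_power)
  from reflect_unit_circle[OF this] obtain u where
    u: "u \<noteq> 0" "\<And>j. coeff (reflect_poly Q) j = u * cnj (coeff Q j)"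
    unfolding Q_def by blast
  have "coeff Q (size B - j) = coeff (reflect_poly Q) j"
    using j dQ by (simp add: coeff_reflect_poly)
  also have "\<dots> \<noteq> 0" using u nz iff by simp
  finally show ?thesis using iff by simp
qed

section \<open>Exponents modulo \<open>q\<close>\<close>

lemma coeff_mult_residue:
  fixes P R :: "'a::idom poly"
  assumes R: "\<And>i. coeff R i \<noteq> 0 \<Longrightarrow> q dvd i" and nz: "coeff (P * R) i \<noteq> 0"
  shows "\<exists>j. coeff P j \<noteq> 0 \<and> j mod q = i mod q"
proof -
  obtain j where "j \<le> i" "coeff P j * coeff R (i - j) \<noteq> 0"
    using nz unfolding coeff_mult by (meson atMost_iff sum.not_neutral_contains_not_neutral)
  moreover from this have "q dvd i - j" using R by auto
  ultimately show ?thesis using mod_eq_dvd_iff_nat[of j i q] by (intro exI[of _ j]) auto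
qed

text \<open>Multiplication by \<open>R\<close> preserves residue classes of exponents. So
  \<open>P' * R\<close> is the part of \<open>P * R\<close> in the class of \<open>j\<close>, and it
  is nonzero in a domain.\<close>

lemma coeff_mult_residue':
  fixes P R :: "'a::idom poly"
  assumes R: "\<And>i. coeff R i \<noteq> 0 \<Longrightarrow> q dvd i" and "R \<noteq> 0" and nz: "coeff P j \<noteq> 0"
  shows "\<exists>i. coeff (P * R) i \<noteq> 0 \<and> i mod q = j mod q"
proof -
  define P' where "P' = (\<Sum>l\<in>{l. l \<le> degree P \<and> l mod q = j mod q}. monom (coeff P l) l)"
  have P': "coeff P' l = (if l mod q = j mod q then coeff P l else 0)" for l
    by (auto simp: P'_def coeff_sum coeff_eq_0 not_le)
  have "P' \<noteq> 0" using P'[of j] nz by auto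
  then have "P' * R \<noteq> 0" using \<open>R \<noteq> 0\<close> by simp
  then obtain i where i: "coeff (P' * R) i \<noteq> 0" by (metis leading_coeff_0_iff)
  then have ij: "i mod q = j mod q"
    using coeff_mult_residue[OF R i] P' by (metis (mono_tags))
  have "coeff (P * R) i = coeff (P' * R) i"
    unfolding coeff_mult
  proof (rule sum.cong)
    fix l assume l: "l \<in> {..i}"
    show "coeff P l * coeff R (i - l) = coeff P' l * coeff R (i - l)"
    proof (cases "coeff R (i - l) = 0")
      case False
      then have "q dvd i - l" by (rule R)
      then have "l mod q = i mod q" using l mod_eq_dvd_iff_nat[of l i q] by auto
      then show ?thesis using P' ij by simp
    qed simp
  qed simp
  then show ?thesis using i ij by (intro exI[of _ i]) simp
qed

text \<open>Invariance of the roots means \<open>G(\<omega> Y) = \<omega> ^ size B * G(Y)\<close>.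
  The nonzero constant coefficient forces \<open>\<omega> ^ size B = 1\<close>, and comparison at
  \<open>i\<close> then gives \<open>\<omega> ^ i = 1\<close>.\<close>

lemma rotation_invariant_exponents:
  fixes B :: "'a::{alg_closed_field, field_char_0} multiset"
  assumes "0 \<notin># B" and inv: "image_mset (\<lambda>x. \<omega> * x) B = B" and \<omega>: "\<And>i. \<omega> ^ i = 1 \<Longrightarrow> q dvd i"
    and nz: "coeff (\<Prod>x\<in>#B. [:- x, 1:]) i \<noteq> 0"
  shows "q dvd i"
proof -
  let ?G = "\<Prod>x\<in>#B. [:- x, 1:]"
  have ev: "poly ?G t = (\<Prod>x\<in>#B. t - x)" for t
    by (induction B) (auto simp: left_diff_distrib)
  have "poly ?G (\<omega> * t) = \<omega> ^ size B * poly ?G t" for t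
  proof -
    have "poly ?G (\<omega> * t) = (\<Prod>x\<in>#image_mset (\<lambda>x. \<omega> * x) B. \<omega> * t - x)"
      by (simp only: ev inv)
    also have "\<dots> = (\<Prod>x\<in>#B. \<omega> * (t - x))"
      by (simp add: image_mset.compositionality o_def right_diff_distrib)
    also have "\<dots> = \<omega> ^ size B * (\<Prod>x\<in>#B. t - x)"
      by (induction B) simp_all
    finally show ?thesis by (simp only: ev)
  qed
  then have "poly (pcompose ?G (monom \<omega> (Suc 0))) t = poly (smult (\<omega> ^ size B) ?G) t" for t
    by (simp add: poly_pcompose poly_monom)
  then have "poly (pcompose ?G (monom \<omega> (Suc 0))) = poly (smult (\<omega> ^ size B) ?G)"
    by (rule ext)
  then have "pcompose ?G (monom \<omega> (Suc 0)) = smult (\<omega> ^ size B) ?G"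
    by (rule poly_eq_poly_eq_iff[THEN iffD1])
  from arg_cong[OF this, of coeff] have co: "\<omega> ^ k * coeff ?G k = \<omega> ^ size B * coeff ?G k" for k
    by (simp only: fun_eq_iff coeff_pcompose_monom_linear coeff_smult)
  have "coeff ?G 0 \<noteq> 0"
    using \<open>0 \<notin># B\<close> ev[of 0] by (auto simp: poly_0_coeff_0[symmetric] prod_mset_zero_iff)
  then have "\<omega> ^ size B = 1" using co[of 0] by simp
  then have "\<omega> ^ i = 1" using co[of i] nz by simp
  then show ?thesis by (rule \<omega>)
qed

definition torsion :: "'a::field \<Rightarrow> bool" where
  "torsion x \<longleftrightarrow> (\<exists>m>0. x ^ m = 1)"

lemma torsion_power_iff: "n > 0 \<Longrightarrow> torsion (x ^ n) \<longleftrightarrow> torsion x"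
  unfolding torsion_def by (metis nat_0_less_mult_iff power_mult power_commutes power_one mult.commute)

lemma torsion_mult: "torsion x \<Longrightarrow> torsion y \<Longrightarrow> torsion (x * y)"
proof -
  assume "torsion x" "torsion y"
  then obtain m k where mk: "m > 0" "x ^ m = 1" "k > 0" "y ^ k = 1" by (auto simp: torsion_def)
  have "(x * y) ^ (m * k) = (x ^ m) ^ k * (y ^ k) ^ m"
    by (simp add: power_mult_distrib mult.commute flip: power_mult)
  then show "torsion (x * y)" using mk unfolding torsion_def by (intro exI[of _ "m * k"]) simp
qed

text \<open>The number \<open>N\<close> is uniform in \<open>n\<close>, \<open>q\<close> and
  \<open>g\<close>. Modulo \<open>q\<close> the exponents of \<open>g\<close> are those of its
  torsion part; the degree of that part is divisible by \<open>q\<close>, so reflection turns a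
  residue \<open>j\<close> into \<open>- j\<close>.\<close>

lemma exponents_of_divisors:
  fixes F :: "'a::{alg_closed_field, field_char_0} set"
  assumes F: "is_subfield F" "bounded_roots F" and f: "f \<noteq> 0" "\<And>x. poly f x = 0 \<Longrightarrow> x \<in> F"
  shows "\<exists>N>0. \<forall>n>0. \<forall>q. \<forall>g\<in>polys_over F. g dvd pcompose f (monom 1 n) \<longrightarrow> q * N dvd n \<longrightarrow>
    q dvd order 0 g \<longrightarrow> q dvd degree g \<longrightarrow>
    (\<forall>i. coeff g i \<noteq> 0 \<longrightarrow> (\<exists>j. coeff g j \<noteq> 0 \<and> q dvd i + j))"
proof -
  define A where "A = {x. poly f x = 0 \<and> x \<noteq> 0 \<and> \<not> torsion x}"
  have "finite A" unfolding A_def using poly_roots_finite[OF f(1)] by (rule rev_finite_subset) auto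
  then obtain N where N: "N > 0" "\<And>\<alpha>. \<alpha> \<in> A \<Longrightarrow> stable_level F \<alpha> N"
    using stable_level_uniform[OF F, of A] f(2) unfolding A_def torsion_def by blast
  have "\<exists>j. coeff g j \<noteq> 0 \<and> q dvd i + j"
    if n: "n > 0" and gF: "g \<in> polys_over F" and gdvd: "g dvd pcompose f (monom 1 n)"
      and q: "q * N dvd n" "q dvd order 0 g" "q dvd degree g" and nz: "coeff g i \<noteq> 0"
    for n q g i
  proof -
    have q0: "q > 0" using q(1) n by (auto intro: Nat.gr0I)
    have g0: "g \<noteq> 0" using nz by auto
    define G where "G = proots g"
    define Bc where "Bc = filter_mset torsion G"
    define Bo where "Bo = filter_mset (\<lambda>x. x \<noteq> 0 \<and> \<not> torsion x) G"
    have t0: "\<not> torsion (0 :: 'a)" by (auto simp: torsion_def power_0_left)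
    have G: "G = replicate_mset (order 0 g) 0 + (Bc + Bo)"
      by (rule multiset_eqI) (auto simp: G_def Bc_def Bo_def g0 t0)
    have rt: "poly f (x ^ n) = 0" if "poly g x = 0" for x
    proof -
      obtain h where "pcompose f (monom 1 n) = g * h" using gdvd by (rule dvdE)
      from arg_cong[OF this, of "\<lambda>p. poly p x"] show ?thesis
        using that by (simp add: poly_pcompose poly_monom)
    qed
    \<comment> \<open>The power \<open>x ^ n\<close> is a nontorsion root of \<open>f\<close>, hence
      has stable level \<open>N\<close>; and \<open>\<omega>\<close> is an
      \<open>(n div N)\<close>-th root of unity because \<open>q * N\<close> divides
      \<open>n\<close>.\<close>
    have ord: "order (\<omega> * x) g = order x g"
      if "\<omega> ^ q = 1" "x \<noteq> 0" "\<not> torsion x" "poly g x = 0" for \<omega> x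
    proof -
      have "x ^ n \<in> A" using that rt[of x] torsion_power_iff[OF n, of x] by (simp add: A_def)
      then have "stable_level F (x ^ n) N" by (rule N)
      moreover have "q dvd n div N" "N dvd n" using q(1) N(1) by (auto elim!: dvdE)
      moreover from this(1) have "\<omega> ^ (n div N) = 1" using that(1) by (auto elim!: dvdE simp: power_mult)
      ultimately have "vanishing F (\<omega> * x) = vanishing F x"
        using n unfolding stable_level_def by blast
      then show ?thesis using order_eq_if_vanishing_eq[OF F(1) _ gF g0] by blast
    qed
    obtain \<omega> :: 'a where \<omega>': "\<And>P :: int poly. poly (of_int_poly P) \<omega> = 0 \<longleftrightarrow>
      poly (of_int_poly P) (cis (2 * pi / real q)) = 0"
      using root_of_unity_transfer[OF q0] by blast
    have \<omega>: "\<omega> ^ q = 1" "\<And>i. \<omega> ^ i = 1 \<Longrightarrow> q dvd i"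
      using primitive_root_of_unity(1,2)[OF q0 \<omega>'] by blast+
    have \<omega>0: "\<omega> \<noteq> 0" using \<omega>(1) q0 by (auto simp: power_0_left)
    have cBo: "count Bo x = (if x \<noteq> 0 \<and> \<not> torsion x then order x g else 0)" for x
      by (simp add: Bo_def G_def g0)
    have le: "count Bo x \<le> count Bo (\<eta> * x)" if \<eta>: "\<eta> ^ q = 1" for \<eta> x
    proof (cases "x \<noteq> 0 \<and> \<not> torsion x \<and> poly g x = 0")
      case True
      have \<eta>0: "\<eta> \<noteq> 0" using \<eta> q0 by (auto simp: power_0_left)
      have "torsion (inverse \<eta>)" using \<eta> q0 by (auto simp: torsion_def power_inverse)
      moreover have "x = inverse \<eta> * (\<eta> * x)" using \<eta>0 by simp
      ultimately have "\<not> torsion (\<eta> * x)" using True torsion_mult by metis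
      then show ?thesis using True ord[OF \<eta>, of x] \<eta>0 by (simp add: cBo)
    next
      case False
      then have "count Bo x = 0" by (auto simp: cBo order_0I)
      then show ?thesis by simp
    qed
    have inv: "image_mset (\<lambda>x. \<omega> * x) Bo = Bo"
    proof (rule multiset_eqI)
      fix y
      have "(\<lambda>x. \<omega> * x) -` {y} = {y / \<omega>}" using \<omega>0 by (auto simp: field_simps)
      then have "count (image_mset (\<lambda>x. \<omega> * x) Bo) y = count Bo (y / \<omega>)"
        by (cases "y / \<omega> \<in># Bo") (simp_all add: count_image_mset not_in_iff)
      moreover have "count Bo (y / \<omega>) \<le> count Bo y" using le[OF \<omega>(1), of "y / \<omega>"] \<omega>0 by simp
      moreover have "count Bo y \<le> count Bo (y / \<omega>)"
        using le[of "inverse \<omega>" y] \<omega>(1) by (simp add: power_inverse field_simps)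
      ultimately show "count (image_mset (\<lambda>x. \<omega> * x) Bo) y = count Bo y" using \<omega>0 by simp
    qed
    let ?L = "\<lambda>B. \<Prod>x\<in>#B. [:- x, 1:] :: 'a poly"
    have Bo_exp: "q dvd i" if "coeff (?L Bo) i \<noteq> 0" for i
      using rotation_invariant_exponents[OF _ inv \<omega>(2) that] by (simp add: Bo_def)
    have L0: "?L B \<noteq> 0" for B by (auto simp: prod_mset_zero_iff)
    have degL: "degree (?L B) = size B" for B
      using alg_closed_proots(2)[OF L0[of B]] by (simp only: proots_prod_linear)
    have "coeff (?L Bo) (size Bo) \<noteq> 0" using L0[of Bo] degL[of Bo] by (metis leading_coeff_0_iff)
    then have qBo: "q dvd size Bo" by (rule Bo_exp)
    have "degree g = size G" using alg_closed_proots(2)[OF g0] by (simp add: G_def)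
    also have "\<dots> = order 0 g + (size Bc + size Bo)" by (subst G) simp
    \<comment> \<open>Order and degree of \<open>g\<close> are multiples of \<open>q\<close> by
      hypothesis, so the number of torsion roots is one as well.\<close>
    finally have qBc: "q dvd size Bc" using q(2,3) qBo by (metis dvd_add_right_iff dvd_add_left_iff)
    define R where "R = smult (lead_coeff g) (monom 1 (order 0 g) * ?L Bo)"
    have "?L (replicate_mset d 0) = monom 1 d" for d
      by (induction d) (auto simp: monom_Suc)
    then have "?L G = monom 1 (order 0 g) * (?L Bc * ?L Bo)"
      by (subst G) simp
    then have gR: "g = ?L Bc * R"
      using alg_closed_proots(1)[OF g0] by (simp add: G_def R_def mult_ac)
    have R0: "R \<noteq> 0" using g0 gR by auto
    have R: "q dvd i" if "coeff R i \<noteq> 0" for i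
    proof -
      have "order 0 g \<le> i" "coeff (?L Bo) (i - order 0 g) \<noteq> 0"
        using that by (auto simp: R_def coeff_monom_mult split: if_splits)
      then show ?thesis using Bo_exp[of "i - order 0 g"] q(2) by (metis dvd_add le_add_diff_inverse)
    qed
    obtain j where j: "coeff (?L Bc) j \<noteq> 0" "j mod q = i mod q"
      using coeff_mult_residue[OF R, where P = "?L Bc" and i = i] nz gR by metis
    have jle: "j \<le> size Bc" using j(1) degL[of Bc] by (metis le_degree)
    have "coeff (?L Bc) (size Bc - j) \<noteq> 0"
      using j jle by (intro symmetric_roots_of_unity) (auto simp: Bc_def torsion_def)
    from coeff_mult_residue'[OF R R0 this] gR obtain i' where
      i': "coeff g i' \<noteq> 0" "i' mod q = (size Bc - j) mod q" by metis
    have "(i + i') mod q = (j + (size Bc - j)) mod q"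
      using j(2) i'(2) by (metis mod_add_cong)
    also have "\<dots> = 0" using jle qBc by simp
    finally show ?thesis using i'(1) by auto
  qed
  then show ?thesis using N(1) by blast
qed

section \<open>Polynomials in a root of the indeterminate\<close>

text \<open>\<open>root_poly n p\<close> is \<open>p(X^(1/n))\<close>, an element of the monoid algebra of \<open>\<rat>\<close>.\<close>

definition root_poly :: "nat \<Rightarrow> 'k::comm_ring_1 poly \<Rightarrow> rat \<Rightarrow>\<^sub>0 'k" where
  "root_poly n p = (\<Sum>i\<le>degree p. Poly_Mapping.single (of_nat i / of_nat n) (coeff p i))"

definition level :: "nat \<Rightarrow> rat set" where
  "level n = range (\<lambda>i. of_nat i / of_nat n)"

lemma lookup_root_poly:
  assumes "n > 0"
  shows "Poly_Mapping.lookup (root_poly n p) (of_nat i / of_nat n) = coeff p i"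
proof -
  have "Poly_Mapping.lookup (root_poly n p) (of_nat i / of_nat n) = (\<Sum>j\<le>degree p. if j = i then coeff p i else 0)"
    unfolding root_poly_def lookup_sum
    using assms by (intro sum.cong) (auto simp: lookup_single when_def)
  then show ?thesis by (simp add: coeff_eq_0)
qed

lemma lookup_root_poly_outside:
  "s \<notin> level n \<Longrightarrow> Poly_Mapping.lookup (root_poly n p) s = 0"
  unfolding root_poly_def lookup_sum
  by (intro sum.neutral) (auto simp: lookup_single when_def level_def)

lemma in_keys_root_poly:
  assumes "n > 0"
  shows "of_nat i / of_nat n \<in> Poly_Mapping.keys (root_poly n p) \<longleftrightarrow> coeff p i \<noteq> 0"
  by (simp add: in_keys_iff lookup_root_poly[OF assms])

lemma keys_root_poly:
  assumes "n > 0"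
  shows "Poly_Mapping.keys (root_poly n p) = (\<lambda>i. of_nat i / of_nat n) ` {i. coeff p i \<noteq> 0}"
proof -
  have "s \<in> level n" if "s \<in> Poly_Mapping.keys (root_poly n p)" for s
    using that lookup_root_poly_outside[of s n p] by (auto simp: in_keys_iff)
  then show ?thesis using in_keys_root_poly[OF assms, of _ p] unfolding level_def by blast
qed

lemma root_poly_eqI:
  assumes "n > 0" "Poly_Mapping.keys P \<subseteq> level n"
    and "\<And>i. Poly_Mapping.lookup P (of_nat i / of_nat n) = coeff p i"
  shows "root_poly n p = P"
proof (rule poly_mapping_eqI)
  fix s
  show "Poly_Mapping.lookup (root_poly n p) s = Poly_Mapping.lookup P s"
  proof (cases "s \<in> level n")
    case True
    then show ?thesis using assms(3) lookup_root_poly[OF assms(1)] by (auto simp: level_def)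
  next
    case False
    then show ?thesis using assms(2) lookup_root_poly_outside[OF False, of p]
      by (metis in_keys_iff subsetD)
  qed
qed

lemma root_poly_inj:
  assumes "n > 0" "root_poly n p = root_poly n q"
  shows "p = q"
  using assms lookup_root_poly[OF assms(1)] by (metis poly_eqI)

lemma root_poly_surj:
  assumes n: "n > 0" and P: "Poly_Mapping.keys P \<subseteq> level n"
  shows "\<exists>p. root_poly n p = P"
proof -
  define f :: "nat \<Rightarrow> rat" where "f i = of_nat i / of_nat n" for i
  have "inj f" unfolding f_def by (rule injI) (use n in simp)
  then have "finite (f -` Poly_Mapping.keys P)" by (intro finite_vimageI finite_keys)
  then obtain m where m: "\<forall>i\<in>f -` Poly_Mapping.keys P. i \<le> m"
    unfolding finite_nat_set_iff_bounded_le by (rule exE)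
  define p where "p = (\<Sum>i\<le>m. monom (Poly_Mapping.lookup P (f i)) i)"
  have cp: "Poly_Mapping.lookup P (f i) = coeff p i" for i
  proof (cases "i \<le> m")
    case False
    then have "f i \<notin> Poly_Mapping.keys P" using m by (metis vimageI2)
    then have "Poly_Mapping.lookup P (f i) = 0" by (metis in_keys_iff)
    then show ?thesis using False by (simp add: p_def coeff_sum)
  qed (simp add: p_def coeff_sum)
  have "root_poly n p = P" using cp unfolding f_def by (rule root_poly_eqI[OF n P])
  then show ?thesis ..
qed

lemma root_poly_altdef:
  assumes "degree p \<le> d"
  shows "root_poly n p = (\<Sum>i\<le>d. Poly_Mapping.single (of_nat i / of_nat n) (coeff p i))"
  unfolding root_poly_def using assms
  by (intro sum.mono_neutral_left) (auto simp: coeff_eq_0)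

lemma root_poly_add: "root_poly n (p + q) = root_poly n p + root_poly n q"
proof -
  define d where "d = max (degree p) (degree q)"
  have "degree p \<le> d" "degree q \<le> d" "degree (p + q) \<le> d"
    by (auto simp: d_def degree_add_le_max)
  then show ?thesis by (simp add: root_poly_altdef[of _ d] single_add sum.distrib)
qed

lemma root_poly_smult: "root_poly n (smult a p) = Poly_Mapping.single 0 a * root_poly n p"
  unfolding root_poly_altdef[OF degree_smult_le]
  by (simp add: root_poly_def sum_distrib_left mult_single)

lemma root_poly_0 [simp]: "root_poly n 0 = 0"
  by (simp add: root_poly_def)

lemma root_poly_monom: "root_poly n (monom a i) = Poly_Mapping.single (of_nat i / of_nat n) a"
proof -
  have "root_poly n (monom a i) = (\<Sum>j\<le>i. if j = i then Poly_Mapping.single (of_nat i / of_nat n) a else 0)"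
    unfolding root_poly_altdef[OF degree_monom_le] by (intro sum.cong) auto
  then show ?thesis by simp
qed

lemma root_poly_pCons:
  "root_poly n (pCons a p) = Poly_Mapping.single 0 a + Poly_Mapping.single (1 / of_nat n) 1 * root_poly n p"
proof -
  have "root_poly n (pCons a p) = (\<Sum>i\<le>Suc (degree p). Poly_Mapping.single (of_nat i / of_nat n) (coeff (pCons a p) i))"
    by (rule root_poly_altdef) (rule degree_pCons_le)
  also have "\<dots> = Poly_Mapping.single 0 a +
      (\<Sum>i\<le>degree p. Poly_Mapping.single (of_nat (Suc i) / of_nat n) (coeff p i))"
    by (subst sum.atMost_Suc_shift) simp
  also have "(\<Sum>i\<le>degree p. Poly_Mapping.single (of_nat (Suc i) / of_nat n) (coeff p i)) =
      Poly_Mapping.single (1 / of_nat n) 1 * root_poly n p"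
    unfolding root_poly_def sum_distrib_left
    by (intro sum.cong) (auto simp: mult_single add_divide_distrib)
  finally show ?thesis .
qed

lemma root_poly_mult: "root_poly n (p * q) = root_poly n p * root_poly n q"
proof (induction p)
  case (pCons a p)
  have "root_poly n (pCons a p * q) = root_poly n (smult a q) + root_poly n (pCons 0 (p * q))"
    by (simp add: mult_pCons_left root_poly_add)
  then show ?case
    by (simp add: pCons root_poly_smult root_poly_pCons distrib_right mult.assoc)
qed simp

lemma root_poly_pcompose:
  assumes "m > 0"
  shows "root_poly (n * m) (pcompose p (monom 1 m)) = root_poly n p"
proof (induction p)
  case (pCons a p)
  have "root_poly (n * m) [:a:] = Poly_Mapping.single 0 a"
    using root_poly_monom[of "n * m" a 0] by (simp add: monom_0)
  moreover have "root_poly (n * m) (monom 1 m) = Poly_Mapping.single (1 / of_nat n) (1 :: 'a)"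
    using assms by (simp add: root_poly_monom)
  ultimately show ?case
    by (simp add: pcompose_pCons root_poly_add root_poly_mult root_poly_pCons pCons)
qed simp

lemma order_0_coeff:
  assumes "p \<noteq> (0 :: 'k::idom poly)"
  shows "coeff p (order 0 p) \<noteq> 0" and "i < order 0 p \<Longrightarrow> coeff p i = 0"
proof -
  define d where "d = order 0 p"
  obtain r where r: "p = [:- 0, 1:] ^ d * r" "\<not> [:- 0, 1:] dvd r"
    using order_decomp[OF assms] unfolding d_def by blast
  have "[:- 0, 1:] ^ d = (monom 1 d :: 'k poly)" by (simp add: monom_altdef)
  then have c: "coeff p i = (if i < d then 0 else coeff r (i - d))" for i
    unfolding r(1) by (simp add: coeff_monom_mult)
  have "coeff r 0 \<noteq> 0" using r(2) poly_eq_0_iff_dvd[of r 0] by (metis poly_0_coeff_0)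
  then show "coeff p (order 0 p) \<noteq> 0" and "i < order 0 p \<Longrightarrow> coeff p i = 0"
    using c unfolding d_def by simp_all
qed

lemma Max_keys_root_poly:
  assumes "n > 0" "p \<noteq> 0"
  shows "Max (Poly_Mapping.keys (root_poly n p)) = of_nat (degree p) / of_nat n"
proof (rule Max_eqI)
  show "finite (Poly_Mapping.keys (root_poly n p))" by simp
  show "of_nat (degree p) / of_nat n \<in> Poly_Mapping.keys (root_poly n p)"
    using assms by (simp add: in_keys_root_poly)
  fix s assume "s \<in> Poly_Mapping.keys (root_poly n p)"
  then obtain i where "s = of_nat i / of_nat n" "coeff p i \<noteq> 0"
    using keys_root_poly[OF assms(1)] by auto
  then show "s \<le> of_nat (degree p) / of_nat n"
    using le_degree[of p i] by (auto intro!: divide_right_mono)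
qed

lemma Min_keys_root_poly:
  fixes p :: "'k::idom poly"
  assumes "n > 0" "p \<noteq> 0"
  shows "Min (Poly_Mapping.keys (root_poly n p)) = of_nat (order 0 p) / of_nat n"
proof (rule Min_eqI)
  show "finite (Poly_Mapping.keys (root_poly n p))" by simp
  show "of_nat (order 0 p) / of_nat n \<in> Poly_Mapping.keys (root_poly n p)"
    using assms order_0_coeff(1)[OF assms(2)] by (simp add: in_keys_root_poly)
  fix s assume "s \<in> Poly_Mapping.keys (root_poly n p)"
  then obtain i where "s = of_nat i / of_nat n" "coeff p i \<noteq> 0"
    using keys_root_poly[OF assms(1)] by auto
  moreover from this have "order 0 p \<le> i" using order_0_coeff(2)[OF assms(2), of i] by (meson not_le)
  ultimately show "of_nat (order 0 p) / of_nat n \<le> s" by (auto intro!: divide_right_mono)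
qed

lemma level_mult: "m > 0 \<Longrightarrow> level n \<subseteq> level (n * m)"
proof
  fix s assume "m > 0" "s \<in> level n"
  then obtain i where "s = of_nat i / of_nat n" by (auto simp: level_def)
  then have "s = of_nat (i * m) / of_nat (n * m)" using \<open>m > 0\<close> by simp
  then show "s \<in> level (n * m)" unfolding level_def by blast
qed

lemma common_level:
  assumes "finite T" "\<And>s. s \<in> T \<Longrightarrow> s \<ge> 0"
  shows "\<exists>n>0. T \<subseteq> level n"
  using assms
proof (induction T rule: finite_induct)
  case (insert s T)
  then obtain n where n: "n > 0" "T \<subseteq> level n" by auto
  obtain a b where ab: "quotient_of s = (a, b)" by fastforce
  then have b: "b > 0" "s = of_int a / of_int b"
    using quotient_of_denom_pos quotient_of_div by auto
  then have "a \<ge> 0" using insert.prems[of s] by (simp add: zero_le_divide_iff)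
  then have "s = of_nat (nat a) / of_nat (nat b)" using b by simp
  then have "s \<in> level (nat b)" unfolding level_def by blast
  then have "s \<in> level (nat b * n)" using level_mult n(1) by blast
  moreover have "T \<subseteq> level (nat b * n)"
    using n(2) level_mult[of "nat b" n] b(1) by (auto simp: mult.commute)
  ultimately show ?case using n(1) b(1) by (intro exI[of _ "nat b * n"]) auto
qed auto

text \<open>At a common denominator, greatest and least exponent become degree and order at 0, which
  add up over a domain.\<close>

lemma keys_mult_extrema:
  fixes P Q :: "rat \<Rightarrow>\<^sub>0 'k::idom"
  assumes P: "P \<noteq> 0" "\<And>s. s \<in> Poly_Mapping.keys P \<Longrightarrow> s \<ge> 0"
    and Q: "Q \<noteq> 0" "\<And>s. s \<in> Poly_Mapping.keys Q \<Longrightarrow> s \<ge> 0"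
  shows "Max (Poly_Mapping.keys (P * Q)) = Max (Poly_Mapping.keys P) + Max (Poly_Mapping.keys Q)"
    and "Min (Poly_Mapping.keys (P * Q)) = Min (Poly_Mapping.keys P) + Min (Poly_Mapping.keys Q)"
proof -
  obtain n where n: "n > 0" "Poly_Mapping.keys P \<union> Poly_Mapping.keys Q \<subseteq> level n"
    using common_level[of "Poly_Mapping.keys P \<union> Poly_Mapping.keys Q"] P Q by auto
  obtain p q where pq: "P = root_poly n p" "Q = root_poly n q"
    using root_poly_surj[OF n(1), of P] root_poly_surj[OF n(1), of Q] n(2) by auto
  have 0: "p \<noteq> 0" "q \<noteq> 0" using pq P(1) Q(1) by auto
  then have pq0: "p * q \<noteq> 0" by simp
  note E = Max_keys_root_poly[OF n(1)] Min_keys_root_poly[OF n(1)]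
  show "Max (Poly_Mapping.keys (P * Q)) = Max (Poly_Mapping.keys P) + Max (Poly_Mapping.keys Q)"
    unfolding pq root_poly_mult[symmetric] E[OF pq0] E[OF 0(1)] E[OF 0(2)] degree_mult_eq[OF 0]
    by (simp add: add_divide_distrib)
  show "Min (Poly_Mapping.keys (P * Q)) = Min (Poly_Mapping.keys P) + Min (Poly_Mapping.keys Q)"
    unfolding pq root_poly_mult[symmetric] E[OF pq0] E[OF 0(1)] E[OF 0(2)] order_mult[OF pq0]
    by (simp add: add_divide_distrib)
qed

section \<open>Finite factorization monoids\<close>

lemma (in comm_monoid_cancel) assocs_eq_iff:
  assumes "x \<in> carrier G" "y \<in> carrier G"
  shows "assocs G x = assocs G y \<longleftrightarrow> x \<sim> y"
proof
  assume "assocs G x = assocs G y"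
  then have "x \<in> assocs G y" using assocs_self[OF assms(1)] by simp
  then show "x \<sim> y" by (auto simp: eq_closure_of_def elem_def)
next
  assume "x \<sim> y"
  then have "x \<in> assocs G y" using assms by (auto simp: eq_closure_of_def elem_def)
  then show "assocs G x = assocs G y" using assocs_repr_independence[OF _ assms(2)] by blast
qed

text \<open>The map \<open>f\<close> is an invariant with finitely many values that separates
  association classes.\<close>

lemma finite_assocs_image:
  assumes G: "comm_monoid_cancel G" and D: "D \<subseteq> carrier G" and fin: "finite (f ` D)"
    and assoc: "\<And>x y. x \<in> D \<Longrightarrow> y \<in> D \<Longrightarrow> f x = f y \<Longrightarrow> x \<sim>\<^bsub>G\<^esub> y"
  shows "finite (assocs G ` D)"
proof -
  interpret comm_monoid_cancel G by (rule G)
  have "assocs G x = assocs G (inv_into D f (f x))" if "x \<in> D" for x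
  proof -
    have "inv_into D f (f x) \<in> D" "f (inv_into D f (f x)) = f x"
      using that by (auto intro: inv_into_into f_inv_into_f)
    then show ?thesis using assoc[OF that] assocs_eq_iff that D by (metis subsetD)
  qed
  then have "assocs G ` D \<subseteq> (\<lambda>v. assocs G (inv_into D f v)) ` f ` D" by blast
  then show ?thesis using fin finite_surj by blast
qed

text \<open>Atomicity follows by induction on the number of divisor classes. For a product
  \<open>a\<close> of nonunits \<open>b\<close> and \<open>c\<close>, the factor \<open>b\<close>
  has fewer, since \<open>a\<close> does not divide it.\<close>

lemma (in comm_monoid_cancel) ffm_if_finite_divisors:
  assumes fin: "\<And>a. a \<in> carrier G \<Longrightarrow> finite (assocs G ` {d \<in> carrier G. d divides a})"
  shows "ffm G"
proof -
  let ?D = "\<lambda>a. assocs G ` {d \<in> carrier G. d divides a}"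
  have "\<exists>fs. set fs \<subseteq> carrier G \<and> Divisibility.factors G fs a" if "a \<in> carrier G - Units G" for a
    using that
  proof (induction "card (?D a)" arbitrary: a rule: less_induct)
    case less
    then have a: "a \<in> carrier G" "a \<notin> Units G" by auto
    have smaller: "\<exists>fs. set fs \<subseteq> carrier G \<and> Divisibility.factors G fs b"
      if bc: "b \<in> carrier G" "c \<in> carrier G" "b \<notin> Units G" "c \<notin> Units G" "a = b \<otimes> c" for b c
    proof (rule less.hyps)
      have ba: "b divides a" using bc by (auto intro: dividesI)
      have "?D b \<subseteq> ?D a" using divides_trans[OF _ ba] by blast
      moreover have "assocs G a \<notin> ?D b"
      proof
        assume "assocs G a \<in> ?D b"
        then obtain d where d: "d \<in> carrier G" "d divides b" "assocs G a = assocs G d" by blast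
        then have "a \<sim> d" using assocs_eq_iff a(1) by blast
        then have "a divides d" by (rule associatedE)
        then have "a divides b" using d(2) a(1) by (rule divides_trans)
        then obtain e where e: "e \<in> carrier G" "b = a \<otimes> e" by (rule dividesE)
        then have "b \<otimes> \<one> = b \<otimes> (c \<otimes> e)" using bc by (simp add: m_assoc)
        then have "c \<otimes> e = \<one>" using bc e by (metis l_cancel m_closed one_closed)
        moreover from this have "e \<otimes> c = \<one>" using m_comm[OF bc(2) e(1)] by simp
        ultimately have "c \<in> Units G" using bc(2) e(1) unfolding Units_def by blast
        then show False using bc(4) by blast
      qed
      moreover have "assocs G a \<in> ?D a" using a by (auto simp: divides_refl)
      ultimately have "?D b \<subset> ?D a" by blast
      then show "card (?D b) < card (?D a)" using fin[OF a(1)] by (rule psubset_card_mono[rotated])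
      show "b \<in> carrier G - Units G" using bc by blast
    qed
    show ?case
    proof (cases "Divisibility.irreducible G a")
      case True
      then have "Divisibility.factors G [a] a" using a by (auto simp: factors_def)
      then show ?thesis using a by (intro exI[of _ "[a]"]) auto
    next
      case False
      then obtain b c where bc: "b \<in> carrier G" "c \<in> carrier G" "b \<notin> Units G" "c \<notin> Units G" "a = b \<otimes> c"
        using irreducible_iff_not_product[OF a(1)] a(2) by blast
      obtain fs where fs: "set fs \<subseteq> carrier G" "Divisibility.factors G fs b" using smaller[OF bc] by blast
      have "a = c \<otimes> b" using bc m_comm by blast
      then obtain gs where gs: "set gs \<subseteq> carrier G" "Divisibility.factors G gs c"
        using smaller[OF bc(2,1,4,3)] by blast
      have "Divisibility.factors G (fs @ gs) a" unfolding bc(5) by (rule factors_mult[OF fs(2) gs(2) fs(1) gs(1)])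
      then show ?thesis using fs gs by (intro exI[of _ "fs @ gs"]) auto
    qed
  qed
  moreover have "finite (assocs G ` {d \<in> carrier G. Divisibility.irreducible G d \<and> d divides a})"
    if "a \<in> carrier G" for a
    by (rule finite_subset[OF _ fin[OF that]]) auto
  ultimately show ?thesis
    unfolding ffm_def atomic_monoid_def using comm_monoid_cancel_axioms by blast
qed

context
  fixes S :: "rat set"
  assumes S: "puiseux_monoid S"
begin

lemma puiseuxD: "0 \<in> S" "s \<in> S \<Longrightarrow> 0 \<le> s" "s \<in> S \<Longrightarrow> t \<in> S \<Longrightarrow> s + t \<in> S"
  using S by (auto simp: puiseux_monoid_def)

lemma comm_monoid_cancel_additive_monoid: "comm_monoid_cancel (additive_monoid S)"
  by (intro comm_monoid_cancelI comm_monoidI) (auto simp: additive_monoid_def puiseuxD)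

lemma Units_additive_monoid: "Units (additive_monoid S) = {0}"
proof -
  have *: "x = 0" if "x \<in> S" "y \<in> S" "y + x = 0" for x y
    using that puiseuxD(2)[of x] puiseuxD(2)[of y] by linarith
  have "Units (additive_monoid S) = {x \<in> S. \<exists>y\<in>S. y + x = 0 \<and> x + y = 0}"
    by (simp add: Units_def additive_monoid_def)
  also have "\<dots> = {0}" using * puiseuxD(1) add_0_left[of "0 :: rat"] by blast
  finally show ?thesis .
qed

lemma divides_additive_monoid: "s divides\<^bsub>additive_monoid S\<^esub> t \<longleftrightarrow> t - s \<in> S"
proof
  assume "t - s \<in> S"
  then show "s divides\<^bsub>additive_monoid S\<^esub> t"
    unfolding factor_def additive_monoid_def by (intro bexI[of _ "t - s"]) auto
qed (auto simp: factor_def additive_monoid_def)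

lemma associated_additive_monoid: "s \<sim>\<^bsub>additive_monoid S\<^esub> t \<longleftrightarrow> s = t"
proof
  assume "s \<sim>\<^bsub>additive_monoid S\<^esub> t"
  then have "t - s \<in> S" "s - t \<in> S" by (auto simp: associated_def divides_additive_monoid)
  then show "s = t" using puiseuxD(2)[of "t - s"] puiseuxD(2)[of "s - t"] by simp
qed (use puiseuxD in \<open>auto simp: associated_def divides_additive_monoid\<close>)

lemma finite_assocs_additive_monoid:
  assumes D: "D \<subseteq> S"
  shows "finite (assocs (additive_monoid S) ` D) \<longleftrightarrow> finite D"
proof -
  interpret comm_monoid_cancel "additive_monoid S" by (rule comm_monoid_cancel_additive_monoid)
  have "inj_on (assocs (additive_monoid S)) D"
    using assocs_eq_iff associated_additive_monoid D
    by (intro inj_onI) (auto simp: additive_monoid_def subset_iff)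
  then show ?thesis by (simp add: finite_image_iff)
qed

text \<open>A divisor of \<open>t\<close> is a sum of atoms that divide \<open>t\<close>. There are
  finitely many such atoms, all at least \<open>m > 0\<close>, so at most \<open>t / m\<close>
  summands occur.\<close>

lemma finite_divisors_if_ffm:
  assumes "ffm (additive_monoid S)" and t: "t \<in> S"
  shows "finite {s \<in> S. t - s \<in> S}"
proof (cases "t = 0")
  case True
  have "s = 0" if "s \<in> S" "t - s \<in> S" for s
    using puiseuxD(2)[OF that(1)] puiseuxD(2)[OF that(2)] True by simp
  then have "{s \<in> S. t - s \<in> S} \<subseteq> {0}" by blast
  then show ?thesis by (rule finite_subset) simp
next
  case False
  let ?G = "additive_monoid S"
  interpret comm_monoid_cancel ?G by (rule comm_monoid_cancel_additive_monoid)
  have carr: "carrier ?G = S" by (simp add: additive_monoid_def)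
  define At where "At = {a \<in> S. Divisibility.irreducible ?G a \<and> t - a \<in> S}"
  have "finite (assocs ?G ` At)"
    using assms(1) t False unfolding ffm_def At_def carr divides_additive_monoid Units_additive_monoid
    by blast
  then have At: "finite At" using finite_assocs_additive_monoid[of At] by (auto simp: At_def)
  have At0: "a > 0" if "a \<in> At" for a
    using that puiseuxD(2)[of a] by (auto simp: At_def Divisibility.irreducible_def Units_additive_monoid less_le)
  \<comment> \<open>The element 1 makes the set nonempty without a proof that \<open>At\<close>
    is.\<close>
  define m where "m = Min (insert 1 At)"
  have m: "m > 0" "\<And>a. a \<in> At \<Longrightarrow> m \<le> a" using At At0 by (auto simp: m_def)
  have "\<exists>xs. set xs \<subseteq> At \<and> length xs \<le> nat \<lceil>t / m\<rceil> \<and> s = sum_list xs" if s: "s \<in> S" "t - s \<in> S" for s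
  proof (cases "s = 0")
    case False
    then obtain fs where fs: "set fs \<subseteq> S" "Divisibility.factors ?G fs s"
      using assms(1) s(1) unfolding ffm_def atomic_monoid_def carr Units_additive_monoid by blast
    have sl: "s = sum_list fs" using fs(2) by (simp add: factors_def additive_monoid_def sum_list.eq_foldr)
    have "a \<in> At" if "a \<in> set fs" for a
    proof -
      have "a divides\<^bsub>?G\<^esub> s" using factors_dividesI[OF fs(2) that] fs(1) carr by simp
      then have "s - a \<in> S" by (simp add: divides_additive_monoid)
      then have "(t - s) + (s - a) \<in> S" using s(2) puiseuxD(3) by blast
      then show ?thesis using that fs by (auto simp: At_def factors_def)
    qed
    then have sub: "set fs \<subseteq> At" by blast
    have "of_nat (length xs) * m \<le> sum_list xs" if "set xs \<subseteq> At" for xs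
      using that by (induction xs) (auto simp: distrib_right intro!: add_mono m(2))
    from this[OF sub] have "of_nat (length fs) * m \<le> s" using sl by simp
    also have "s \<le> t" using puiseuxD(2)[OF s(2)] by simp
    finally have "of_nat (length fs) \<le> t / m" using m(1) by (simp add: field_simps)
    then have "length fs \<le> nat \<lceil>t / m\<rceil>" by linarith
    then show ?thesis using sub sl by blast
  qed (auto intro: exI[of _ "[]"])
  then have "{s \<in> S. t - s \<in> S} \<subseteq> sum_list ` {xs. set xs \<subseteq> At \<and> length xs \<le> nat \<lceil>t / m\<rceil>}"
    by blast
  then show ?thesis
    by (rule finite_subset) (intro finite_imageI finite_lists_length_le At)
qed

end

section \<open>Divisors in the monoid algebra\<close>

abbreviation nonzero_algebra :: "rat set \<Rightarrow> (rat \<Rightarrow>\<^sub>0 'k::comm_ring_1) monoid" where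
  "nonzero_algebra S \<equiv> Ring_Divisibility.mult_of (monoid_algebra S)"

lemma monoid_algebra_simps [simp]:
  "carrier (monoid_algebra S) = {p. Poly_Mapping.keys p \<subseteq> S}"
  "mult (monoid_algebra S) = (*)" "one (monoid_algebra S) = 1" "zero (monoid_algebra S) = 0"
  by (simp_all add: monoid_algebra_def)

lemma nonzero_algebra_simps [simp]:
  "carrier (nonzero_algebra S) = {p. Poly_Mapping.keys p \<subseteq> S \<and> p \<noteq> 0}"
  "mult (nonzero_algebra S) = (*)" "one (nonzero_algebra S) = 1"
  by auto

lemma divides_nonzero_algebra:
  "P divides\<^bsub>nonzero_algebra S\<^esub> Q \<longleftrightarrow> (\<exists>R. Poly_Mapping.keys R \<subseteq> S \<and> R \<noteq> 0 \<and> Q = P * R)"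
  unfolding factor_def nonzero_algebra_simps by blast

lemma keys_singletonD:
  assumes "Poly_Mapping.keys P = {s}"
  shows "P = Poly_Mapping.single s (Poly_Mapping.lookup P s)"
proof (rule poly_mapping_eqI)
  fix u
  show "Poly_Mapping.lookup P u = Poly_Mapping.lookup (Poly_Mapping.single s (Poly_Mapping.lookup P s)) u"
  proof (cases "u = s")
    case False
    then have "u \<notin> Poly_Mapping.keys P" using assms by simp
    then have "Poly_Mapping.lookup P u = 0" by (metis in_keys_iff)
    then show ?thesis using False by (simp add: lookup_single when_def)
  qed (simp add: lookup_single)
qed

text \<open>Least and greatest exponent are additive and coincide for the product, so they coincide
  for each factor.\<close>

lemma monomial_factors:
  fixes P Q :: "rat \<Rightarrow>\<^sub>0 'k::idom"
  assumes PQ: "P * Q = Poly_Mapping.single t c" "c \<noteq> 0"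
    and P: "\<And>s. s \<in> Poly_Mapping.keys P \<Longrightarrow> s \<ge> 0" and Q: "\<And>s. s \<in> Poly_Mapping.keys Q \<Longrightarrow> s \<ge> 0"
  obtains s a b where "P = Poly_Mapping.single s a" "Q = Poly_Mapping.single (t - s) b" "a \<noteq> 0" "b \<noteq> 0"
proof -
  have "Poly_Mapping.single t c \<noteq> 0" using PQ(2) by (metis lookup_single_eq lookup_zero)
  then have 0: "P \<noteq> 0" "Q \<noteq> 0" using PQ(1) by auto
  define p1 p2 q1 q2 where pq: "p1 = Min (Poly_Mapping.keys P)" "p2 = Max (Poly_Mapping.keys P)"
    "q1 = Min (Poly_Mapping.keys Q)" "q2 = Max (Poly_Mapping.keys Q)"
  have ne: "Poly_Mapping.keys P \<noteq> {}" "Poly_Mapping.keys Q \<noteq> {}" using 0 by auto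
  have "Poly_Mapping.keys (P * Q) = {t}" using PQ by simp
  then have "p2 + q2 = t" "p1 + q1 = t"
    using keys_mult_extrema[OF 0(1) P 0(2) Q] by (simp_all add: pq)
  moreover have bounds: "p1 \<le> s \<and> s \<le> p2" if "s \<in> Poly_Mapping.keys P" for s
    using that by (simp add: pq)
  moreover have bounds': "q1 \<le> s \<and> s \<le> q2" if "s \<in> Poly_Mapping.keys Q" for s
    using that by (simp add: pq)
  moreover have "p1 \<le> p2" "q1 \<le> q2" using ne bounds bounds' by (meson equals0I order_trans)+
  ultimately have "Poly_Mapping.keys P \<subseteq> {p1}" "Poly_Mapping.keys Q \<subseteq> {t - p1}" by fastforce+
  then have K: "Poly_Mapping.keys P = {p1}" "Poly_Mapping.keys Q = {t - p1}"
    using ne subset_singletonD by metis+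
  show thesis
  proof (rule that)
    show "P = Poly_Mapping.single p1 (Poly_Mapping.lookup P p1)"
      "Q = Poly_Mapping.single (t - p1) (Poly_Mapping.lookup Q (t - p1))"
      using K by (auto intro: keys_singletonD)
    show "Poly_Mapping.lookup P p1 \<noteq> 0" "Poly_Mapping.lookup Q (t - p1) \<noteq> 0"
      using K by (metis in_keys_iff insertI1)+
  qed
qed

lemma finite_submultisets: "finite {A. A \<subseteq># M}"
proof -
  have "{A. A \<subseteq># M} \<subseteq> mset ` {xs. set xs \<subseteq> set_mset M \<and> length xs \<le> size M}"
  proof
    fix A assume "A \<in> {A. A \<subseteq># M}"
    moreover obtain xs where "A = mset xs" by (metis ex_mset)
    ultimately show "A \<in> mset ` {xs. set xs \<subseteq> set_mset M \<and> length xs \<le> size M}"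
      using set_mset_mono[of A M] size_mset_mono[of A M] by auto
  qed
  then show ?thesis by (rule finite_subset) (intro finite_imageI finite_lists_length_le finite_set_mset)
qed

text \<open>With \<open>R\<close> the roots of \<open>\<psi>\<close>, the field \<open>L\<close>
  contains the coefficients of every divisor of \<open>f\<close> and the \<open>n\<close>-th powers
  of its roots, and it is still finitely generated.\<close>

lemma finitely_generated_alg_closure:
  assumes "finitely_generated_field TYPE('k::field_char_0)" and "finite (R :: 'k alg_closure set)"
  shows "\<exists>L. is_subfield L \<and> bounded_roots L \<and> range to_ac \<subseteq> L \<and> R \<subseteq> L"
proof -
  obtain A :: "'k set" where A: "finite A" "is_subfield hull (\<rat> \<union> A) = UNIV"
    using assms(1) by (auto simp: finitely_generated_field_def)
  define B where "B = to_ac ` A \<union> R"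
  define L where "L = is_subfield hull (\<rat> \<union> B)"
  have L: "is_subfield L" by (simp add: L_def is_subfield_hull)
  have BL: "B \<subseteq> L" using hull_subset[of "\<rat> \<union> B" is_subfield] by (auto simp: L_def)
  have "bounded_roots L" unfolding L_def
    by (rule bounded_roots_above_finitely_generated[OF bounded_roots_above_Rats])
      (use A assms(2) in \<open>simp add: B_def\<close>)
  moreover have "range to_ac \<subseteq> L"
  proof -
    have pre: "is_subfield {x :: 'k. to_ac x \<in> L}"
      using L by (auto simp: is_subfield_def)
    then have "is_subfield hull (\<rat> \<union> A) \<subseteq> {x. to_ac x \<in> L}"
      using subfield_Rats[OF pre] BL by (intro hull_minimal) (auto simp: B_def)
    then show ?thesis using A(2) by auto
  qed
  ultimately show ?thesis using L BL by (intro exI[of _ L]) (auto simp: B_def)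
qed

interpretation to_ac_hom: inj_idom_hom "to_ac :: 'k::field \<Rightarrow> 'k alg_closure"
  by unfold_locales auto

interpretation to_ac_poly_hom: map_poly_inj_idom_hom "to_ac :: 'k::field \<Rightarrow> 'k alg_closure" ..

lemma order_0_map_poly_to_ac:
  assumes "p \<noteq> (0 :: 'k::field poly)"
  shows "order 0 (map_poly to_ac p) = order 0 p"
proof -
  have "order 0 (map_poly to_ac p) \<le> order 0 p"
    using order_0_coeff(2)[of "map_poly to_ac p" "order 0 p"] order_0_coeff(1)[OF assms] assms
    by (metis coeff_map_poly to_ac_0 to_ac_eq_0_iff to_ac_poly_hom.hom_0_iff not_le)
  moreover have "order 0 p \<le> order 0 (map_poly to_ac p)"
    using order_0_coeff(1)[of "map_poly to_ac p"] order_0_coeff(2)[OF assms, of "order 0 (map_poly to_ac p)"] assms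
    by (metis coeff_map_poly to_ac_0 to_ac_poly_hom.hom_0_iff not_le)
  ultimately show ?thesis by simp
qed

context
  fixes S :: "rat set"
  assumes S: "puiseux_monoid S"
begin

lemma factor_supports_finite:
  fixes f :: "rat \<Rightarrow>\<^sub>0 'k::field_char_0"
  assumes K: "finitely_generated_field TYPE('k)"
    and fin: "\<And>t. t \<in> S \<Longrightarrow> finite {s \<in> S. t - s \<in> S}"
    and f: "f \<noteq> 0" "Poly_Mapping.keys f \<subseteq> S"
  shows "\<exists>T. finite T \<and> T \<subseteq> S \<and> (\<forall>G H. Poly_Mapping.keys G \<subseteq> S \<longrightarrow> Poly_Mapping.keys H \<subseteq> S \<longrightarrow>
    G * H = f \<longrightarrow> Poly_Mapping.keys G \<subseteq> T)"
proof -
  note nonneg = puiseuxD(2)[OF S]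
  obtain nf where nf: "nf > 0" "Poly_Mapping.keys f \<subseteq> level nf"
    using common_level[of "Poly_Mapping.keys f"] f(2) nonneg by auto
  obtain \<psi> where \<psi>: "root_poly nf \<psi> = f" using root_poly_surj[OF nf] by blast
  have \<psi>0: "\<psi> \<noteq> 0" using \<psi> f(1) by auto
  define \<psi>' where "\<psi>' = map_poly to_ac \<psi>"
  have \<psi>'0: "\<psi>' \<noteq> 0" using \<psi>0 by (simp add: \<psi>'_def)
  obtain L where L: "is_subfield L" "bounded_roots L" "range to_ac \<subseteq> L" "{x. poly \<psi>' x = 0} \<subseteq> L"
    using finitely_generated_alg_closure[OF K poly_roots_finite[OF \<psi>'0]] by blast
  obtain N1 where N1: "N1 > 0" "\<And>n q g i. n > 0 \<Longrightarrow> g \<in> polys_over L \<Longrightarrow> g dvd pcompose \<psi>' (monom 1 n) \<Longrightarrow>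
    q * N1 dvd n \<Longrightarrow> q dvd order 0 g \<Longrightarrow> q dvd degree g \<Longrightarrow> coeff g i \<noteq> 0 \<Longrightarrow> \<exists>j. coeff g j \<noteq> 0 \<and> q dvd i + j"
    using exponents_of_divisors[OF L(1,2) \<psi>'0] L(4) by (auto simp: subset_iff)
  define a b where ab: "a = Min (Poly_Mapping.keys f)" "b = Max (Poly_Mapping.keys f)"
  have "Poly_Mapping.keys f \<noteq> {}" using f(1) by simp
  then have abS: "a \<in> S" "b \<in> S"
    using f(2) Min_in[OF finite_keys, of f] Max_in[OF finite_keys, of f] by (auto simp: ab)
  \<comment> \<open>The least and the greatest exponent of any factor lie here, because extreme
    exponents add in a product.\<close>
  define E where "E = {s \<in> S. a - s \<in> S} \<union> {s \<in> S. b - s \<in> S}"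
  have "finite E" unfolding E_def using fin[OF abS(1)] fin[OF abS(2)] by blast
  then obtain N2 where N2: "N2 > 0" "E \<subseteq> level N2"
    using common_level[of E] nonneg by (auto simp: E_def)
  \<comment> \<open>All three factors depend on \<open>f\<close> only: \<open>nf\<close> on its
    exponents, \<open>N1\<close> on its nontorsion roots, \<open>N2\<close> on the extreme exponents
    of its factors.\<close>
  define k where "k = nf * N1 * N2"
  have k: "k > 0" using nf N1 N2 by (simp add: k_def)
  \<comment> \<open>The candidates for sums of partners; \<open>2 * b\<close> appears since every
    exponent of a factor is at most \<open>b\<close>.\<close>
  define U where "U = {u \<in> S. u \<in> level k \<and> u \<le> 2 * b}"
  define T where "T = (\<Union>u\<in>U. {s \<in> S. u - s \<in> S})"
  have "U \<subseteq> (\<lambda>i. of_nat i / of_nat k) ` {..nat \<lceil>2 * b * of_nat k\<rceil>}"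
  proof
    fix u assume "u \<in> U"
    then obtain i where i: "u = of_nat i / of_nat k" "u \<le> 2 * b" by (auto simp: U_def level_def)
    have "of_nat i = u * of_nat k" using i(1) k by simp
    also have "\<dots> \<le> 2 * b * of_nat k" using i(2) by (intro mult_right_mono) auto
    finally have "of_nat i \<le> 2 * b * of_nat k" .
    then have "i \<le> nat \<lceil>2 * b * of_nat k\<rceil>" by linarith
    then show "u \<in> (\<lambda>i. of_nat i / of_nat k) ` {..nat \<lceil>2 * b * of_nat k\<rceil>}" using i by blast
  qed
  then have "finite U" by (rule finite_subset) simp
  then have "finite T" unfolding T_def using fin by (intro finite_UN_I) (auto simp: U_def)
  moreover have "T \<subseteq> S" by (auto simp: T_def)
  moreover have "s \<in> T" if GH: "Poly_Mapping.keys G \<subseteq> S" "Poly_Mapping.keys H \<subseteq> S" "G * H = f"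
    and s: "s \<in> Poly_Mapping.keys G" for G H s
  proof -
    have GH0: "G \<noteq> 0" "H \<noteq> 0" using GH(3) f(1) by auto
    then have ne: "Poly_Mapping.keys G \<noteq> {}" "Poly_Mapping.keys H \<noteq> {}" by simp_all
    obtain m where m: "m > 0" "Poly_Mapping.keys G \<union> Poly_Mapping.keys H \<subseteq> level m"
      using common_level[of "Poly_Mapping.keys G \<union> Poly_Mapping.keys H"] GH(1,2) nonneg by auto
    \<comment> \<open>At level \<open>nf * n\<close> the polynomial of \<open>f\<close> is
      \<open>\<psi>(Y^n)\<close>. The factor \<open>N1\<close> gives \<open>m * N1 dvd n\<close>,
      and \<open>N2\<close> makes order and degree of \<open>g\<close> multiples of
      \<open>m\<close>, so that \<open>q = m\<close> is admissible.\<close>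
    define n where "n = m * N1 * N2"
    define l where "l = m * k"
    have n: "n > 0" using m N1 N2 by (simp add: n_def)
    have l: "l > 0" "l = nf * n" using m k by (simp_all add: l_def k_def n_def mult_ac)
    have "level m \<subseteq> level l" unfolding l_def by (rule level_mult[OF k])
    then obtain g h where gh: "root_poly l g = G" "root_poly l h = H"
      using root_poly_surj[OF l(1), of G] root_poly_surj[OF l(1), of H] m(2) by blast
    have g0: "g \<noteq> 0" using gh GH0 by auto
    have "root_poly l (g * h) = root_poly l (pcompose \<psi> (monom 1 n))"
      unfolding root_poly_mult gh GH(3) unfolding l(2) root_poly_pcompose[OF n] \<psi> ..
    then have "g * h = pcompose \<psi> (monom 1 n)" by (rule root_poly_inj[OF l(1)])
    from arg_cong[OF this, of "map_poly to_ac"]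
    have "map_poly to_ac g * map_poly to_ac h = pcompose \<psi>' (monom 1 n)"
      by (simp add: hom_distribs \<psi>'_def to_ac_hom.map_poly_pcompose)
    then have gdvd: "map_poly to_ac g dvd pcompose \<psi>' (monom 1 n)" by (metis dvd_triv_left)
    have gL: "map_poly to_ac g \<in> polys_over L"
      using L(3) by (auto intro!: polys_overI simp: coeff_map_poly)
    have mdiv: "m dvd d" if d: "of_nat d / of_nat l \<in> E" for d
    proof -
      obtain e where "of_nat d / of_nat l = (of_nat e / of_nat N2 :: rat)"
        using d N2(2) by (auto simp: level_def)
      then have "(of_nat (d * N2) :: rat) = of_nat (e * l)"
        using l(1) N2(1) by (simp add: field_simps)
      then have "d * N2 = e * l" by (simp only: of_nat_eq_iff)
      then have "d * N2 = (m * (e * nf * N1)) * N2" by (simp add: l_def k_def mult_ac)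
      then have "d = m * (e * nf * N1)" using N2(1) by simp
      then show ?thesis by simp
    qed
    have G_nonneg: "\<And>s. s \<in> Poly_Mapping.keys G \<Longrightarrow> s \<ge> 0" and
      H_nonneg: "\<And>s. s \<in> Poly_Mapping.keys H \<Longrightarrow> s \<ge> 0" using GH nonneg by auto
    note ext = keys_mult_extrema[OF GH0(1) G_nonneg GH0(2) H_nonneg, unfolded GH(3), folded ab]
    have mm: "Max (Poly_Mapping.keys G) \<in> S" "Min (Poly_Mapping.keys G) \<in> S"
      "Max (Poly_Mapping.keys H) \<in> S" "Min (Poly_Mapping.keys H) \<in> S"
      using GH ne Max_in[OF finite_keys] Min_in[OF finite_keys] by blast+
    have "Max (Poly_Mapping.keys G) \<in> E" "Min (Poly_Mapping.keys G) \<in> E"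
      using mm ext by (simp_all add: E_def)
    then have "m dvd degree g" "m dvd order 0 g"
      using mdiv Max_keys_root_poly[OF l(1) g0] Min_keys_root_poly[OF l(1) g0] gh(1) by auto
    then have mg: "m dvd degree (map_poly to_ac g)" "m dvd order 0 (map_poly to_ac g)"
      using g0 by (simp_all add: order_0_map_poly_to_ac)
    obtain i where i: "s = of_nat i / of_nat l" "coeff g i \<noteq> 0"
      using s unfolding gh(1)[symmetric] keys_root_poly[OF l(1)] by blast
    have "m * N1 dvd n" by (simp add: n_def)
    then obtain j where j: "coeff g j \<noteq> 0" "m dvd i + j"
      using N1(2)[OF n gL gdvd _ mg(2,1), of i] i(2) by (auto simp: coeff_map_poly)
    define s' where "s' = (of_nat j / of_nat l :: rat)"
    have s': "s' \<in> Poly_Mapping.keys G"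
      unfolding s'_def gh(1)[symmetric] in_keys_root_poly[OF l(1)] by (rule j(1))
    obtain v where "i + j = m * v" using j(2) by (rule dvdE)
    then have "s + s' = of_nat (m * v) / of_nat l"
      unfolding i(1) s'_def by (simp flip: add_divide_distrib of_nat_add)
    also have "\<dots> = of_nat v / of_nat k" using m(1) by (simp add: l_def)
    finally have "s + s' \<in> level k" by (auto simp: level_def)
    moreover have "s + s' \<in> S" using s s' GH(1) puiseuxD(3)[OF S] by blast
    moreover have "s + s' \<le> 2 * b"
    proof -
      have "s \<le> Max (Poly_Mapping.keys G)" "s' \<le> Max (Poly_Mapping.keys G)" using s s' by simp_all
      moreover have "Max (Poly_Mapping.keys G) \<le> b" using ext(1) nonneg[OF mm(3)] by simp
      ultimately show ?thesis by simp
    qed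
    ultimately have "s + s' \<in> U" by (simp add: U_def)
    moreover have "(s + s') - s \<in> S" using s' GH(1) by auto
    moreover have "s \<in> S" using s GH(1) by auto
    ultimately show "s \<in> T" unfolding T_def by blast
  qed
  ultimately show ?thesis by blast
qed

end

section \<open>Monomials and divisor classes in the monoid algebra\<close>

context
  fixes S :: "rat set"
  assumes S: "puiseux_monoid S"
begin

lemma comm_monoid_cancel_nonzero_algebra:
  "comm_monoid_cancel (nonzero_algebra S :: (rat \<Rightarrow>\<^sub>0 'k::field_char_0) monoid)"
proof -
  interpret domain "monoid_algebra S :: (rat \<Rightarrow>\<^sub>0 'k) ring" by (rule domain_monoid_algebra[OF S])
  show ?thesis by (rule mult_of.comm_monoid_cancel_axioms)
qed

lemma single_in_carrier:
  "Poly_Mapping.single s c \<in> carrier (nonzero_algebra S) \<longleftrightarrow> s \<in> S \<and> c \<noteq> 0"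
proof (cases "c = 0")
  case False
  then have "Poly_Mapping.single s c \<noteq> 0" by (metis lookup_single_eq lookup_zero)
  then show ?thesis using False by simp
qed simp

lemma monomial_factors_in_carrier:
  fixes P Q :: "rat \<Rightarrow>\<^sub>0 'k::field_char_0"
  assumes P: "P \<in> carrier (nonzero_algebra S)" and Q: "Q \<in> carrier (nonzero_algebra S)"
    and PQ: "P * Q = Poly_Mapping.single t c" and c: "c \<noteq> 0"
  obtains s a b where "P = Poly_Mapping.single s a" "Q = Poly_Mapping.single (t - s) b"
    "a \<noteq> 0" "b \<noteq> 0" "s \<in> S" "t - s \<in> S"
proof -
  have PQS: "\<And>s. s \<in> Poly_Mapping.keys P \<Longrightarrow> s \<ge> 0" "\<And>s. s \<in> Poly_Mapping.keys Q \<Longrightarrow> s \<ge> 0"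
    using P Q puiseuxD(2)[OF S] by auto
  obtain s a b where sab: "P = Poly_Mapping.single s a" "Q = Poly_Mapping.single (t - s) b" "a \<noteq> 0" "b \<noteq> 0"
    using monomial_factors[OF PQ c PQS] by blast
  then show thesis using P Q that unfolding sab single_in_carrier by blast
qed

lemma Units_nonzero_algebra:
  "Units (nonzero_algebra S :: (rat \<Rightarrow>\<^sub>0 'k::field_char_0) monoid) = {Poly_Mapping.single 0 c | c. c \<noteq> 0}"
proof (intro equalityI subsetI)
  fix P :: "rat \<Rightarrow>\<^sub>0 'k" assume "P \<in> Units (nonzero_algebra S)"
  then obtain Q where PQ: "P \<in> carrier (nonzero_algebra S)" "Q \<in> carrier (nonzero_algebra S)"
    "P * Q = Poly_Mapping.single 0 1"
    unfolding Units_def nonzero_algebra_simps(2,3) by auto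
  obtain s a where s: "P = Poly_Mapping.single s a" "a \<noteq> 0" "s \<in> S" "0 - s \<in> S"
    using monomial_factors_in_carrier[OF PQ one_neq_zero] by metis
  then have "s = 0" using puiseuxD(2)[OF S, of s] puiseuxD(2)[OF S, of "0 - s"] by simp
  then show "P \<in> {Poly_Mapping.single 0 c | c. c \<noteq> 0}" using s by blast
next
  fix P :: "rat \<Rightarrow>\<^sub>0 'k" assume "P \<in> {Poly_Mapping.single 0 c | c. c \<noteq> 0}"
  then obtain c where c: "P = Poly_Mapping.single 0 c" "c \<noteq> 0" by blast
  have "P \<in> carrier (nonzero_algebra S)" "Poly_Mapping.single 0 (inverse c) \<in> carrier (nonzero_algebra S)"
    unfolding c(1) single_in_carrier using c(2) puiseuxD(1)[OF S] by auto
  moreover have "P * Poly_Mapping.single 0 (inverse c) = 1" "Poly_Mapping.single 0 (inverse c) * P = 1"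
    using c by (auto simp: mult_single)
  ultimately show "P \<in> Units (nonzero_algebra S)"
    unfolding Units_def nonzero_algebra_simps(2,3) by blast
qed

lemma single_in_Units_iff:
  "c \<noteq> 0 \<Longrightarrow> Poly_Mapping.single s (c :: 'k::field_char_0) \<in> Units (nonzero_algebra S) \<longleftrightarrow> s = 0"
  unfolding Units_nonzero_algebra by (auto, metis keys_single singleton_inject)

lemma single_nonunit:
  "s \<in> S \<Longrightarrow> s \<noteq> 0 \<Longrightarrow> (c :: 'k::field_char_0) \<noteq> 0 \<Longrightarrow>
    Poly_Mapping.single s c \<in> carrier (nonzero_algebra S) - Units (nonzero_algebra S)"
  using single_in_carrier single_in_Units_iff by blast

lemma irreducible_single_iff:
  assumes s: "s \<in> S" and c: "(c :: 'k::field_char_0) \<noteq> 0"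
  shows "Divisibility.irreducible (nonzero_algebra S) (Poly_Mapping.single s c) \<longleftrightarrow>
    Divisibility.irreducible (additive_monoid S) s"
proof -
  interpret M: comm_monoid_cancel "nonzero_algebra S :: (rat \<Rightarrow>\<^sub>0 'k) monoid"
    by (rule comm_monoid_cancel_nonzero_algebra)
  interpret A: comm_monoid_cancel "additive_monoid S" by (rule comm_monoid_cancel_additive_monoid[OF S])
  have carr: "carrier (additive_monoid S) = S" "mult (additive_monoid S) = (+)"
    by (simp_all add: additive_monoid_def)
  have "Poly_Mapping.single s c \<in> carrier (nonzero_algebra S)" using s c single_in_carrier by blast
  note M_iff = M.irreducible_iff_not_product[OF this]
  note A_iff = A.irreducible_iff_not_product[of s, unfolded carr, OF s]
  have "(\<exists>P \<in> carrier (nonzero_algebra S) - Units (nonzero_algebra S).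
      \<exists>Q \<in> carrier (nonzero_algebra S) - Units (nonzero_algebra S). Poly_Mapping.single s c = P * Q) \<longleftrightarrow>
    (\<exists>x \<in> S - Units (additive_monoid S). \<exists>y \<in> S - Units (additive_monoid S). s = x + y)"
    (is "?L \<longleftrightarrow> ?R")
  proof
    assume ?L
    then obtain P Q :: "rat \<Rightarrow>\<^sub>0 'k" where PQ: "P \<in> carrier (nonzero_algebra S)" "Q \<in> carrier (nonzero_algebra S)"
      "P * Q = Poly_Mapping.single s c" "P \<notin> Units (nonzero_algebra S)" "Q \<notin> Units (nonzero_algebra S)"
      by (metis DiffE)
    obtain x a b where x: "P = Poly_Mapping.single x a" "Q = Poly_Mapping.single (s - x) b"
      "a \<noteq> 0" "b \<noteq> 0" "x \<in> S" "s - x \<in> S"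
      using monomial_factors_in_carrier[OF PQ(1-3) c] .
    then have "x \<noteq> 0" "s - x \<noteq> 0" using PQ(4,5) single_in_Units_iff by blast+
    then show ?R using x(5,6) unfolding Units_additive_monoid[OF S]
      by (intro bexI[of _ x] bexI[of _ "s - x"]) auto
  next
    assume ?R
    then obtain x y where xy: "x \<in> S" "y \<in> S" "x \<noteq> 0" "y \<noteq> 0" "s = x + y"
      unfolding Units_additive_monoid[OF S] by blast
    have "Poly_Mapping.single x c \<in> carrier (nonzero_algebra S) - Units (nonzero_algebra S)"
      "Poly_Mapping.single y (1 :: 'k) \<in> carrier (nonzero_algebra S) - Units (nonzero_algebra S)"
      using xy c single_nonunit one_neq_zero by blast+
    moreover have "Poly_Mapping.single s c = Poly_Mapping.single x c * Poly_Mapping.single y 1"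
      by (simp add: mult_single xy(5))
    ultimately show ?L by blast
  qed
  then show ?thesis
    unfolding M_iff A_iff nonzero_algebra_simps(2) single_in_Units_iff[OF c] Units_additive_monoid[OF S]
    by simp
qed

lemma divides_single:
  assumes "c \<noteq> (0 :: 'k::field_char_0)" "b \<noteq> 0"
  shows "Poly_Mapping.single s b divides\<^bsub>nonzero_algebra S\<^esub> Poly_Mapping.single t c \<longleftrightarrow> t - s \<in> S"
proof
  assume "Poly_Mapping.single s b divides\<^bsub>nonzero_algebra S\<^esub> Poly_Mapping.single t c"
  then obtain R where R: "Poly_Mapping.keys R \<subseteq> S" "R \<noteq> 0" "Poly_Mapping.single t c = Poly_Mapping.single s b * R"
    by (auto simp only: divides_nonzero_algebra)
  \<comment> \<open>All rational exponents are available in the ambient type, so the monomial can be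
    inverted there even though \<open>- s\<close> need not lie in \<open>S\<close>.\<close>
  have "Poly_Mapping.single (- s) (inverse b) * Poly_Mapping.single t c =
      (Poly_Mapping.single (- s) (inverse b) * Poly_Mapping.single s b) * R"
    unfolding R(3) by (simp only: mult.assoc)
  then have "R = Poly_Mapping.single (t - s) (inverse b * c)" using assms(2) by (simp add: mult_single)
  then show "t - s \<in> S" using R(1) assms by simp
next
  assume "t - s \<in> S"
  then show "Poly_Mapping.single s b divides\<^bsub>nonzero_algebra S\<^esub> Poly_Mapping.single t c"
    unfolding divides_nonzero_algebra using assms single_in_carrier[of "t - s" "c / b"]
    by (intro exI[of _ "Poly_Mapping.single (t - s) (c / b)"]) (simp add: mult_single)
qed

text \<open>The monomials are closed under divisors, and with coefficient 1 they are associate only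
  if equal. So factorizations and divisor counts descend to the exponents.\<close>

lemma ffm_if_ffm_nonzero_algebra:
  assumes ffm: "ffm (nonzero_algebra S :: (rat \<Rightarrow>\<^sub>0 'k::field_char_0) monoid)"
  shows "ffm (additive_monoid S)"
proof -
  let ?M = "nonzero_algebra S :: (rat \<Rightarrow>\<^sub>0 'k) monoid"
  let ?A = "additive_monoid S"
  let ?m = "\<lambda>s. Poly_Mapping.single s (1 :: 'k)"
  interpret M: comm_monoid_cancel ?M by (rule comm_monoid_cancel_nonzero_algebra)
  interpret A: comm_monoid_cancel ?A by (rule comm_monoid_cancel_additive_monoid[OF S])
  have carr: "carrier ?A = S" "mult ?A = (+)" "one ?A = 0" by (simp_all add: additive_monoid_def)
  have lift: "\<exists>xs. set xs \<subseteq> S \<and> Divisibility.factors ?A xs t"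
    if "set fs \<subseteq> carrier ?M" "Divisibility.factors ?M fs (Poly_Mapping.single t c)" "c \<noteq> 0"
    for fs t c
    using that
  proof (induction fs arbitrary: t c)
    case Nil
    then have "1 = Poly_Mapping.single t c" by (simp add: Divisibility.factors_def)
    from arg_cong[OF this, of Poly_Mapping.keys] have "t = 0" using Nil.prems(3) by simp
    then show ?case by (intro exI[of _ "[]"]) (simp add: Divisibility.factors_def carr)
  next
    case (Cons f fs)
    \<comment> \<open>The remaining product is again a monomial, with an unspecified coefficient;
      hence the induction over arbitrary \<open>t\<close> and \<open>c\<close>.\<close>
    define r where "r = foldr (mult ?M) fs (one ?M)"
    have fr: "f * r = Poly_Mapping.single t c" "Divisibility.irreducible ?M f" "Divisibility.factors ?M fs r"
      using Cons.prems(2) by (auto simp: Divisibility.factors_def r_def)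
    have f: "f \<in> carrier ?M" and fs: "set fs \<subseteq> carrier ?M" using Cons.prems(1) by simp_all
    have r: "r \<in> carrier ?M" using M.factors_closed[OF fr(3) fs] .
    obtain s a b where s: "f = Poly_Mapping.single s a" "r = Poly_Mapping.single (t - s) b"
      "a \<noteq> 0" "b \<noteq> 0" "s \<in> S" "t - s \<in> S"
      using monomial_factors_in_carrier[OF f r fr(1) Cons.prems(3)] .
    obtain xs where xs: "set xs \<subseteq> S" "Divisibility.factors ?A xs (t - s)"
      using Cons.IH[OF fs fr(3)[unfolded s(2)] s(4)] by blast
    have "Divisibility.irreducible ?A s" using fr(2) unfolding s(1) irreducible_single_iff[OF s(5,3)] .
    then have "Divisibility.factors ?A (s # xs) t"
      using xs(2) by (auto simp: Divisibility.factors_def carr)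
    then show ?case using xs(1) s(5) by (intro exI[of _ "s # xs"]) auto
  qed
  have "\<exists>xs. set xs \<subseteq> S \<and> Divisibility.factors ?A xs t" if "t \<in> S" "t \<noteq> 0" for t
  proof -
    have "?m t \<in> carrier ?M - Units ?M"
      using that single_nonunit one_neq_zero by blast
    then obtain fs where fs: "set fs \<subseteq> carrier ?M" "Divisibility.factors ?M fs (?m t)"
      using ffm unfolding ffm_def atomic_monoid_def by blast
    show ?thesis by (rule lift[OF fs one_neq_zero])
  qed
  moreover have "finite {d \<in> S. Divisibility.irreducible ?A d \<and> d divides\<^bsub>?A\<^esub> t}" (is "finite ?D")
    if t: "t \<in> S" "t \<noteq> 0" for t
  proof -
    have tM: "?m t \<in> carrier ?M - Units ?M"
      using t single_nonunit one_neq_zero by blast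
    have "?m ` ?D \<subseteq> {d \<in> carrier ?M. Divisibility.irreducible ?M d \<and> d divides\<^bsub>?M\<^esub> ?m t}"
    proof
      fix P assume "P \<in> ?m ` ?D"
      then obtain d where d: "P = ?m d" "d \<in> S" "Divisibility.irreducible ?A d" "t - d \<in> S"
        using divides_additive_monoid[OF S] by blast
      have "?m d \<in> carrier ?M" using d(2) single_in_carrier one_neq_zero by blast
      moreover have "Divisibility.irreducible ?M (?m d)"
        using d(3) irreducible_single_iff[OF d(2) one_neq_zero] by blast
      moreover have "?m d divides\<^bsub>?M\<^esub> ?m t"
        using d(4) divides_single[OF one_neq_zero one_neq_zero] by blast
      ultimately show "P \<in> {d \<in> carrier ?M. Divisibility.irreducible ?M d \<and> d divides\<^bsub>?M\<^esub> ?m t}"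
        using d(1) by blast
    qed
    moreover have "finite (assocs ?M ` {d \<in> carrier ?M. Divisibility.irreducible ?M d \<and> d divides\<^bsub>?M\<^esub> ?m t})"
      using ffm tM unfolding ffm_def by blast
    ultimately have "finite (assocs ?M ` ?m ` ?D)" by (meson finite_subset image_mono)
    moreover have "inj_on (\<lambda>d. assocs ?M (?m d)) ?D"
    proof (rule inj_onI)
      fix d e assume de: "d \<in> ?D" "e \<in> ?D" "assocs ?M (?m d) = assocs ?M (?m e)"
      have "?m d \<in> carrier ?M" "?m e \<in> carrier ?M"
        using de(1,2) single_in_carrier one_neq_zero by blast+
      then have "?m d \<sim>\<^bsub>?M\<^esub> ?m e" using M.assocs_eq_iff de(3) by blast
      then have "d - e \<in> S" "e - d \<in> S"
        using divides_single[OF one_neq_zero one_neq_zero] unfolding associated_def by blast+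
      then show "d = e" using puiseuxD(2)[OF S, of "d - e"] puiseuxD(2)[OF S, of "e - d"] by simp
    qed
    ultimately show ?thesis unfolding image_image by (rule finite_imageD)
  qed
  ultimately show ?thesis
    unfolding ffm_def atomic_monoid_def carr Units_additive_monoid[OF S]
    using A.comm_monoid_cancel_axioms by blast
qed

text \<open>The finite set \<open>T\<close> of exponents places all divisors and cofactors at one
  level. There, factoriality is used through roots: a divisor is fixed up to a constant by its
  multiset of roots in the closure, a submultiset of that of \<open>\<psi>\<close>.\<close>

lemma ffm_nonzero_algebra_if_ffm:
  assumes K: "finitely_generated_field TYPE('k::field_char_0)" and ffm: "ffm (additive_monoid S)"
  shows "ffm (nonzero_algebra S :: (rat \<Rightarrow>\<^sub>0 'k) monoid)"
proof -
  let ?M = "nonzero_algebra S :: (rat \<Rightarrow>\<^sub>0 'k) monoid"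
  interpret M: comm_monoid_cancel ?M by (rule comm_monoid_cancel_nonzero_algebra)
  show ?thesis
  proof (rule M.ffm_if_finite_divisors)
    fix f assume "f \<in> carrier ?M"
    then have f: "Poly_Mapping.keys f \<subseteq> S" "f \<noteq> 0" by auto
    let ?D = "{G \<in> carrier ?M. G divides\<^bsub>?M\<^esub> f}"
    obtain T where T: "finite T" "T \<subseteq> S" "\<And>G H. Poly_Mapping.keys G \<subseteq> S \<Longrightarrow> Poly_Mapping.keys H \<subseteq> S \<Longrightarrow>
      G * H = f \<Longrightarrow> Poly_Mapping.keys G \<subseteq> T"
      using factor_supports_finite[OF S K finite_divisors_if_ffm[OF S ffm] f(2,1)] by metis
    have "\<And>s. s \<in> T \<union> Poly_Mapping.keys f \<Longrightarrow> s \<ge> 0" using T(2) f(1) puiseuxD(2)[OF S] by blast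
    then obtain n where n: "n > 0" "T \<union> Poly_Mapping.keys f \<subseteq> level n"
      using common_level[of "T \<union> Poly_Mapping.keys f"] T(1) by auto
    obtain \<psi> where \<psi>: "root_poly n \<psi> = f" using root_poly_surj[OF n(1), of f] n(2) by auto
    have \<psi>0: "\<psi> \<noteq> 0" using \<psi> f(2) by auto
    have div: "\<exists>g h. root_poly n g = G \<and> g \<noteq> 0 \<and> h \<noteq> 0 \<and> \<psi> = g * h" if "G \<in> ?D" for G
    proof -
      obtain H where H: "Poly_Mapping.keys G \<subseteq> S" "Poly_Mapping.keys H \<subseteq> S" "f = G * H"
        using \<open>G \<in> ?D\<close> by (auto simp only: divides_nonzero_algebra nonzero_algebra_simps mem_Collect_eq)
      have "Poly_Mapping.keys G \<subseteq> T" "Poly_Mapping.keys H \<subseteq> T"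
        using T(3)[of G H] T(3)[of H G] H by (auto simp: mult.commute)
      then obtain g h where gh: "root_poly n g = G" "root_poly n h = H"
        using root_poly_surj[OF n(1), of G] root_poly_surj[OF n(1), of H] n(2) by blast
      have "root_poly n (g * h) = root_poly n \<psi>" by (simp add: root_poly_mult gh \<psi> H(3))
      then have "\<psi> = g * h" using root_poly_inj[OF n(1)] by metis
      then show ?thesis using gh \<psi>0 by auto
    qed
    \<comment> \<open>The choice is unambiguous for divisors of \<open>f\<close>, because
      \<open>root_poly n\<close> is injective.\<close>
    define code where "code G = proots (map_poly to_ac (SOME g. root_poly n g = G))" for G :: "rat \<Rightarrow>\<^sub>0 'k"
    have code: "code (root_poly n g) = proots (map_poly to_ac g)" for g
      unfolding code_def using root_poly_inj[OF n(1)] by (metis (mono_tags, lifting) someI)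
    show "finite (assocs ?M ` ?D)"
    proof (rule finite_assocs_image[OF M.comm_monoid_cancel_axioms])
      show "?D \<subseteq> carrier ?M" by blast
      have "code ` ?D \<subseteq> {A. A \<subseteq># proots (map_poly to_ac \<psi>)}"
      proof
        fix A assume "A \<in> code ` ?D"
        then obtain G where G: "G \<in> ?D" "A = code G" by blast
        obtain g h where gh: "root_poly n g = G" "g \<noteq> 0" "h \<noteq> 0" "\<psi> = g * h" using div[OF G(1)] by blast
        have "proots (map_poly to_ac \<psi>) = proots (map_poly to_ac g) + proots (map_poly to_ac h)"
          using gh(2,3) by (simp add: gh(4) to_ac_poly_hom.hom_mult proots_mult)
        then show "A \<in> {A. A \<subseteq># proots (map_poly to_ac \<psi>)}"
          using code[of g] by (simp add: G(2) gh(1))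
      qed
      then show "finite (code ` ?D)" by (rule finite_subset[OF _ finite_submultisets])
      fix G G' assume G: "G \<in> ?D" "G' \<in> ?D" and eq: "code G = code G'"
      obtain g where g: "root_poly n g = G" "g \<noteq> 0" using div[OF G(1)] by blast
      obtain g' where g': "root_poly n g' = G'" "g' \<noteq> 0" using div[OF G(2)] by blast
      define P where "P = (\<Prod>x\<in>#code G. [:- x, 1:])"
      \<comment> \<open>Equal root multisets make the polynomials proportional over the closure. The
        ratio of leading coefficients lies in the base field, so it gives a unit of the monoid
        algebra.\<close>
      define c where "c = lead_coeff g / lead_coeff g'"
      have c: "c \<noteq> 0" using g(2) g'(2) by (simp add: c_def)
      have P1: "map_poly to_ac g = smult (to_ac (lead_coeff g)) P"
        using alg_closed_proots(1)[of "map_poly to_ac g"] g code[of g] unfolding P_def by simp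
      have P2: "map_poly to_ac g' = smult (to_ac (lead_coeff g')) P"
        using alg_closed_proots(1)[of "map_poly to_ac g'"] g' code[of g'] unfolding P_def eq by simp
      have "map_poly to_ac (smult c g') = smult (to_ac c) (map_poly to_ac g')"
        by (simp add: hom_distribs)
      also have "\<dots> = smult (to_ac (c * lead_coeff g')) P" unfolding P2 by simp
      also have "c * lead_coeff g' = lead_coeff g" using g'(2) by (simp add: c_def)
      finally have "map_poly to_ac (smult c g') = map_poly to_ac g" unfolding P1 .
      then have "smult c g' = g" by (rule to_ac_poly_hom.injectivity)
      then have "G = G' * Poly_Mapping.single 0 c"
        unfolding g(1)[symmetric] g'(1)[symmetric] by (metis root_poly_smult mult.commute)
      moreover have "Poly_Mapping.single 0 c \<in> Units ?M" using c single_in_Units_iff by blast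
      ultimately show "G \<sim>\<^bsub>?M\<^esub> G'" using G(2)
        by (intro M.associatedI2[of "Poly_Mapping.single 0 c"]) simp_all
    qed
  qed
qed

end

theorem theorem3p2:
  fixes S :: "rat set"
  assumes "finitely_generated_field TYPE('k::field_char_0)"
    and "puiseux_monoid S"
  shows "ffd (monoid_algebra S :: (rat \<Rightarrow>\<^sub>0 'k) ring) \<longleftrightarrow> ffm (additive_monoid S)"
  unfolding ffd_def
  using domain_monoid_algebra[OF assms(2)] ffm_if_ffm_nonzero_algebra[OF assms(2)]
    ffm_nonzero_algebra_if_ffm[OF assms(2,1)] by blast

end
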